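(* Let $\mathcal T$ be a rooted metric tree with compact core and finitely many attached half-lines, equipped with the Gaussian measure $\mu$ (all as in the context). The self-adjoint operator on $L^2_\mu(\mathcal T)$ associated with the form $\mathfrak a^{\mathrm D}$ is precisely the Dirichlet realisation $\mathcal A^{\mathrm D}$ of the Ornstein–Uhlenbeck operator. Likewise, the self-adjoint operator associated with $\mathfrak a^{\mathrm N}$ is precisely the Neumann realisation $\mathcal A^{\mathrm N}$.
   Context: Tree. Let $\widetilde{\mathcal T}$ be a compact rooted metric tree (a finite tree whose edges have finite positive lengths) with vertex set $\mathsf V$ and root $\mathsf o\in\mathsf V$; let $\mathsf L\subset\mathsf V\setminus\{\mathsf o\}$, assumed nonempty, be the set of its leaves (vertices of degree one, excluding the root). $\mathcal T$ is obtained from $\widetilde{\mathcal T}$ by attaching to each vertex of $\mathsf L$ a finite non-zero number of half-lines. $\mathsf E$ is the edge set of $\mathcal T$ (including half-lines); the vertex set of $\mathcal T$ is $\mathsf V$. For $x\in\mathcal T$ (any point on an edge), $|x|$ is the path distance from $x$ to $\mathsf o$. Each edge is parametrised by arc length in the direction away from the root, and $f'$ denotes the (weak) derivative in this coordinate. The normal derivative of $f$ at a vertex $\mathsf v$ along an edge $\mathsf e$ incident to $\mathsf v$ (written $\mathsf e\sim\mathsf v$), pointing away from $\mathsf v$ into $\mathsf e$, is $\frac{\partial f_{\mathsf e}}{\partial n}(\mathsf v)=f_{\mathsf e}'$ at $\mathsf v$ if $\mathsf e$ starts at $\mathsf v$, and $-f'_{\mathsf e}$ at $\mathsf v$ if $\mathsf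 e$ terminates at $\mathsf v$. Spaces. $\mu(\mathrm dx)=G(x)\,\mathrm dx$ with $G(x)=\frac{2}{\sqrt\pi}e^{-|x|^2}$ and $\mathrm dx$ Lebesgue measure on edges. $L^2_\mu(\mathcal T)=\bigoplus_{\mathsf e\in\mathsf E}L^2_\mu(\mathsf e)$, $\widetilde{H^k_\mu}(\mathcal T)=\bigoplus_{\mathsf e\in\mathsf E}H^k_\mu(\mathsf e)$ (edgewise weak derivatives up to order $k$ in $L^2_\mu$), $H^1_\mu(\mathcal T)=\widetilde{H^1_\mu}(\mathcal T)\cap C(\mathcal T)$, $H^1_{0,\mu}(\mathcal T)=\{f\in H^1_\mu(\mathcal T): f(\mathsf o)=0\}$. Operators. $(\mathcal Af)(x)=-\frac12 f''(x)+|x|f'(x)$ on edges. Standard conditions at $\mathsf v$: $f$ is continuous at $\mathsf v$ and $\sum_{\mathsf e\sim\mathsf v}\frac{\partial f_{\mathsf e}}{\partial n}(\mathsf v)=0$. $\mathcal A^{\mathrm D}$ is $\mathcal A$ with domain $\{f\in\widetilde{H^2_\mu}(\mathcal T): f(\mathsf o)=0,\ f$ satisfies the standard conditions at all $\mathsf v\in\mathsf V\setminus\{\mathsf o\}\}$. $\mathcal A^{\mathrm N}$ is $\mathcal A$ with domain $\{f\in\widetilde{H^2_\mu}(\mathcal T): f$ satisfies the standard conditions at all $\mathsf v\in\mathsf V\}$. Forms. $\mathfrak a(f,g)=\frac12\int_{\mathcal T}f'\,\overline{g'}\,\mathrm d\mu$; $\mathfrak a^{\mathrm D}$ is $\mathfrak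 a$ with domain $H^1_{0,\mu}(\mathcal T)$ and $\mathfrak a^{\mathrm N}$ is $\mathfrak a$ with domain $H^1_\mu(\mathcal T)$. The operator $B$ associated with a form $(\mathfrak q,\operatorname{dom}\mathfrak q)$ has domain $\{f\in\operatorname{dom}\mathfrak q:\exists g\in L^2_\mu(\mathcal T)$ with $\mathfrak q(f,h)=\langle g,h\rangle_{L^2_\mu(\mathcal T)}$ for all $h\in\operatorname{dom}\mathfrak q\}$ and $Bf=g$. *)

theory Defs
  imports "HOL-Analysis.Analysis" "Graph_Theory.Graph_Theory"
begin

section \<open>Rooted metric trees with half-lines\<close>

text \<open>
  The compact tree is the digraph \<open>core\<close>, every edge being oriented away from the root;
  \<open>len\<close> gives the edge lengths. \<open>halflines\<close> is the set of (labels of) attached half-lines and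
  \<open>foot\<close> maps a half-line to the vertex it is attached to.
\<close>

record ('v, 'e) tree =
  core :: "('v, 'e) pre_digraph"
  root :: 'v
  len :: "'e \<Rightarrow> real"
  halflines :: "'e set"
  foot :: "'e \<Rightarrow> 'v"

definition leaves :: "('v, 'e) tree \<Rightarrow> 'v set" where
  "leaves T = {v \<in> verts (core T) - {root T}. in_degree (core T) v + out_degree (core T) v = 1}"

text \<open>
  A finite digraph is a tree with all edges pointing away from the root iff there is
  exactly one directed walk from the root to each vertex.
\<close>

locale metric_tree = core: fin_digraph "core T" for T :: "('v, 'e) tree" +
  assumes root_in_verts: "root T \<in> verts (core T)"
    and unique_walk: "\<And>v. v \<in> verts (core T) \<Longrightarrow> \<exists>!p. pre_digraph.awalk (core T) (root T) p v"
    and len_pos: "\<And>e. e \<in> arcs (core T) \<Longrightarrow> 0 < len T e"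
    and leaves_nonempty: "leaves T \<noteq> {}"
    and finite_halflines: "finite (halflines T)"
    and halflines_disjoint: "halflines T \<inter> arcs (core T) = {}"
    and halflines_at_leaves: "foot T ` halflines T = leaves T"

definition edges :: "('v, 'e) tree \<Rightarrow> 'e set" where
  "edges T = arcs (core T) \<union> halflines T"

definition start :: "('v, 'e) tree \<Rightarrow> 'e \<Rightarrow> 'v" where
  "start T e = (if e \<in> halflines T then foot T e else tail (core T) e)"

definition incident :: "('v, 'e) tree \<Rightarrow> 'v \<Rightarrow> 'e set" where
  "incident T v = {e \<in> edges T. start T e = v \<or> (e \<in> arcs (core T) \<and> head (core T) e = v)}"

definition open_edge :: "('v, 'e) tree \<Rightarrow> 'e \<Rightarrow> real set" where
  "open_edge T e = (if e \<in> halflines T then {0<..} else {0<..<len T e})"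

definition closed_edge :: "('v, 'e) tree \<Rightarrow> 'e \<Rightarrow> real set" where
  "closed_edge T e = (if e \<in> halflines T then {0..} else {0..len T e})"

text \<open>The arc length coordinate on \<open>e\<close> of a vertex \<open>v\<close> incident to \<open>e\<close>.\<close>

definition end_coord :: "('v, 'e) tree \<Rightarrow> 'e \<Rightarrow> 'v \<Rightarrow> real" where
  "end_coord T e v = (if start T e = v then 0 else len T e)"

definition vertex_dist :: "('v, 'e) tree \<Rightarrow> 'v \<Rightarrow> real" where
  "vertex_dist T v = sum_list (map (len T) (THE p. pre_digraph.awalk (core T) (root T) p v))"

text \<open>\<open>|x|\<close> for the point \<open>x\<close> with coordinate \<open>t\<close> on the edge \<open>e\<close>.\<close>

definition root_dist :: "('v, 'e) tree \<Rightarrow> 'e \<Rightarrow> real \<Rightarrow> real" where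
  "root_dist T e t = vertex_dist T (start T e) + t"


section \<open>The Gaussian \<open>L\<^sup>2\<close> space\<close>

definition gauss_edge :: "('v, 'e) tree \<Rightarrow> 'e \<Rightarrow> real measure" where
  "gauss_edge T e = density (restrict_space lborel (open_edge T e))
     (\<lambda>t. ennreal (2 / sqrt pi * exp (- (root_dist T e t)\<^sup>2)))"

text \<open>
  A function on the tree is a family of complex functions indexed by the edges, in the arc
  length coordinate; only its values on the open edges matter. Elements of \<open>L\<^sup>2\<close> are represented
  by functions, two of which represent the same element iff they satisfy \<open>ae_eq\<close>.
\<close>

type_synonym 'e tree_fun = "'e \<Rightarrow> real \<Rightarrow> complex"

definition square_int :: "real measure \<Rightarrow> (real \<Rightarrow> complex) set" where
  "square_int M = {u \<in> borel_measurable M. integrable M (\<lambda>t. (cmod (u t))\<^sup>2)}"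

definition L2 :: "('v, 'e) tree \<Rightarrow> 'e tree_fun set" where
  "L2 T = {f. \<forall>e\<in>edges T. f e \<in> square_int (gauss_edge T e)}"

definition ae_eq :: "('v, 'e) tree \<Rightarrow> 'e tree_fun \<Rightarrow> 'e tree_fun \<Rightarrow> bool" where
  "ae_eq T f g \<longleftrightarrow> (\<forall>e\<in>edges T. AE t in gauss_edge T e. f e t = g e t)"

definition inner_L2 :: "('v, 'e) tree \<Rightarrow> 'e tree_fun \<Rightarrow> 'e tree_fun \<Rightarrow> complex" where
  "inner_L2 T f g = (\<Sum>e\<in>edges T. LINT t|gauss_edge T e. f e t * cnj (g e t))"

definition norm_L2 :: "('v, 'e) tree \<Rightarrow> 'e tree_fun \<Rightarrow> real" where
  "norm_L2 T f = sqrt (Re (inner_L2 T f f))"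


section \<open>Weak derivatives and Sobolev spaces\<close>

definition test_functions :: "real set \<Rightarrow> (real \<Rightarrow> real) set" where
  "test_functions I = {\<phi>. (\<forall>n x. (deriv ^^ n) \<phi> differentiable (at x)) \<and>
     (\<exists>K. compact K \<and> K \<subseteq> I \<and> (\<forall>x. x \<notin> K \<longrightarrow> \<phi> x = 0))}"

definition locally_integrable :: "real set \<Rightarrow> (real \<Rightarrow> complex) \<Rightarrow> bool" where
  "locally_integrable I u \<longleftrightarrow> (\<forall>a b. {a..b} \<subseteq> I \<longrightarrow> set_integrable lborel {a..b} u)"

definition has_weak_deriv :: "real set \<Rightarrow> nat \<Rightarrow> (real \<Rightarrow> complex) \<Rightarrow> (real \<Rightarrow> complex) \<Rightarrow> bool" where
  "has_weak_deriv I k u w \<longleftrightarrow> locally_integrable I u \<and> locally_integrable I w \<and>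
     (\<forall>\<phi>\<in>test_functions I.
        (LINT x:I|lborel. (deriv ^^ k) \<phi> x *\<^sub>R u x) = (-1) ^ k * (LINT x:I|lborel. \<phi> x *\<^sub>R w x))"

text \<open>The edgewise weak derivative of order \<open>k\<close>; it is determined up to \<open>ae_eq\<close>.\<close>

definition wderiv :: "('v, 'e) tree \<Rightarrow> nat \<Rightarrow> 'e tree_fun \<Rightarrow> 'e tree_fun" where
  "wderiv T k f = (\<lambda>e. SOME w. has_weak_deriv (open_edge T e) k (f e) w)"

definition edge_sobolev :: "('v, 'e) tree \<Rightarrow> nat \<Rightarrow> 'e \<Rightarrow> (real \<Rightarrow> complex) set" where
  "edge_sobolev T k e = {u \<in> square_int (gauss_edge T e).
     \<forall>j\<in>{1..k}. \<exists>w \<in> square_int (gauss_edge T e). has_weak_deriv (open_edge T e) j u w}"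

text \<open>The space \<open>H\<^sup>k\<close> with a tilde, i.e. without conditions at the vertices.\<close>

definition sobolev_tilde :: "('v, 'e) tree \<Rightarrow> nat \<Rightarrow> 'e tree_fun set" where
  "sobolev_tilde T k = {f. \<forall>e\<in>edges T. f e \<in> edge_sobolev T k e}"

text \<open>
  Values at vertices are those of the continuous representative on the closed edge, which is
  unique there when it exists.
\<close>

definition is_cont_rep :: "('v, 'e) tree \<Rightarrow> 'e \<Rightarrow> (real \<Rightarrow> complex) \<Rightarrow> (real \<Rightarrow> complex) \<Rightarrow> bool" where
  "is_cont_rep T e u \<phi> \<longleftrightarrow>
     continuous_on (closed_edge T e) \<phi> \<and> (AE t in gauss_edge T e. \<phi> t = u t)"

definition vertex_value :: "('v, 'e) tree \<Rightarrow> 'e tree_fun \<Rightarrow> 'e \<Rightarrow> 'v \<Rightarrow> complex" where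
  "vertex_value T f e v = (SOME \<phi>. is_cont_rep T e (f e) \<phi>) (end_coord T e v)"

definition continuous_at_vertex :: "('v, 'e) tree \<Rightarrow> 'e tree_fun \<Rightarrow> 'v \<Rightarrow> bool" where
  "continuous_at_vertex T f v \<longleftrightarrow>
     (\<forall>e\<in>incident T v. \<forall>e'\<in>incident T v. vertex_value T f e v = vertex_value T f e' v)"

definition continuous_funs :: "('v, 'e) tree \<Rightarrow> 'e tree_fun set" where
  "continuous_funs T = {f. (\<forall>e\<in>edges T. \<exists>\<phi>. is_cont_rep T e (f e) \<phi>) \<and>
     (\<forall>v\<in>verts (core T). continuous_at_vertex T f v)}"

definition zero_at_root :: "('v, 'e) tree \<Rightarrow> 'e tree_fun \<Rightarrow> bool" where
  "zero_at_root T f \<longleftrightarrow> (\<forall>e\<in>incident T (root T). vertex_value T f e (root T) = 0)"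

definition H1 :: "('v, 'e) tree \<Rightarrow> 'e tree_fun set" where
  "H1 T = sobolev_tilde T 1 \<inter> continuous_funs T"

definition H1_0 :: "('v, 'e) tree \<Rightarrow> 'e tree_fun set" where
  "H1_0 T = {f \<in> H1 T. zero_at_root T f}"

definition normal_deriv :: "('v, 'e) tree \<Rightarrow> 'e tree_fun \<Rightarrow> 'e \<Rightarrow> 'v \<Rightarrow> complex" where
  "normal_deriv T f e v =
     (if start T e = v then vertex_value T (wderiv T 1 f) e v
      else - vertex_value T (wderiv T 1 f) e v)"

definition standard_conditions :: "('v, 'e) tree \<Rightarrow> 'e tree_fun \<Rightarrow> 'v \<Rightarrow> bool" where
  "standard_conditions T f v \<longleftrightarrow>
     continuous_at_vertex T f v \<and> (\<Sum>e\<in>incident T v. normal_deriv T f e v) = 0"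


section \<open>Operators in \<open>L\<^sup>2\<close>\<close>

text \<open>
  An operator is represented by its graph, the set of all pairs of functions \<open>(f, g)\<close> such that
  (the class of) \<open>f\<close> is in the domain and is mapped to (the class of) \<open>g\<close>.
\<close>

type_synonym 'e graph = "('e tree_fun \<times> 'e tree_fun) set"

definition L2_operator :: "('v, 'e) tree \<Rightarrow> 'e graph \<Rightarrow> bool" where
  "L2_operator T A \<longleftrightarrow>
     A \<noteq> {} \<and> A \<subseteq> L2 T \<times> L2 T \<and>
     (\<forall>f g f' g'. (f, g) \<in> A \<longrightarrow> f' \<in> L2 T \<longrightarrow> g' \<in> L2 T \<longrightarrow> ae_eq T f f' \<longrightarrow> ae_eq T g g' \<longrightarrow>
        (f', g') \<in> A) \<and>
     (\<forall>f g g'. (f, g) \<in> A \<longrightarrow> (f, g') \<in> A \<longrightarrow> ae_eq T g g') \<and>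
     (\<forall>f g f' g' a b. (f, g) \<in> A \<longrightarrow> (f', g') \<in> A \<longrightarrow>
        (\<lambda>e t. a * f e t + b * f' e t, \<lambda>e t. a * g e t + b * g' e t) \<in> A)"

definition densely_defined :: "('v, 'e) tree \<Rightarrow> 'e graph \<Rightarrow> bool" where
  "densely_defined T A \<longleftrightarrow>
     (\<forall>f\<in>L2 T. \<forall>\<epsilon>>0. \<exists>h\<in>Domain A. norm_L2 T (\<lambda>e t. f e t - h e t) < \<epsilon>)"

definition adjoint_op :: "('v, 'e) tree \<Rightarrow> 'e graph \<Rightarrow> 'e graph" where
  "adjoint_op T A = {(g, g') \<in> L2 T \<times> L2 T. \<forall>(f, f')\<in>A. inner_L2 T f' g = inner_L2 T f g'}"

definition self_adjoint :: "('v, 'e) tree \<Rightarrow> 'e graph \<Rightarrow> bool" where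
  "self_adjoint T A \<longleftrightarrow> L2_operator T A \<and> densely_defined T A \<and> adjoint_op T A = A"

definition associated_op ::
    "('v, 'e) tree \<Rightarrow> ('e tree_fun \<Rightarrow> 'e tree_fun \<Rightarrow> complex) \<Rightarrow> 'e tree_fun set \<Rightarrow> 'e graph" where
  "associated_op T q W =
     {(f, g). f \<in> W \<and> g \<in> L2 T \<and> (\<forall>h\<in>W. q f h = inner_L2 T g h)}"


section \<open>The form and the realisations of the Ornstein--Uhlenbeck operator\<close>

definition OU_form :: "('v, 'e) tree \<Rightarrow> 'e tree_fun \<Rightarrow> 'e tree_fun \<Rightarrow> complex" where
  "OU_form T f g = 1 / 2 * inner_L2 T (wderiv T 1 f) (wderiv T 1 g)"

definition OU_expr :: "('v, 'e) tree \<Rightarrow> 'e tree_fun \<Rightarrow> 'e tree_fun" where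
  "OU_expr T f = (\<lambda>e t. - (1 / 2) * wderiv T 2 f e t + of_real (root_dist T e t) * wderiv T 1 f e t)"

text \<open>
  That the Ornstein--Uhlenbeck expression maps \<open>W\<close> into \<open>L\<^sup>2\<close> is deliberately not required here,
  so that the domain of the resulting graph is all of \<open>W\<close>.
\<close>

definition OU_realisation :: "('v, 'e) tree \<Rightarrow> 'e tree_fun set \<Rightarrow> 'e graph" where
  "OU_realisation T W =
     {(f, g). f \<in> W \<and> (\<forall>e\<in>edges T. g e \<in> borel_measurable (gauss_edge T e)) \<and>
        ae_eq T g (OU_expr T f)}"

definition dirichlet_dom :: "('v, 'e) tree \<Rightarrow> 'e tree_fun set" where
  "dirichlet_dom T = {f \<in> sobolev_tilde T 2. zero_at_root T f \<and>
     (\<forall>v\<in>verts (core T) - {root T}. standard_conditions T f v)}"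

definition neumann_dom :: "('v, 'e) tree \<Rightarrow> 'e tree_fun set" where
  "neumann_dom T = {f \<in> sobolev_tilde T 2. \<forall>v\<in>verts (core T). standard_conditions T f v}"

definition A_D :: "('v, 'e) tree \<Rightarrow> 'e graph" where
  "A_D T = OU_realisation T (dirichlet_dom T)"

definition A_N :: "('v, 'e) tree \<Rightarrow> 'e graph" where
  "A_N T = OU_realisation T (neumann_dom T)"

end

theory Submission
  imports Defs "HOL-Probability.Distributions"
begin

text \<open>
  Fix a set \<open>D\<close> of vertices and let \<open>A\<close> be the realisation with Dirichlet conditions on \<open>D\<close> and standard
  conditions at all other vertices; \<open>D\<close> is \<open>{root T}\<close> or empty in the theorem. By Green's formula \<open>A\<close> is a
  restriction of the operator associated with the form, and since the form is symmetric this operator is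
  a restriction of the adjoint of \<open>A\<close>. Hence everything follows once the adjoint of \<open>A\<close> is contained in \<open>A\<close>;
  neither completeness of the form domain nor a representation theorem is needed.

  Let \<open>(g, k)\<close> be in the adjoint. Testing with smooth functions supported inside an edge shows that
  \<open>G g'\<close> is a primitive of \<open>- 2 G k\<close>, where \<open>G\<close> is the Gaussian weight (du Bois-Reymond's lemma of second
  order). On half-lines, estimates with cutoff functions give that \<open>g'\<close> and \<open>x g'\<close>, and therefore \<open>g''\<close>,
  are in the weighted \<open>L\<^sup>2\<close> space. The vertex conditions are recovered from Green's formula by testing with
  functions that are cubic polynomials on the compact edges and affine on the half-lines, since
  these attain arbitrary values and normal derivatives at the vertices.
\<close>

text \<open>The graph of the realisation is built from Hilbert choices of weak derivatives and
  continuous representatives. The proof works instead with explicit triples \<open>F\<close>,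
  \<open>p\<close>, \<open>q\<close> of a function and its two derivatives, each a primitive of the
  next up to the ends of the edge, and shows that the choices agree with them.

  Of an element \<open>g\<close> of the adjoint only square integrability is known. On a half-line
  the flux \<open>G g'\<close> has a known derivative, but neither \<open>g'\<close> nor
  \<open>x g'\<close> is known to be square integrable, and the boundary term at a far point has the
  wrong sign or none. Hence the order: first \<open>g'\<close>, paired with \<open>g\<close>; then
  \<open>x g'\<close>, where the derivative \<open>2 x / G\<close> of \<open>1 / G\<close> supplies
  the dominating term; then \<open>g''\<close> from the equation.

  The conditions at a vertex separate from the rest because the Gaussian weight has one value there,
  common to all its edges.\<close>

section \<open>Primitives of integrable functions\<close>

text \<open>
  \<open>F\<close> is locally absolutely continuous on \<open>J\<close> with derivative \<open>D\<close>. Only the class of \<open>D\<close> modulo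
  null sets matters, whereas \<open>F\<close> is the continuous representative.
\<close>

definition ac_deriv :: "real set \<Rightarrow> (real \<Rightarrow> complex) \<Rightarrow> (real \<Rightarrow> complex) \<Rightarrow> bool" where
  "ac_deriv J F D \<longleftrightarrow> (\<forall>a b. a \<le> b \<longrightarrow> {a..b} \<subseteq> J \<longrightarrow>
     set_integrable lborel {a..b} D \<and> (LINT x:{a..b}|lborel. D x) = F b - F a)"

lemma ac_derivD:
  assumes "ac_deriv J F D" "a \<le> b" "{a..b} \<subseteq> J"
  shows "set_integrable lborel {a..b} D" "(LINT x:{a..b}|lborel. D x) = F b - F a"
  using assms unfolding ac_deriv_def by auto

lemma ac_deriv_subset: "ac_deriv J F D \<Longrightarrow> K \<subseteq> J \<Longrightarrow> ac_deriv K F D"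
  unfolding ac_deriv_def by blast

lemma ac_deriv_continuous_Icc:
  assumes "ac_deriv J F D" "{a..b} \<subseteq> J"
  shows "continuous_on {a..b} F"
proof (cases "a \<le> b")
  case True
  have eq: "F x = F a + integral {a..x} D" if "x \<in> {a..b}" for x
  proof -
    have "a \<le> x" "{a..x} \<subseteq> J" using that assms(2) by auto
    then show ?thesis
      using ac_derivD[OF assms(1) \<open>a \<le> x\<close>] set_borel_integral_eq_integral(2)[of "{a..x}" D]
      by (simp add: algebra_simps)
  qed
  have "D integrable_on {a..b}"
    using ac_derivD(1)[OF assms(1) True assms(2)] set_borel_integral_eq_integral(1) by blast
  then have "continuous_on {a..b} (\<lambda>x. F a + integral {a..x} D)"
    by (intro continuous_intros indefinite_integral_continuous_1)
  then show ?thesis by (rule continuous_on_eq) (rule eq[symmetric])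
qed simp

lemma set_integrable_mult_continuous:
  fixes D h :: "real \<Rightarrow> complex"
  assumes "set_integrable lborel {a..b} D" "continuous_on {a..b} h"
  shows "set_integrable lborel {a..b} (\<lambda>x. D x * h x)"
proof -
  obtain B where B: "\<And>x. x \<in> {a..b} \<Longrightarrow> norm (h x) \<le> B"
    using compact_imp_bounded[OF compact_continuous_image[OF assms(2) compact_Icc]]
    unfolding bounded_iff by blast
  have m: "(\<lambda>x. indicator {a..b} x *\<^sub>R h x) \<in> borel_measurable lborel"
    using borel_measurable_continuous_on_indicator[OF _ assms(2)] by simp
  have "integrable lborel (\<lambda>x. (indicator {a..b} x *\<^sub>R D x) * (indicator {a..b} x *\<^sub>R h x))"
  proof (rule Bochner_Integration.integrable_bound)
    show "integrable lborel (\<lambda>x. B *\<^sub>R (indicator {a..b} x *\<^sub>R D x))"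
      using assms(1) unfolding set_integrable_def by (rule integrable_scaleR_right)
    show "(\<lambda>x. (indicator {a..b} x *\<^sub>R D x) * (indicator {a..b} x *\<^sub>R h x)) \<in> borel_measurable lborel"
      using assms(1) m unfolding set_integrable_def by measurable
    show "AE x in lborel. norm ((indicator {a..b} x *\<^sub>R D x) * (indicator {a..b} x *\<^sub>R h x))
        \<le> norm (B *\<^sub>R (indicator {a..b} x *\<^sub>R D x))"
    proof (rule AE_I2)
      fix x
      show "norm ((indicator {a..b} x *\<^sub>R D x) * (indicator {a..b} x *\<^sub>R h x))
        \<le> norm (B *\<^sub>R (indicator {a..b} x *\<^sub>R D x))"
      proof (cases "x \<in> {a..b}")
        case True
        have "norm (h x) \<le> \<bar>B\<bar>" using B[OF True] by linarith
        then have "norm (D x) * norm (h x) \<le> norm (D x) * \<bar>B\<bar>" by (rule mult_left_mono) simp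
        then show ?thesis using True by (simp add: norm_mult mult.commute)
      qed (auto simp: indicator_def)
    qed
  qed
  then show ?thesis unfolding set_integrable_def
    by (rule back_subst[where P="integrable lborel"]) (auto simp: indicator_def)
qed

lemma integrable_lborel_product:
  fixes f g :: "real \<Rightarrow> complex"
  assumes [simp]: "integrable lborel f" "integrable lborel g"
  shows "integrable (lborel \<Otimes>\<^sub>M lborel) (\<lambda>(x, y). f x * g y)"
proof -
  have [measurable]: "f \<in> borel_measurable borel" "g \<in> borel_measurable borel"
    using assms[THEN borel_measurable_integrable] by simp_all
  show ?thesis
  proof (rule lborel_pair.Fubini_integrable)
    show "(\<lambda>(x, y). f x * g y) \<in> borel_measurable (lborel \<Otimes>\<^sub>M lborel)" by measurable
    show "integrable lborel (\<lambda>x. LBINT y. cmod (case (x, y) of (x, y) \<Rightarrow> f x * g y))"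
      by (simp add: norm_mult)
    show "AE x in lborel. integrable lborel (\<lambda>y. case (x, y) of (x, y) \<Rightarrow> f x * g y)"
      by simp
  qed
qed

text \<open>Fubini for \<open>D x * D' y\<close> on the square, split along the diagonal.\<close>

lemma ac_deriv_mult_Icc:
  assumes F: "ac_deriv {a..b} F D" and F': "ac_deriv {a..b} F' D'" and ab: "a \<le> b"
  shows "(LINT x:{a..b}|lborel. D x * F' x + F x * D' x) = F b * F' b - F a * F' a"
proof -
  define f where "f = (\<lambda>x. indicator {a..b} x *\<^sub>R D x)"
  define g where "g = (\<lambda>x. indicator {a..b} x *\<^sub>R D' x)"
  have f: "integrable lborel f" and g: "integrable lborel g"
    using ac_derivD(1)[OF F ab order_refl] ac_derivD(1)[OF F' ab order_refl]
    by (simp_all add: f_def g_def set_integrable_def)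
  have [measurable]: "f \<in> borel_measurable borel" "g \<in> borel_measurable borel"
    using f[THEN borel_measurable_integrable] g[THEN borel_measurable_integrable] by simp_all
  have int: "integral\<^sup>L lborel f = F b - F a" "integral\<^sup>L lborel g = F' b - F' a"
    using ac_derivD(2)[OF F ab order_refl] ac_derivD(2)[OF F' ab order_refl]
    by (simp_all add: f_def g_def set_lebesgue_integral_def)
  have part_g: "(LBINT y. indicator {..x} y *\<^sub>R g y) = F' x - F' a" if "x \<in> {a..b}" for x
  proof -
    have "(LBINT y. indicator {..x} y *\<^sub>R g y) = (LINT y:{a..x}|lborel. D' y)"
      unfolding set_lebesgue_integral_def g_def using that
      by (intro Bochner_Integration.integral_cong) (auto simp: indicator_def)
    then show ?thesis using ac_derivD(2)[OF F', of a x] that by auto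
  qed
  \<comment> \<open>Strict here, non-strict in \<open>part_g\<close>: the two regions must partition
    the square, with the diagonal counted once. The single point \<open>y\<close> is null, so the
    value is unaffected.\<close>
  have part_f: "(LBINT x. indicator {..<y} x *\<^sub>R f x) = F y - F a" if "y \<in> {a..b}" for y
  proof -
    have "(LBINT x. indicator {..<y} x *\<^sub>R f x) = (LBINT x. indicator {..y} x *\<^sub>R f x)"
      by (intro integral_cong_AE) (auto intro!: eventually_mono[OF AE_lborel_singleton[of y]] simp: indicator_def)
    also have "\<dots> = (LINT y:{a..y}|lborel. D y)"
      unfolding set_lebesgue_integral_def f_def using that
      by (intro Bochner_Integration.integral_cong) (auto simp: indicator_def)
    finally show ?thesis using ac_derivD(2)[OF F, of a y] that by auto
  qed
  have fg: "integrable (lborel \<Otimes>\<^sub>M lborel) (\<lambda>(x, y). f x * g y)"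
    by (rule integrable_lborel_product[OF f g])
  have le: "integrable (lborel \<Otimes>\<^sub>M lborel) (\<lambda>(x, y). indicator {..x} y *\<^sub>R (f x * g y))"
    by (rule Bochner_Integration.integrable_bound[OF fg])
      (auto simp: split_beta' indicator_def intro!: AE_I2)
  have gt: "integrable (lborel \<Otimes>\<^sub>M lborel) (\<lambda>(x, y). indicator {..<y} x *\<^sub>R (f x * g y))"
    by (rule Bochner_Integration.integrable_bound[OF fg])
      (auto simp: split_beta' indicator_def intro!: AE_I2)
  have A: "(LBINT y. LBINT x. indicator {..x} y *\<^sub>R (f x * g y)) = (LBINT x. f x * (F' x - F' a))"
  proof -
    have "(LBINT y. LBINT x. indicator {..x} y *\<^sub>R (f x * g y))
        = (LBINT x. LBINT y. indicator {..x} y *\<^sub>R (f x * g y))"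
      using lborel_pair.Fubini_integral[OF le] .
    also have "\<dots> = (LBINT x. f x * (LBINT y. indicator {..x} y *\<^sub>R g y))"
      by (intro Bochner_Integration.integral_cong refl)
        (simp only: mult_scaleR_right[symmetric] integral_mult_right_zero)
    also have "\<dots> = (LBINT x. f x * (F' x - F' a))"
    proof (intro Bochner_Integration.integral_cong refl)
      show "f x * (LBINT y. indicator {..x} y *\<^sub>R g y) = f x * (F' x - F' a)" for x
      proof (cases "x \<in> {a..b}")
        case True show ?thesis by (simp only: part_g[OF True])
      next
        case False then show ?thesis by (simp add: f_def)
      qed
    qed
    finally show ?thesis .
  qed
  have B: "(LBINT y. LBINT x. indicator {..<y} x *\<^sub>R (f x * g y)) = (LBINT y. (F y - F a) * g y)"
  proof -
    have "(LBINT y. LBINT x. indicator {..<y} x *\<^sub>R (f x * g y))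
         = (LBINT y. (LBINT x. indicator {..<y} x *\<^sub>R f x) * g y)"
      by (intro Bochner_Integration.integral_cong refl)
        (simp only: mult_scaleR_left[symmetric] integral_mult_left_zero)
    also have "\<dots> = (LBINT y. (F y - F a) * g y)"
    proof (intro Bochner_Integration.integral_cong refl)
      show "(LBINT x. indicator {..<y} x *\<^sub>R f x) * g y = (F y - F a) * g y" for y
      proof (cases "y \<in> {a..b}")
        case True show ?thesis by (simp only: part_f[OF True])
      next
        case False then show ?thesis by (simp add: g_def)
      qed
    qed
    finally show ?thesis .
  qed
  have cF: "continuous_on {a..b} F" "continuous_on {a..b} F'"
    using ac_deriv_continuous_Icc[OF F order_refl] ac_deriv_continuous_Icc[OF F' order_refl] .
  have "set_integrable lborel {a..b} (\<lambda>x. D x * F' x)" "set_integrable lborel {a..b} (\<lambda>x. D' x * F x)"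
    using set_integrable_mult_continuous[OF ac_derivD(1)[OF F ab order_refl] cF(2)]
      set_integrable_mult_continuous[OF ac_derivD(1)[OF F' ab order_refl] cF(1)] by auto
  then have ifF: "integrable lborel (\<lambda>x. f x * F' x)" "integrable lborel (\<lambda>x. F x * g x)"
    unfolding set_integrable_def f_def g_def by (simp_all add: mult.commute)
  have "(F b - F a) * (F' b - F' a) = (LBINT y. LBINT x. f x * g y)"
    by (simp add: int)
  also have "\<dots> = (LBINT y. LBINT x. indicator {..x} y *\<^sub>R (f x * g y) + indicator {..<y} x *\<^sub>R (f x * g y))"
    by (intro Bochner_Integration.integral_cong refl) (auto simp: indicator_def)
  also have "\<dots> = (LBINT y. LBINT x. indicator {..x} y *\<^sub>R (f x * g y)) + (LBINT y. LBINT x. indicator {..<y} x *\<^sub>R (f x * g y))"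
  proof -
    have s: "integrable (lborel \<Otimes>\<^sub>M lborel) (\<lambda>z. (case z of (x, y) \<Rightarrow> indicator {..x} y *\<^sub>R (f x * g y)) +
       (case z of (x, y) \<Rightarrow> indicator {..<y} x *\<^sub>R (f x * g y)))"
      using le gt by (rule Bochner_Integration.integrable_add)
    have "(LBINT y. LBINT x. indicator {..x} y *\<^sub>R (f x * g y) + indicator {..<y} x *\<^sub>R (f x * g y))
      = integral\<^sup>L (lborel \<Otimes>\<^sub>M lborel) (\<lambda>z. (case z of (x, y) \<Rightarrow> indicator {..x} y *\<^sub>R (f x * g y)) +
       (case z of (x, y) \<Rightarrow> indicator {..<y} x *\<^sub>R (f x * g y)))"
      using lborel_pair.integral_snd[of "\<lambda>x y. indicator {..x} y *\<^sub>R (f x * g y) + indicator {..<y} x *\<^sub>R (f x * g y)"] s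
      by (simp add: split_beta')
    also have "\<dots> = (LBINT y. LBINT x. indicator {..x} y *\<^sub>R (f x * g y)) + (LBINT y. LBINT x. indicator {..<y} x *\<^sub>R (f x * g y))"
      using lborel_pair.integral_snd[OF le] lborel_pair.integral_snd[OF gt] le gt by simp
    finally show ?thesis .
  qed
  also have "\<dots> = (LBINT x. f x * (F' x - F' a)) + (LBINT y. (F y - F a) * g y)"
    by (simp only: A B)
  also have "\<dots> = (LBINT x. f x * F' x) + (LBINT y. F y * g y) - (F b - F a) * F' a - F a * (F' b - F' a)"
    using ifF f g by (simp add: ring_distribs int)
  finally have "(LBINT x. f x * F' x) + (LBINT y. F y * g y) = F b * F' b - F a * F' a"
    by (simp add: algebra_simps)
  moreover have "(LINT x:{a..b}|lborel. D x * F' x + F x * D' x) = (LBINT x. f x * F' x + F x * g x)"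
    unfolding set_lebesgue_integral_def f_def g_def
    by (intro Bochner_Integration.integral_cong) (auto simp: indicator_def)
  ultimately show ?thesis using ifF by simp
qed

lemma ac_deriv_mult:
  assumes "ac_deriv J F D" "ac_deriv J F' D'"
  shows "ac_deriv J (\<lambda>x. F x * F' x) (\<lambda>x. D x * F' x + F x * D' x)"
  unfolding ac_deriv_def
proof (intro allI impI conjI)
  fix a b :: real assume ab: "a \<le> b" "{a..b} \<subseteq> J"
  have s: "ac_deriv {a..b} F D" "ac_deriv {a..b} F' D'"
    using assms ab ac_deriv_subset by blast+
  show "(LINT x:{a..b}|lborel. D x * F' x + F x * D' x) = F b * F' b - F a * F' a"
    by (rule ac_deriv_mult_Icc[OF s ab(1)])
  have "set_integrable lborel {a..b} (\<lambda>x. D x * F' x)" "set_integrable lborel {a..b} (\<lambda>x. D' x * F x)"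
    using set_integrable_mult_continuous[OF ac_derivD(1)[OF s(1) ab(1) order_refl] ac_deriv_continuous_Icc[OF s(2) order_refl]]
      set_integrable_mult_continuous[OF ac_derivD(1)[OF s(2) ab(1) order_refl] ac_deriv_continuous_Icc[OF s(1) order_refl]] by auto
  then show "set_integrable lborel {a..b} (\<lambda>x. D x * F' x + F x * D' x)"
    by (simp add: mult.commute set_integral_add(1))
qed

lemma ac_deriv_cnj: "ac_deriv J F D \<Longrightarrow> ac_deriv J (\<lambda>x. cnj (F x)) (\<lambda>x. cnj (D x))"
  unfolding ac_deriv_def
proof (intro allI impI)
  fix a b :: real assume F: "\<forall>a b. a \<le> b \<longrightarrow> {a..b} \<subseteq> J \<longrightarrow>
     set_integrable lborel {a..b} D \<and> (LINT x:{a..b}|lborel. D x) = F b - F a"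
    and ab: "a \<le> b" "{a..b} \<subseteq> J"
  have eq: "(\<lambda>x. indicat_real {a..b} x *\<^sub>R cnj (D x)) = (\<lambda>x. cnj (indicat_real {a..b} x *\<^sub>R D x))"
    by simp
  have "integrable lborel (\<lambda>x. indicat_real {a..b} x *\<^sub>R D x)"
    "(LINT x|lborel. indicat_real {a..b} x *\<^sub>R D x) = F b - F a"
    using F ab unfolding set_integrable_def set_lebesgue_integral_def by blast+
  then show "set_integrable lborel {a..b} (\<lambda>x. cnj (D x)) \<and>
      (LINT x:{a..b}|lborel. cnj (D x)) = cnj (F b) - cnj (F a)"
    unfolding set_integrable_def set_lebesgue_integral_def eq
    by (simp only: integrable_cnj Bochner_Integration.integral_cnj complex_cnj_diff simp_thms)
qed

lemma ac_deriv_add: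
  "ac_deriv J F D \<Longrightarrow> ac_deriv J F' D' \<Longrightarrow> ac_deriv J (\<lambda>x. F x + F' x) (\<lambda>x. D x + D' x)"
  unfolding ac_deriv_def by (auto simp: set_integral_add)

lemma ac_deriv_cmult: "ac_deriv J F D \<Longrightarrow> ac_deriv J (\<lambda>x. c * F x) (\<lambda>x. c * D x)"
  unfolding ac_deriv_def by (auto simp: right_diff_distrib)

lemma ac_deriv_const: "ac_deriv J (\<lambda>x. c) (\<lambda>x. 0)"
  unfolding ac_deriv_def by (auto simp: set_integrable_def set_lebesgue_integral_def)

lemma ac_deriv_C1:
  assumes "\<And>x. (F has_vector_derivative D x) (at x)" "continuous_on UNIV D"
  shows "ac_deriv J F D"
  unfolding ac_deriv_def
proof (intro allI impI conjI)
  fix a b :: real assume ab: "a \<le> b"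
  have c: "continuous_on {a..b} D" using assms(2) continuous_on_subset by blast
  show "set_integrable lborel {a..b} D" by (rule borel_integrable_atLeastAtMost'[OF c])
  show "(LINT x:{a..b}|lborel. D x) = F b - F a"
    unfolding set_lebesgue_integral_def
    by (rule integral_FTC_atLeastAtMost[OF ab _ c]) (simp add: assms(1) has_vector_derivative_at_within)
qed

lemma ac_deriv_cong:
  assumes "ac_deriv J F D" "\<And>x. x \<in> J \<Longrightarrow> F x = F' x" "\<And>x. x \<in> J \<Longrightarrow> D x = D' x"
  shows "ac_deriv J F' D'"
  unfolding ac_deriv_def
proof (intro allI impI)
  fix a b :: real assume ab: "a \<le> b" "{a..b} \<subseteq> J"
  have "set_integrable lborel {a..b} D = set_integrable lborel {a..b} D'"
    by (rule set_integrable_cong) (use ab assms in auto)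
  moreover have "(LINT x:{a..b}|lborel. D x) = (LINT x:{a..b}|lborel. D' x)"
    by (rule set_lebesgue_integral_cong) (use ab assms in auto)
  ultimately show "set_integrable lborel {a..b} D' \<and> (LINT x:{a..b}|lborel. D' x) = F' b - F' a"
    using ac_derivD[OF assms(1) ab] assms(2)[of a, symmetric] assms(2)[of b, symmetric] ab
    by (simp add: subset_iff)
qed

text \<open>Integrability is asked for up to the endpoints of \<open>J\<close>. With
  \<open>J\<close> a closed edge the primitive therefore has values at the vertices, although the
  equation behind it is tested only inside the edge.\<close>

lemma ac_deriv_primitive:
  assumes "is_interval J" "x0 \<in> J" "\<And>a b. {a..b} \<subseteq> J \<Longrightarrow> set_integrable lborel {a..b} D"
  obtains F where "ac_deriv J F D"
proof -
  define F where "F x = (if x0 \<le> x then (LINT y:{x0..x}|lborel. D y) else - (LINT y:{x..x0}|lborel. D y))" for x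
  have split: "(LINT y:{a..c}|lborel. D y) = (LINT y:{a..b}|lborel. D y) + (LINT y:{b..c}|lborel. D y)"
    if "a \<le> b" "b \<le> c" "{a..c} \<subseteq> J" for a b c
  proof -
    have i: "set_integrable lborel {a..c} D" using assms(3) that by blast
    have "(LINT y:{a..c}|lborel. D y) = (LINT y:{a..b} \<union> {b<..c}|lborel. D y)"
      using that by (intro arg_cong2[where f="\<lambda>A. set_lebesgue_integral lborel A"]) auto
    also have "\<dots> = (LINT y:{a..b}|lborel. D y) + (LINT y:{b<..c}|lborel. D y)"
      by (rule set_integral_Un) (use that in \<open>auto intro: set_integrable_subset[OF i]\<close>)
    also have "(LINT y:{b<..c}|lborel. D y) = (LINT y:{b..c}|lborel. D y)"
      unfolding set_lebesgue_integral_def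
    proof (rule integral_cong_AE)
      have "set_integrable lborel {b<..c} D" "set_integrable lborel {b..c} D"
        using that by (auto intro: set_integrable_subset[OF i])
      then show "(\<lambda>x. indicat_real {b<..c} x *\<^sub>R D x) \<in> borel_measurable lborel"
        "(\<lambda>x. indicat_real {b..c} x *\<^sub>R D x) \<in> borel_measurable lborel"
        unfolding set_integrable_def by (auto dest: borel_measurable_integrable)
    qed (auto intro!: eventually_mono[OF AE_lborel_singleton[of b]] simp: indicator_def)
    finally show ?thesis .
  qed
  have "ac_deriv J F D"
    unfolding ac_deriv_def
  proof (intro allI impI conjI)
    fix a b :: real assume ab: "a \<le> b" "{a..b} \<subseteq> J"
    show "set_integrable lborel {a..b} D" using assms(3) ab by blast
    have J: "a \<in> J" "b \<in> J" using ab by auto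
    have sub: "{u..v} \<subseteq> J" if "u \<in> J" "v \<in> J" for u v
      using mem_is_interval_1_I[OF assms(1) that] by auto
    consider "x0 \<le> a" | "a < x0" "x0 \<le> b" | "b < x0" by linarith
    then show "(LINT x:{a..b}|lborel. D x) = F b - F a"
    proof cases
      case 1
      then have "(LINT y:{x0..b}|lborel. D y) = (LINT y:{x0..a}|lborel. D y) + (LINT y:{a..b}|lborel. D y)"
        using split ab(1) sub[OF assms(2) J(2)] by blast
      then show ?thesis using 1 ab(1) by (simp add: F_def)
    next
      case 2
      then have "(LINT y:{a..b}|lborel. D y) = (LINT y:{a..x0}|lborel. D y) + (LINT y:{x0..b}|lborel. D y)"
        using split ab(2) by (meson less_imp_le)
      then show ?thesis using 2 by (simp add: F_def)
    next
      case 3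
      then have "(LINT y:{a..x0}|lborel. D y) = (LINT y:{a..b}|lborel. D y) + (LINT y:{b..x0}|lborel. D y)"
        using split ab(1) sub[OF J(1) assms(2)] by (meson less_imp_le)
      then show ?thesis using 3 ab(1) by (simp add: F_def)
    qed
  qed
  then show ?thesis using that by blast
qed

section \<open>Smooth bump functions\<close>

text \<open>The differentiability clause of \<open>test_functions\<close>, split off so that closure
  properties can be proved without regard to supports.\<close>

definition smooth :: "(real \<Rightarrow> real) \<Rightarrow> bool" where
  "smooth f \<longleftrightarrow> (\<forall>n x. (deriv ^^ n) f differentiable (at x))"

text \<open>Spares a formula for the derivative of order \<open>n\<close>: it is enough to exhibit a
  set of differentiable functions that is closed under \<open>deriv\<close>.\<close>

lemma smooth_coinduct:
  assumes "f \<in> S" "\<And>f x. f \<in> S \<Longrightarrow> f differentiable (at x)" "\<And>f. f \<in> S \<Longrightarrow> deriv f \<in> S"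
  shows "smooth f"
proof -
  have "(deriv ^^ n) f \<in> S" for n by (induction n) (use assms in auto)
  then show ?thesis unfolding smooth_def using assms(2) by blast
qed

lemma smooth_differentiable: "smooth f \<Longrightarrow> f differentiable (at x)"
  unfolding smooth_def by (metis funpow_0)

lemma smooth_deriv: "smooth f \<Longrightarrow> smooth (deriv f)"
  unfolding smooth_def by (metis funpow_Suc_right comp_apply)

lemma smooth_has_deriv: "smooth f \<Longrightarrow> (f has_real_derivative deriv f x) (at x)"
  using smooth_differentiable by (simp add: DERIV_deriv_iff_real_differentiable)

lemma smooth_from_deriv:
  assumes "\<And>x. (f has_real_derivative g x) (at x)" "smooth g"
  shows "smooth f"
proof (rule smooth_coinduct[of f "insert f (Collect smooth)"])
  fix h assume "h \<in> insert f (Collect smooth)"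
  moreover have "deriv f = g" using assms(1) DERIV_imp_deriv by blast
  ultimately show "deriv h \<in> insert f (Collect smooth)" using assms(2) smooth_deriv by auto
  show "h differentiable at x" for x
    using \<open>h \<in> _\<close> assms(1) smooth_differentiable real_differentiable_def by blast
qed simp

lemma smooth_isCont: "smooth f \<Longrightarrow> isCont f x"
  using smooth_has_deriv DERIV_isCont by blast

lemma smooth_continuous_on: "smooth f \<Longrightarrow> continuous_on A f"
  by (simp add: smooth_isCont continuous_at_imp_continuous_on)

text \<open>Unlike the products themselves, their sums are closed under differentiation.\<close>

inductive_set prod_span :: "(real \<Rightarrow> real) set" where
  base: "smooth f \<Longrightarrow> smooth g \<Longrightarrow> (\<lambda>x. f x * g x) \<in> prod_span"
| add: "f \<in> prod_span \<Longrightarrow> g \<in> prod_span \<Longrightarrow> (\<lambda>x. f x + g x) \<in> prod_span"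

lemma prod_span_deriv: "f \<in> prod_span \<Longrightarrow> \<exists>g\<in>prod_span. \<forall>x. (f has_real_derivative g x) (at x)"
proof (induction rule: prod_span.induct)
  case (base f g)
  have "(\<lambda>x. deriv f x * g x + f x * deriv g x) \<in> prod_span"
    by (intro prod_span.intros smooth_deriv base)
  moreover have "\<forall>x. ((\<lambda>x. f x * g x) has_real_derivative deriv f x * g x + f x * deriv g x) (at x)"
    using DERIV_mult[OF smooth_has_deriv smooth_has_deriv, OF base] by (simp add: mult.commute add.commute)
  ultimately show ?case by (intro bexI[where x="\<lambda>x. deriv f x * g x + f x * deriv g x"])
next
  case (add f g)
  then obtain f' g' where "f' \<in> prod_span" "g' \<in> prod_span"
    "\<forall>x. (f has_real_derivative f' x) (at x)" "\<forall>x. (g has_real_derivative g' x) (at x)" by blast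
  then show ?case
    by (intro bexI[of _ "\<lambda>x. f' x + g' x"]) (auto intro: prod_span.add DERIV_add)
qed

lemma smooth_prod_span:
  assumes "f \<in> prod_span" shows "smooth f"
proof (rule smooth_coinduct[OF assms])
  fix f assume "f \<in> prod_span"
  then obtain g where g: "g \<in> prod_span" "\<And>x. (f has_real_derivative g x) (at x)"
    using prod_span_deriv by blast
  then have "deriv f = g" using DERIV_imp_deriv by blast
  then show "deriv f \<in> prod_span" using g by simp
  show "f differentiable at x" for x using g real_differentiable_def by blast
qed

lemma smooth_mult: "smooth f \<Longrightarrow> smooth g \<Longrightarrow> smooth (\<lambda>x. f x * g x)"
  by (simp add: smooth_prod_span prod_span.base)

lemma smooth_const: "smooth (\<lambda>x. c)"
  by (rule smooth_coinduct[of _ "range (\<lambda>c x. c)"]) auto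

lemma smooth_add: "smooth f \<Longrightarrow> smooth g \<Longrightarrow> smooth (\<lambda>x. f x + g x)"
  using smooth_prod_span[OF prod_span.add[OF prod_span.base prod_span.base], of f "\<lambda>_. 1" g "\<lambda>_. 1"]
  by (simp add: smooth_const)

lemma smooth_cmult: "smooth f \<Longrightarrow> smooth (\<lambda>x. c * f x)"
  by (intro smooth_mult smooth_const)

lemma smooth_affine:
  assumes "smooth f" shows "smooth (\<lambda>x. f (a + c * x))"
\<comment> \<open>The free factor \<open>s\<close> absorbs the \<open>c\<close> that the chain rule
  produces at each differentiation.\<close>
proof (rule smooth_coinduct[of _ "{(\<lambda>x. s * f (a + c * x)) | s f. smooth f}"])
  show "(\<lambda>x. f (a + c * x)) \<in> {(\<lambda>x. s * f (a + c * x)) | s f. smooth f}"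
    using assms by (intro CollectI exI[of _ 1] exI[of _ f]) auto
next
  fix h assume "h \<in> {(\<lambda>x. s * f (a + c * x)) | s f. smooth f}"
  then obtain s g where h: "h = (\<lambda>x. s * g (a + c * x))" "smooth g" by blast
  have d: "(h has_real_derivative (s * c) * deriv g (a + c * x)) (at x)" for x
    unfolding h(1) using smooth_has_deriv[OF h(2), of "a + c * x"]
    by (auto intro!: derivative_eq_intros DERIV_chain2[of g])
  then show "h differentiable at x" for x using real_differentiable_def by blast
  have "deriv h = (\<lambda>x. (s * c) * deriv g (a + c * x))" using d DERIV_imp_deriv by blast
  then show "deriv h \<in> {(\<lambda>x. s * f (a + c * x)) | s f. smooth f}"
    using smooth_deriv[OF h(2)] by blast
qed

text \<open>For \<open>k = 0\<close> this is the classical flat function. The power of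
  \<open>x\<close> in the denominator is present because differentiation produces it.\<close>

definition flat_exp :: "real \<Rightarrow> nat \<Rightarrow> real \<Rightarrow> real" where
  "flat_exp c k x = (if x > 0 then exp (- c / x) / x ^ k else 0)"

text \<open>With \<open>y = c / h\<close> this is the decay of \<open>y ^ k / exp y\<close> at
  infinity.\<close>

lemma flat_exp_tendsto_0:
  assumes "c > 0" shows "((\<lambda>h. flat_exp c k h) \<longlongrightarrow> 0) (at 0)"
proof -
  have lim: "((\<lambda>y. (1 / c ^ k) * (y ^ k / exp y)) \<longlongrightarrow> (1 / c ^ k) * 0) at_top"
    by (intro tendsto_intros tendsto_power_div_exp_0)
  have f: "filterlim (\<lambda>h. c / h) at_top (at_right 0)" using assms by real_asymp
  have "((\<lambda>h. (1 / c ^ k) * ((c / h) ^ k / exp (c / h))) \<longlongrightarrow> 0) (at_right 0)"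
    using filterlim_compose[OF lim f] by simp
  moreover have "eventually (\<lambda>h. (1 / c ^ k) * ((c / h) ^ k / exp (c / h)) = flat_exp c k h) (at_right 0)"
    using eventually_at_right_less[of 0]
    by eventually_elim (use assms in \<open>auto simp: flat_exp_def exp_minus field_simps power_divide\<close>)
  ultimately have r: "((\<lambda>h. flat_exp c k h) \<longlongrightarrow> 0) (at_right 0)"
    by (rule Lim_transform_eventually)
  have "((\<lambda>h. flat_exp c k h) \<longlongrightarrow> 0) (at_left 0)"
    by (rule Lim_transform_eventually[of "\<lambda>_. 0"])
      (auto simp: flat_exp_def eventually_at_left_field intro!: exI[of _ "-1"])
  with r show ?thesis by (simp add: filterlim_at_split)
qed

lemma flat_exp_deriv:
  assumes "c > 0"
  shows "(flat_exp c k has_real_derivative c * flat_exp c (k + 2) x - real k * flat_exp c (k + 1) x) (at x)"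
proof -
  consider "x > 0" | "x = 0" | "x < 0" by linarith
  then show ?thesis
  proof cases
    case 1
    have "((\<lambda>x. exp (- c / x) / x ^ k) has_real_derivative c * flat_exp c (k + 2) x - real k * flat_exp c (k + 1) x) (at x)"
      using 1 by (auto intro!: derivative_eq_intros simp: flat_exp_def)
        (cases k; simp add: field_simps power2_eq_square)
    moreover have "eventually (\<lambda>y. exp (- c / y) / y ^ k = flat_exp c k y) (nhds x)"
      using 1 eventually_nhds_in_open[of "{0<..}" x]
      by (auto elim!: eventually_mono simp: flat_exp_def)
    ultimately show ?thesis by (rule iffD1[OF DERIV_cong_ev[OF refl _ refl], rotated])
  next
    case 2
    \<comment> \<open>At 0 the difference quotient is the same function with exponent raised by one,
      so its limit is already known.\<close>
    have "((\<lambda>h. flat_exp c k h / h) \<longlongrightarrow> 0) (at 0)"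
      by (rule Lim_transform_eventually[OF flat_exp_tendsto_0[OF assms, of "Suc k"]])
        (auto simp: flat_exp_def eventually_at_filter)
    then show ?thesis using 2 by (simp add: DERIV_def flat_exp_def)
  next
    case 3
    have "eventually (\<lambda>y. 0 = flat_exp c k y) (nhds x)"
      using 3 eventually_nhds_in_open[of "{..<0}" x]
      by (auto elim!: eventually_mono simp: flat_exp_def)
    then have "(flat_exp c k has_real_derivative 0) (at x)"
      by (rule iffD1[OF DERIV_cong_ev[OF refl _ refl]]) simp
    then show ?thesis using 3 by (simp add: flat_exp_def)
  qed
qed

inductive_set flat_span :: "real \<Rightarrow> (real \<Rightarrow> real) set" for c where
  base: "(\<lambda>x. s * flat_exp c k x) \<in> flat_span c"
| add: "f \<in> flat_span c \<Longrightarrow> g \<in> flat_span c \<Longrightarrow> (\<lambda>x. f x + g x) \<in> flat_span c"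

lemma flat_span_deriv:
  assumes "c > 0"
  shows "f \<in> flat_span c \<Longrightarrow> \<exists>g\<in>flat_span c. \<forall>x. (f has_real_derivative g x) (at x)"
proof (induction rule: flat_span.induct)
  case (base s k)
  have "(\<lambda>x. (s * c) * flat_exp c (k + 2) x + (- s * real k) * flat_exp c (k + 1) x) \<in> flat_span c"
    by (intro flat_span.intros)
  moreover have "\<forall>x. ((\<lambda>x. s * flat_exp c k x) has_real_derivative
      (s * c) * flat_exp c (k + 2) x + (- s * real k) * flat_exp c (k + 1) x) (at x)"
  proof
    fix x show "((\<lambda>x. s * flat_exp c k x) has_real_derivative
      (s * c) * flat_exp c (k + 2) x + (- s * real k) * flat_exp c (k + 1) x) (at x)"
      using DERIV_cmult[OF flat_exp_deriv[OF assms, of k x], of s] by (simp add: algebra_simps)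
  qed
  ultimately show ?case by (intro bexI[where x="\<lambda>x. (s * c) * flat_exp c (k + 2) x + (- s * real k) * flat_exp c (k + 1) x"])
next
  case (add f g)
  then obtain f' g' where "f' \<in> flat_span c" "g' \<in> flat_span c"
    "\<forall>x. (f has_real_derivative f' x) (at x)" "\<forall>x. (g has_real_derivative g' x) (at x)" by blast
  then show ?case
    by (intro bexI[of _ "\<lambda>x. f' x + g' x"]) (auto intro: flat_span.add DERIV_add)
qed

lemma smooth_flat_exp:
  assumes "c > 0" shows "smooth (flat_exp c 0)"
proof (rule smooth_coinduct[of _ "flat_span c"])
  show "flat_exp c 0 \<in> flat_span c" using flat_span.base[of 1 c 0] by simp
next
  fix f assume "f \<in> flat_span c"
  then obtain g where g: "g \<in> flat_span c" "\<And>x. (f has_real_derivative g x) (at x)"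
    using flat_span_deriv[OF assms] by blast
  then have "deriv f = g" using DERIV_imp_deriv by blast
  then show "deriv f \<in> flat_span c" using g by simp
  show "f differentiable at x" for x using g real_differentiable_def by blast
qed

text \<open>The exponent \<open>1 / Suc n\<close> makes the bumps tend to the indicator function of the interval.\<close>

definition bump :: "real \<Rightarrow> real \<Rightarrow> nat \<Rightarrow> real \<Rightarrow> real" where
  "bump a b n x = flat_exp (1 / Suc n) 0 (x - a) * flat_exp (1 / Suc n) 0 (b - x)"

lemma smooth_bump: "smooth (bump a b n)"
proof -
  have "smooth (flat_exp (1 / Suc n) 0)" by (rule smooth_flat_exp) simp
  from smooth_mult[OF smooth_affine[OF this, of "-a" 1] smooth_affine[OF this, of b "-1"]]
  show ?thesis by (simp add: bump_def[abs_def])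
qed

lemma bump_eq_0: "x \<notin> {a<..<b} \<Longrightarrow> bump a b n x = 0"
  by (auto simp: bump_def flat_exp_def)

lemma bump_pos: "x \<in> {a<..<b} \<Longrightarrow> bump a b n x > 0"
  by (auto simp: bump_def flat_exp_def)

lemma bump_bounds: "0 \<le> bump a b n x" "bump a b n x \<le> 1"
proof -
  have *: "0 \<le> flat_exp (1 / Suc n) 0 y" "flat_exp (1 / Suc n) 0 y \<le> 1" for y
    by (auto simp: flat_exp_def)
  show "0 \<le> bump a b n x" "bump a b n x \<le> 1"
    unfolding bump_def using * by (auto intro!: mult_nonneg_nonneg mult_le_one)
qed

lemma bump_tendsto: "(\<lambda>n. bump a b n x) \<longlonglongrightarrow> indicator {a<..<b} x"
proof (cases "x \<in> {a<..<b}")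
  case True
  have e: "(\<lambda>n. flat_exp (1 / Suc n) 0 y) \<longlonglongrightarrow> 1" if "y > 0" for y
  proof -
    have "(\<lambda>n. exp (- (1 / real (Suc n)) / y)) \<longlonglongrightarrow> exp (- 0 / y)"
      using that by (intro tendsto_intros LIMSEQ_Suc[OF lim_1_over_n]) auto
    then show ?thesis using that by (simp add: flat_exp_def)
  qed
  have "(\<lambda>n. bump a b n x) \<longlonglongrightarrow> 1 * 1"
    unfolding bump_def by (intro tendsto_mult e) (use True in auto)
  then show ?thesis using True by simp
next
  case False
  then show ?thesis by (simp add: bump_eq_0)
qed

section \<open>Test functions and du Bois-Reymond's lemma\<close>

locale open_interval =
  fixes I :: "real set"
  assumes open_I: "open I" and interval_I: "is_interval I" and nonempty_I: "I \<noteq> {}"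
begin

lemma Icc_subset: "a \<in> I \<Longrightarrow> b \<in> I \<Longrightarrow> {a..b} \<subseteq> I"
  by (rule subsetI) (rule mem_is_interval_1_I[OF interval_I, of a b], auto)

lemma sets_I [measurable, simp]: "I \<in> sets borel"
  using open_I by simp

lemma enlarge:
  assumes "a \<in> I" "b \<in> I" "a \<le> b"
  obtains a' b' where "a' < a" "b < b'" "{a'..b'} \<subseteq> I"
proof -
  have "\<exists>y>x. y \<in> I" "\<exists>y<x. y \<in> I" if x: "x \<in> I" for x
  proof -
    obtain e where e: "e > 0" "ball x e \<subseteq> I" using open_I x openE by blast
    have "x + e / 2 \<in> I" "x - e / 2 \<in> I" using e by (auto simp: dist_real_def subset_iff)
    moreover have "x + e / 2 > x" "x - e / 2 < x" using e by auto
    ultimately show "\<exists>y>x. y \<in> I" "\<exists>y<x. y \<in> I" by blast+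
  qed
  then show ?thesis using assms Icc_subset that by meson
qed

lemma test_functionsI:
  assumes "smooth \<phi>" "{a..b} \<subseteq> I" "\<And>x. x \<notin> {a..b} \<Longrightarrow> \<phi> x = 0"
  shows "\<phi> \<in> test_functions I"
  using assms unfolding test_functions_def smooth_def by (auto intro!: exI[of _ "{a..b}"])

text \<open>The support is enlarged a little, so that \<open>\<phi>\<close> vanishes already at
  \<open>a\<close> and \<open>b\<close> themselves. Integration by parts over \<open>{a..b}\<close>
  then has no boundary terms.\<close>

lemma test_functionsE:
  assumes "\<phi> \<in> test_functions I"
  obtains a b where "smooth \<phi>" "a < b" "{a..b} \<subseteq> I" "\<And>x. x \<notin> {a<..<b} \<Longrightarrow> \<phi> x = 0"
proof -
  obtain K where K: "compact K" "K \<subseteq> I" "\<And>x. x \<notin> K \<Longrightarrow> \<phi> x = 0" and s: "smooth \<phi>"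
    using assms unfolding test_functions_def smooth_def by auto
  obtain a b where ab: "a \<in> I" "b \<in> I" "a \<le> b" "K \<subseteq> {a..b}"
  proof (cases "K = {}")
    case True
    then show ?thesis using nonempty_I that by auto
  next
    case False
    then obtain a b where "a \<in> K" "b \<in> K" "\<forall>x\<in>K. a \<le> x" "\<forall>x\<in>K. x \<le> b"
      using compact_attains_inf[OF K(1)] compact_attains_sup[OF K(1)] by blast
    then show ?thesis using that[of a b] K(2) by (auto simp: subset_iff)
  qed
  obtain a' b' where "a' < a" "b < b'" "{a'..b'} \<subseteq> I" using enlarge[OF ab(1-3)] by blast
  moreover have "\<phi> x = 0" if "x \<notin> {a'<..<b'}" for x
  proof (rule K(3))
    show "x \<notin> K" using that ab(3,4) \<open>a' < a\<close> \<open>b < b'\<close> by fastforce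
  qed
  moreover have "a' < b'" using \<open>a' < a\<close> \<open>b < b'\<close> ab(3) by linarith
  ultimately show ?thesis using that[of a' b'] s by blast
qed

lemma test_smooth: "\<phi> \<in> test_functions I \<Longrightarrow> smooth \<phi>"
  by (erule test_functionsE)

lemma bump_test: "{a..b} \<subseteq> I \<Longrightarrow> bump a b n \<in> test_functions I"
  by (rule test_functionsI[OF smooth_bump]) (auto simp: bump_eq_0)

lemma test_cmult: assumes "\<phi> \<in> test_functions I" shows "(\<lambda>x. c * \<phi> x) \<in> test_functions I"
  using assms by (elim test_functionsE, intro test_functionsI smooth_cmult) auto

lemma test_add:
  assumes "\<phi> \<in> test_functions I" "\<psi> \<in> test_functions I"
  shows "(\<lambda>x. \<phi> x + \<psi> x) \<in> test_functions I"
proof -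
  obtain a b where 1: "a < b" "{a..b} \<subseteq> I" "\<And>x. x \<notin> {a<..<b} \<Longrightarrow> \<phi> x = 0" using assms test_functionsE by metis
  obtain c d where 2: "c < d" "{c..d} \<subseteq> I" "\<And>x. x \<notin> {c<..<d} \<Longrightarrow> \<psi> x = 0" using assms test_functionsE by metis
  have mM: "min a c \<in> I" "max b d \<in> I" using 1 2 by (auto simp: min_def max_def subset_iff)
  show ?thesis
  proof (rule test_functionsI)
    show "{min a c..max b d} \<subseteq> I" using Icc_subset[OF mM] .
    show "\<phi> x + \<psi> x = 0" if "x \<notin> {min a c..max b d}" for x
      using that 1(3)[of x] 2(3)[of x] by (simp add: min_le_iff_disj le_max_iff_disj) linarith
  qed (intro smooth_add test_smooth assms)
qed

lemma deriv_eq_0_outside: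
  fixes \<phi> :: "real \<Rightarrow> real"
  assumes "\<And>x. x \<notin> {a<..<b} \<Longrightarrow> \<phi> x = 0" "x \<notin> {a..b}" shows "deriv \<phi> x = 0"
proof -
  have "eventually (\<lambda>y. y \<in> - {a..b}) (nhds x)"
    by (rule eventually_nhds_in_open) (use assms(2) in \<open>auto intro: open_Compl\<close>)
  then have "eventually (\<lambda>y. \<phi> y = 0) (nhds x)"
    by eventually_elim (use assms(1) in auto)
  then have "deriv \<phi> x = deriv (\<lambda>_. 0) x" by (rule deriv_cong_ev) simp
  then show ?thesis by simp
qed

lemma test_deriv:
  assumes "\<phi> \<in> test_functions I" shows "deriv \<phi> \<in> test_functions I"
proof -
  obtain a b where ab: "smooth \<phi>" "a < b" "{a..b} \<subseteq> I" "\<And>x. x \<notin> {a<..<b} \<Longrightarrow> \<phi> x = 0"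
    using assms test_functionsE by metis
  show ?thesis
    by (rule test_functionsI[OF smooth_deriv[OF ab(1)] ab(3)]) (rule deriv_eq_0_outside[OF ab(4)])
qed

lemma test_integrable:
  fixes v :: "real \<Rightarrow> complex"
  assumes "\<phi> \<in> test_functions I" "locally_integrable I v"
  shows "set_integrable lborel I (\<lambda>x. \<phi> x *\<^sub>R v x)"
proof -
  obtain a b where ab: "smooth \<phi>" "a < b" "{a..b} \<subseteq> I" "\<And>x. x \<notin> {a<..<b} \<Longrightarrow> \<phi> x = 0"
    using assms test_functionsE by metis
  have "set_integrable lborel {a..b} v" using assms(2) ab(3) unfolding locally_integrable_def by blast
  then have "set_integrable lborel {a..b} (\<lambda>x. v x * of_real (\<phi> x))"
    by (rule set_integrable_mult_continuous) (intro continuous_intros smooth_continuous_on ab)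
  moreover have "indicator {a..b} x *\<^sub>R (v x * of_real (\<phi> x)) = indicator I x *\<^sub>R (\<phi> x *\<^sub>R v x)" for x
  proof (cases "x \<in> {a<..<b}")
    case True
    then have "x \<in> {a..b}" "x \<in> I" using ab(3) by auto
    then show ?thesis by (simp add: scaleR_conv_of_real)
  qed (simp add: ab(4))
  ultimately show ?thesis unfolding set_integrable_def by simp
qed

text \<open>Dynkin argument: for \<open>w\<close> cut off to a compact interval, the Borel sets with
  vanishing integral form a Dynkin system containing the rays \<open>{..t}\<close>, hence all Borel
  sets; a density with vanishing integrals is zero almost everywhere.\<close>

lemma integral_eq_0_imp_AE_0:
  fixes w :: "real \<Rightarrow> complex"
  assumes w: "locally_integrable I w"
    and zero: "\<And>a b. a \<le> b \<Longrightarrow> {a..b} \<subseteq> I \<Longrightarrow> (LINT x:{a..b}|lborel. w x) = 0"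
  shows "AE x in lborel. x \<in> I \<longrightarrow> w x = 0"
proof -
  have AE: "AE x in lborel. x \<in> {a..b} \<longrightarrow> w x = 0" if ab: "{a..b} \<subseteq> I" for a b
  proof (cases "a \<le> b")
    case True
    define f where "f = (\<lambda>x. indicator {a..b} x *\<^sub>R w x)"
    have f: "integrable lborel f"
      using w ab unfolding locally_integrable_def set_integrable_def f_def by blast
    have f0: "(LINT x|lborel. f x) = 0"
      using zero[OF True ab] by (simp add: f_def set_lebesgue_integral_def)
    have "set_lebesgue_integral lborel A f = 0" if "A \<in> sets lborel" for A
    proof -
      have "A \<in> sigma_sets UNIV (range (\<lambda>t::real. {..t}))"
        using that by (simp add: borel_eq_atMost)
      have "Int_stable (range (\<lambda>t::real. {..t}))"
        by (auto simp: Int_stable_def intro!: image_eqI[of _ _ "min _ _"])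
      have S: "range (\<lambda>t::real. {..t}) \<subseteq> Pow UNIV" by simp
      have borel: "B \<in> sets borel" if "B \<in> sigma_sets UNIV (range (\<lambda>t::real. {..t}))" for B
        using that by (simp add: borel_eq_atMost)
      from \<open>Int_stable _\<close> S \<open>A \<in> sigma_sets _ _\<close> show ?thesis
      proof (induction A rule: sigma_sets_induct_disjoint)
        case (basic A)
        then obtain t where A: "A = {..t}" by auto
        show ?case
        proof (cases "t < a")
          case True
          then show ?thesis unfolding A set_lebesgue_integral_def f_def
            by (intro integral_eq_zero_AE) (auto simp: indicator_def)
        next
          case False
          define c where "c = min t b"
          have c: "a \<le> c" "{a..c} \<subseteq> I" using False True ab by (auto simp: c_def)
          have "set_lebesgue_integral lborel A f = (LINT x:{a..c}|lborel. w x)"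
            unfolding A set_lebesgue_integral_def f_def c_def
            by (intro Bochner_Integration.integral_cong) (auto simp: indicator_def)
          then show ?thesis using zero[OF c] by simp
        qed
      next
        case empty then show ?case by (simp add: set_lebesgue_integral_def)
      next
        case (compl A)
        have "set_integrable lborel A f" "set_integrable lborel (UNIV - A) f"
          unfolding set_integrable_def using borel[OF compl(1)]
          by (auto intro!: integrable_mult_indicator f)
        then have "set_lebesgue_integral lborel (A \<union> (UNIV - A)) f
            = set_lebesgue_integral lborel A f + set_lebesgue_integral lborel (UNIV - A) f"
          by (intro set_integral_Un) auto
        moreover have "A \<union> (UNIV - A) = UNIV" by auto
        ultimately show ?case using compl f0 by (simp add: set_lebesgue_integral_def)
      next
        case (union A)
        have meas: "A i \<in> sets borel" for i using union(2) borel by blast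
        have "set_integrable lborel (\<Union>i. A i) f"
          unfolding set_integrable_def by (intro integrable_mult_indicator f) (use meas in auto)
        then have "set_lebesgue_integral lborel (\<Union>i. A i) f = (\<Sum>i. set_lebesgue_integral lborel (A i) f)"
          using union meas by (intro lebesgue_integral_countable_add) (auto simp: disjoint_family_on_def)
        then show ?case using union by simp
      qed
    qed
    then have "AE x in lborel. f x = 0" by (rule sigma_finite_measure.density_zero[OF lborel.sigma_finite_measure_axioms f])
    then show ?thesis by eventually_elim (auto simp: f_def indicator_def)
  qed auto
  \<comment> \<open>Only countably many null sets may be united, hence rational endpoints; by
    openness such intervals still cover \<open>I\<close>.\<close>
  have "AE x in lborel. \<forall>a\<in>\<rat>. \<forall>b\<in>\<rat>. {a..b} \<subseteq> I \<longrightarrow> x \<in> {a..b} \<longrightarrow> w x = 0"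
    unfolding Ball_def
    by (subst AE_ball_countable[unfolded Ball_def, OF countable_rat], intro allI impI,
        subst AE_ball_countable[unfolded Ball_def, OF countable_rat], intro allI impI)
      (use AE in auto)
  then show ?thesis
  proof eventually_elim
    case (elim x)
    show ?case
    proof
      assume x: "x \<in> I"
      then obtain a' b' where "a' < x" "x < b'" "{a'..b'} \<subseteq> I" using enlarge[of x x] by auto
      moreover obtain a b where "a \<in> \<rat>" "a' < a" "a < x" "b \<in> \<rat>" "x < b" "b < b'"
        using Rats_dense_in_real calculation by meson
      ultimately show "w x = 0" using elim[rule_format, of a b] by (auto simp: subset_iff)
    qed
  qed
qed

text \<open>The bumps on \<open>{a..b}\<close> increase the reach of the hypothesis to interval
  integrals: they converge to the indicator function and are bounded by 1, so dominated convergence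
  applies.\<close>

theorem fundamental_lemma:
  fixes w :: "real \<Rightarrow> complex"
  assumes w: "locally_integrable I w"
    and zero: "\<And>\<phi>. \<phi> \<in> test_functions I \<Longrightarrow> (LINT x:I|lborel. \<phi> x *\<^sub>R w x) = 0"
  shows "AE x in lborel. x \<in> I \<longrightarrow> w x = 0"
proof (rule integral_eq_0_imp_AE_0[OF w])
  fix a b :: real assume ab: "a \<le> b" "{a..b} \<subseteq> I"
  define f where "f = (\<lambda>x. indicator {a..b} x *\<^sub>R w x)"
  have f: "integrable lborel f"
    using w ab unfolding locally_integrable_def set_integrable_def f_def by blast
  have "(LINT x|lborel. bump a b n x *\<^sub>R f x) = (LINT x:I|lborel. bump a b n x *\<^sub>R w x)" for n
    unfolding set_lebesgue_integral_def f_def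
  proof (intro Bochner_Integration.integral_cong refl)
    fix x show "bump a b n x *\<^sub>R indicat_real {a..b} x *\<^sub>R w x = indicat_real I x *\<^sub>R bump a b n x *\<^sub>R w x"
    proof (cases "x \<in> {a<..<b}")
      case True
      then have "x \<in> {a..b}" "x \<in> I" using ab by auto
      then show ?thesis by simp
    qed (simp add: bump_eq_0)
  qed
  then have z: "(LINT x|lborel. bump a b n x *\<^sub>R f x) = 0" for n
    using zero[OF bump_test[OF ab(2)]] by simp
  have m [measurable]: "f \<in> borel_measurable borel" "bump a b n \<in> borel_measurable borel" for n
    using f[THEN borel_measurable_integrable] smooth_continuous_on[OF smooth_bump]
    by (simp_all add: borel_measurable_continuous_onI)
  have "(\<lambda>n. LINT x|lborel. bump a b n x *\<^sub>R f x) \<longlonglongrightarrow> (LINT x|lborel. indicator {a<..<b} x *\<^sub>R f x)"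
  proof (rule integral_dominated_convergence[where w="\<lambda>x. norm (f x)"])
    show "AE x in lborel. (\<lambda>n. bump a b n x *\<^sub>R f x) \<longlonglongrightarrow> indicator {a<..<b} x *\<^sub>R f x"
      by (intro AE_I2 tendsto_intros bump_tendsto)
    show "AE x in lborel. norm (bump a b n x *\<^sub>R f x) \<le> norm (f x)" for n
      using bump_bounds[of a b n] by (intro AE_I2) (simp add: mult_left_le_one_le)
  qed (use f in auto)
  then have "(LINT x|lborel. indicator {a<..<b} x *\<^sub>R f x) = 0"
    unfolding z by (rule LIMSEQ_unique) (rule tendsto_const)
  moreover have "(LINT x|lborel. indicator {a<..<b} x *\<^sub>R f x) = (LINT x|lborel. f x)"
  proof (rule integral_cong_AE)
    show "AE x in lborel. indicator {a<..<b} x *\<^sub>R f x = f x"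
      using AE_lborel_singleton[of a] AE_lborel_singleton[of b]
      by eventually_elim (auto simp: indicator_def f_def)
  qed measurable
  ultimately show "(LINT x:{a..b}|lborel. w x) = 0"
    by (simp add: f_def set_lebesgue_integral_def)
qed

text \<open>Serves to correct the mean of a test function by subtracting a multiple of
  \<open>\<rho>\<close>.\<close>

lemma normalized_test_function:
  obtains \<rho> where "\<rho> \<in> test_functions I" "(LINT x|lborel. \<rho> x) = 1"
proof -
  obtain x where "x \<in> I" using nonempty_I by blast
  then obtain a b where ab: "a < x" "x < b" "{a..b} \<subseteq> I" using enlarge[of x x] by auto
  let ?f = "bump a b 0"
  have int: "integrable lborel ?f"
  proof -
    have "set_integrable lborel {a..b} ?f"
      by (rule borel_integrable_atLeastAtMost') (rule smooth_continuous_on[OF smooth_bump])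
    moreover have "indicator {a..b} x *\<^sub>R ?f x = ?f x" for x
      by (cases "x \<in> {a<..<b}") (auto simp: bump_eq_0)
    ultimately show ?thesis unfolding set_integrable_def by (simp only: cong: Bochner_Integration.integrable_cong)
  qed
  have "(LINT x|lborel. ?f x) \<noteq> 0"
  proof
    assume "(LINT x|lborel. ?f x) = 0"
    then have "AE x in lborel. ?f x = 0"
      using integral_nonneg_eq_0_iff_AE[OF int] bump_bounds by auto
    then have "AE x in lborel. x \<notin> {a<..<b}"
    proof eventually_elim
      case (elim x) then show ?case using bump_pos[of x a b 0] by auto
    qed
    then have "emeasure lborel {x \<in> space lborel. \<not> x \<notin> {a<..<b}} = 0"
      by (subst (asm) AE_iff_measurable[OF _ refl]) auto
    moreover have "{x \<in> space lborel. \<not> x \<notin> {a<..<b}} = {a<..<b}" by auto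
    ultimately have "emeasure lborel {a<..<b} = 0" by simp
    then show False using ab by simp
  qed
  then show ?thesis
    using that[OF test_cmult[OF bump_test[OF ab(3)], of "1 / (LINT x|lborel. ?f x)" 0]] by simp
qed

text \<open>The primitive starting left of the support vanishes right of it precisely because the
  total integral is zero; so it has compact support again.\<close>

lemma test_primitive:
  assumes "\<psi> \<in> test_functions I" "(LINT x|lborel. \<psi> x) = 0"
  obtains \<phi> where "\<phi> \<in> test_functions I" "deriv \<phi> = \<psi>"
proof -
  obtain a b where ab: "smooth \<psi>" "a < b" "{a..b} \<subseteq> I" "\<And>x. x \<notin> {a<..<b} \<Longrightarrow> \<psi> x = 0"
    using assms test_functionsE by metis
  \<comment> \<open>The lower limit is \<open>a - 1\<close> rather than \<open>a\<close>, so that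
    the point \<open>a\<close> is interior to the interval of integration and the derivative there
    is two-sided.\<close>
  define \<phi> where "\<phi> x = integral {a - 1..x} \<psi>" for x
  have cont: "continuous_on A \<psi>" for A by (rule smooth_continuous_on[OF ab(1)])
  have left: "\<phi> x = 0" if "x < a" for x
  proof -
    have "\<phi> x = integral {a - 1..x} (\<lambda>_. 0)"
      unfolding \<phi>_def by (rule integral_cong) (use that ab(4) in auto)
    then show ?thesis by simp
  qed
  have d: "(\<phi> has_real_derivative \<psi> x) (at x)" for x
  proof (cases "x < a")
    case True
    have "eventually (\<lambda>y. 0 = \<phi> y) (nhds x)"
      using True eventually_nhds_in_open[of "{..<a}" x] left by (auto elim!: eventually_mono)
    then have "(\<phi> has_real_derivative 0) (at x)"
      by (rule iffD1[OF DERIV_cong_ev[OF refl _ refl]]) simp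
    then show ?thesis using ab(4)[of x] True by simp
  next
    case False
    have "(\<phi> has_real_derivative \<psi> x) (at x within {a - 1..x + 1})"
      unfolding \<phi>_def by (rule integral_has_real_derivative[OF cont]) (use False in auto)
    moreover have "x \<in> interior {a - 1..x + 1}" using False by simp
    ultimately show ?thesis using at_within_interior by metis
  qed
  have right: "\<phi> x = 0" if "x > b" for x
  proof -
    have s: "set_integrable lborel {a - 1..x} \<psi>" by (rule borel_integrable_atLeastAtMost'[OF cont])
    have "\<phi> x = (LINT y:{a - 1..x}|lborel. \<psi> y)"
      unfolding \<phi>_def using set_borel_integral_eq_integral(2)[OF s] by simp
    also have "\<dots> = (LINT y|lborel. \<psi> y)"
      unfolding set_lebesgue_integral_def
    proof (intro Bochner_Integration.integral_cong refl)
      show "indicat_real {a - 1..x} y *\<^sub>R \<psi> y = \<psi> y" for y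
        using that by (cases "y \<in> {a<..<b}") (auto simp: ab(4))
    qed
    finally show ?thesis using assms(2) by simp
  qed
  have "\<phi> \<in> test_functions I"
  proof (rule test_functionsI[OF smooth_from_deriv[OF d ab(1)] ab(3)])
    show "\<phi> x = 0" if "x \<notin> {a..b}" for x using left[of x] right[of x] that by fastforce
  qed
  moreover have "deriv \<phi> = \<psi>" using d DERIV_imp_deriv by blast
  ultimately show ?thesis using that by blast
qed

lemma test_integral_complex:
  assumes "\<phi> \<in> test_functions I"
  shows "(LINT x:I|lborel. \<phi> x *\<^sub>R c) = (LINT x|lborel. \<phi> x) *\<^sub>R (c::complex)"
    and "integrable lborel \<phi>"
proof -
  obtain a b where ab: "smooth \<phi>" "a < b" "{a..b} \<subseteq> I" "\<And>x. x \<notin> {a<..<b} \<Longrightarrow> \<phi> x = 0"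
    using assms test_functionsE by metis
  have s: "set_integrable lborel {a..b} \<phi>"
    by (rule borel_integrable_atLeastAtMost') (rule smooth_continuous_on[OF ab(1)])
  then show "integrable lborel \<phi>" unfolding set_integrable_def
  proof (rule back_subst[where P="integrable lborel"], intro ext)
    show "indicat_real {a..b} x *\<^sub>R \<phi> x = \<phi> x" for x
      using ab(4)[of x] by (cases "x \<in> {a<..<b}") auto
  qed
  moreover have "indicator I x *\<^sub>R \<phi> x *\<^sub>R c = \<phi> x *\<^sub>R c" for x
  proof (cases "x \<in> {a<..<b}")
    case True
    then have "x \<in> I" using ab(3) by auto
    then show ?thesis by simp
  qed (simp add: ab(4))
  ultimately show "(LINT x:I|lborel. \<phi> x *\<^sub>R c) = (LINT x|lborel. \<phi> x) *\<^sub>R c"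
    unfolding set_lebesgue_integral_def by (simp only: integral_scaleR_left)
qed

lemma locally_integrable_continuous: "continuous_on I v \<Longrightarrow> locally_integrable I v"
  unfolding locally_integrable_def
  by (auto intro!: borel_integrable_atLeastAtMost' intro: continuous_on_subset)

lemma locally_integrable_add:
  "locally_integrable I u \<Longrightarrow> locally_integrable I v \<Longrightarrow> locally_integrable I (\<lambda>x. u x + v x)"
  unfolding locally_integrable_def by (auto intro: set_integral_add)

lemma locally_integrable_diff:
  "locally_integrable I u \<Longrightarrow> locally_integrable I v \<Longrightarrow> locally_integrable I (\<lambda>x. u x - v x)"
  unfolding locally_integrable_def by (auto intro: set_integral_diff)

lemma test_decomposition:
  assumes "\<rho> \<in> test_functions I" "(LINT x|lborel. \<rho> x) = 1" "\<psi> \<in> test_functions I"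
  obtains \<phi> where "\<phi> \<in> test_functions I" "\<And>x. deriv \<phi> x = \<psi> x - (LINT x|lborel. \<psi> x) * \<rho> x"
proof -
  let ?s = "LINT x|lborel. \<psi> x"
  have t: "(\<lambda>x. \<psi> x + (- ?s) * \<rho> x) \<in> test_functions I"
    by (intro test_add test_cmult assms)
  moreover have "(LINT x|lborel. \<psi> x + (- ?s) * \<rho> x) = 0"
    using test_integral_complex(2)[OF assms(1)] test_integral_complex(2)[OF assms(3)] assms(2) by simp
  ultimately obtain \<phi> where "\<phi> \<in> test_functions I" "deriv \<phi> = (\<lambda>x. \<psi> x + (- ?s) * \<rho> x)"
    using test_primitive by blast
  then show ?thesis using that by simp
qed

text \<open>The hypothesis covers all test functions of mean zero, since these are derivatives. A
  general \<open>\<psi>\<close> becomes one after subtracting its mean times \<open>\<rho>\<close>,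
  and the constant \<open>c\<close> collects what was subtracted.\<close>

theorem du_Bois_Reymond:
  fixes v :: "real \<Rightarrow> complex"
  assumes v: "locally_integrable I v"
    and zero: "\<And>\<phi>. \<phi> \<in> test_functions I \<Longrightarrow> (LINT x:I|lborel. deriv \<phi> x *\<^sub>R v x) = 0"
  obtains c where "AE x in lborel. x \<in> I \<longrightarrow> v x = c"
proof -
  obtain \<rho> where \<rho>: "\<rho> \<in> test_functions I" "(LINT x|lborel. \<rho> x) = 1"
    using normalized_test_function .
  define c where "c = (LINT x:I|lborel. \<rho> x *\<^sub>R v x)"
  have "AE x in lborel. x \<in> I \<longrightarrow> v x - c = 0"
  proof (rule fundamental_lemma)
    show "locally_integrable I (\<lambda>x. v x - c)"
      by (intro locally_integrable_diff v locally_integrable_continuous continuous_intros)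
    fix \<psi> assume \<psi>: "\<psi> \<in> test_functions I"
    let ?s = "LINT x|lborel. \<psi> x"
    obtain \<phi> where \<phi>: "\<phi> \<in> test_functions I" "\<And>x. deriv \<phi> x = \<psi> x - ?s * \<rho> x"
      using test_decomposition[OF \<rho> \<psi>] by blast
    have i: "set_integrable lborel I (\<lambda>x. \<psi> x *\<^sub>R v x)" "set_integrable lborel I (\<lambda>x. \<rho> x *\<^sub>R v x)"
      "set_integrable lborel I (\<lambda>x. \<psi> x *\<^sub>R c)"
      by (intro test_integrable \<psi> \<rho> v locally_integrable_continuous continuous_intros)+
    have "0 = (LINT x:I|lborel. \<psi> x *\<^sub>R v x - ?s *\<^sub>R (\<rho> x *\<^sub>R v x))"
      using zero[OF \<phi>(1)] by (simp only: \<phi>(2) scaleR_diff_left scaleR_scaleR)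
    also have "\<dots> = (LINT x:I|lborel. \<psi> x *\<^sub>R v x) - ?s *\<^sub>R c"
      unfolding c_def set_integral_scaleR_right[symmetric]
      by (intro set_integral_diff set_integrable_scaleR_right i)
    finally have "(LINT x:I|lborel. \<psi> x *\<^sub>R v x) = (LINT x:I|lborel. \<psi> x *\<^sub>R c)"
      unfolding test_integral_complex(1)[OF \<psi>] by (metis right_minus_eq)
    then show "(LINT x:I|lborel. \<psi> x *\<^sub>R (v x - c)) = 0"
      unfolding scaleR_diff_right set_integral_diff(2)[OF i(1,3)] by (rule right_minus_eq[THEN iffD2])
  qed
  then show ?thesis using that by simp
qed

lemma ac_deriv_locally_integrable:
  assumes F: "ac_deriv I F D"
  shows "locally_integrable I F" "locally_integrable I D"
proof -
  show "locally_integrable I F" unfolding locally_integrable_def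
    using ac_deriv_continuous_Icc[OF F] borel_integrable_atLeastAtMost' by blast
  show "locally_integrable I D" unfolding locally_integrable_def
  proof (intro allI impI)
    fix a b assume "{a..b} \<subseteq> I"
    then show "set_integrable lborel {a..b} D"
      using ac_derivD(1)[OF F, of a b] by (cases "a \<le> b") (auto simp: set_integrable_def)
  qed
qed

lemma integral_by_parts_test:
  assumes F: "ac_deriv I F D" and \<phi>: "\<phi> \<in> test_functions I"
  shows "(LINT x:I|lborel. deriv \<phi> x *\<^sub>R F x) = - (LINT x:I|lborel. \<phi> x *\<^sub>R D x)"
proof -
  obtain a b where ab: "smooth \<phi>" "a < b" "{a..b} \<subseteq> I" "\<And>x. x \<notin> {a<..<b} \<Longrightarrow> \<phi> x = 0"
    using \<phi> test_functionsE by metis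
  have supp': "deriv \<phi> x = 0" if "x \<notin> {a..b}" for x
    using deriv_eq_0_outside[of a b \<phi> x] ab(4) that by blast
  have A: "ac_deriv I (\<lambda>x. of_real (\<phi> x)) (\<lambda>x. of_real (deriv \<phi> x))"
    using smooth_has_deriv[OF ab(1)] smooth_continuous_on[OF smooth_deriv[OF ab(1)]]
    by (intro ac_deriv_C1 has_vector_derivative_of_real continuous_intros)
      (auto simp: has_real_derivative_iff_has_vector_derivative)
  note li = ac_deriv_locally_integrable[OF F]
  have i: "set_integrable lborel I (\<lambda>x. deriv \<phi> x *\<^sub>R F x)" "set_integrable lborel I (\<lambda>x. \<phi> x *\<^sub>R D x)"
    by (intro test_integrable test_deriv \<phi> li)+
  have "0 = (LINT x:{a..b}|lborel. of_real (deriv \<phi> x) * F x + of_real (\<phi> x) * D x)"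
    using ac_derivD(2)[OF ac_deriv_mult[OF A F] _ ab(3)] ab(2,4) by simp
  also have "\<dots> = (LINT x:I|lborel. deriv \<phi> x *\<^sub>R F x + \<phi> x *\<^sub>R D x)"
    unfolding set_lebesgue_integral_def
  proof (intro Bochner_Integration.integral_cong refl)
    fix x show "indicat_real {a..b} x *\<^sub>R (of_real (deriv \<phi> x) * F x + of_real (\<phi> x) * D x)
      = indicat_real I x *\<^sub>R (deriv \<phi> x *\<^sub>R F x + \<phi> x *\<^sub>R D x)"
    proof (cases "x \<in> {a..b}")
      case True
      then have "x \<in> I" using ab(3) by auto
      then show ?thesis using True by (simp add: scaleR_conv_of_real)
    next
      case False
      then have "\<phi> x = 0" by (intro ab(4)) auto
      then show ?thesis using False supp'[OF False] by simp
    qed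
  qed
  also have "\<dots> = (LINT x:I|lborel. deriv \<phi> x *\<^sub>R F x) + (LINT x:I|lborel. \<phi> x *\<^sub>R D x)"
    by (rule set_integral_add(2)[OF i])
  finally show ?thesis by (simp add: eq_neg_iff_add_eq_0)
qed

text \<open>Reduction to the first-order lemma. If \<open>deriv \<phi>\<close> is
  \<open>\<psi> - s * \<rho>\<close> with \<open>s\<close> the mean of \<open>\<psi>\<close>, the
  hypothesis says that integrating \<open>deriv \<psi>\<close> against \<open>v\<close> gives
  \<open>s\<close> times a constant \<open>M\<close>. The function \<open>- x * M\<close> gives the
  same value, so the difference is constant.\<close>

theorem du_Bois_Reymond_2:
  fixes v :: "real \<Rightarrow> complex"
  assumes v: "locally_integrable I v"
    and zero: "\<And>\<phi>. \<phi> \<in> test_functions I \<Longrightarrow> (LINT x:I|lborel. deriv (deriv \<phi>) x *\<^sub>R v x) = 0"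
  obtains c m where "AE x in lborel. x \<in> I \<longrightarrow> v x = c + of_real x * m"
proof -
  obtain \<rho> where \<rho>: "\<rho> \<in> test_functions I" "(LINT x|lborel. \<rho> x) = 1"
    using normalized_test_function .
  define M where "M = (LINT x:I|lborel. deriv \<rho> x *\<^sub>R v x)"
  have lin: "ac_deriv I (\<lambda>x. of_real x * M) (\<lambda>x. M)"
    by (rule ac_deriv_C1) (auto intro!: derivative_eq_intros continuous_intros)
  have li: "locally_integrable I (\<lambda>x. of_real x * M)"
    by (intro locally_integrable_continuous continuous_intros)
  \<comment> \<open>The slope has to be \<open>- M\<close>: for affine \<open>v\<close>, integrating \<open>deriv \<rho> * v\<close> by parts gives minus the slope.\<close>
  have "(LINT x:I|lborel. deriv \<psi> x *\<^sub>R (v x + of_real x * M)) = 0" if \<psi>: "\<psi> \<in> test_functions I" for \<psi>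
  proof -
    let ?s = "LINT x|lborel. \<psi> x"
    obtain \<phi> where \<phi>: "\<phi> \<in> test_functions I" "\<And>x. deriv \<phi> x = \<psi> x - ?s * \<rho> x"
      using test_decomposition[OF \<rho> \<psi>] by blast
    have dd: "deriv (deriv \<phi>) x = deriv \<psi> x - ?s * deriv \<rho> x" for x
    proof (rule DERIV_imp_deriv)
      have "deriv \<phi> = (\<lambda>x. \<psi> x - ?s * \<rho> x)" using \<phi>(2) by blast
      then show "(deriv \<phi> has_real_derivative deriv \<psi> x - ?s * deriv \<rho> x) (at x)"
        using smooth_has_deriv[OF test_smooth[OF \<psi>]] smooth_has_deriv[OF test_smooth[OF \<rho>(1)]]
        by (auto intro!: DERIV_diff DERIV_cmult)
    qed
    have i: "set_integrable lborel I (\<lambda>x. deriv \<psi> x *\<^sub>R v x)" "set_integrable lborel I (\<lambda>x. deriv \<rho> x *\<^sub>R v x)"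
      "set_integrable lborel I (\<lambda>x. deriv \<psi> x *\<^sub>R (of_real x * M))"
      by (intro test_integrable test_deriv \<psi> \<rho> v li)+
    have "0 = (LINT x:I|lborel. deriv \<psi> x *\<^sub>R v x - ?s *\<^sub>R (deriv \<rho> x *\<^sub>R v x))"
      using zero[OF \<phi>(1)] by (simp only: dd scaleR_diff_left scaleR_scaleR)
    also have "\<dots> = (LINT x:I|lborel. deriv \<psi> x *\<^sub>R v x) - ?s *\<^sub>R M"
      unfolding M_def set_integral_scaleR_right[symmetric]
      by (intro set_integral_diff set_integrable_scaleR_right i)
    also have "?s *\<^sub>R M = (LINT x:I|lborel. \<psi> x *\<^sub>R M)"
      by (rule test_integral_complex(1)[OF \<psi>, symmetric])
    also have "(LINT x:I|lborel. deriv \<psi> x *\<^sub>R v x) - \<dots>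
        = (LINT x:I|lborel. deriv \<psi> x *\<^sub>R v x) + (LINT x:I|lborel. deriv \<psi> x *\<^sub>R (of_real x * M))"
      unfolding integral_by_parts_test[OF lin \<psi>] by (rule diff_conv_add_uminus)
    finally show ?thesis unfolding scaleR_add_right set_integral_add(2)[OF i(1,3)] by (rule sym)
  qed
  then obtain c where "AE x in lborel. x \<in> I \<longrightarrow> v x + of_real x * M = c"
    using du_Bois_Reymond[OF locally_integrable_add[OF v li]] by blast
  then have "AE x in lborel. x \<in> I \<longrightarrow> v x = c + of_real x * (- M)"
    by eventually_elim (auto simp: algebra_simps)
  then show ?thesis using that by blast
qed

end

section \<open>Weak derivatives\<close>

lemma integrable_AE_cong:
  fixes f g :: "real \<Rightarrow> 'b::{banach, second_countable_topology}"
  assumes "integrable lborel f" "g \<in> borel_measurable lborel" "AE x in lborel. f x = g x"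
  shows "integrable lborel g"
  using assms integrable_cong_AE[of f lborel g] by auto

lemma ac_deriv_cong_AE:
  assumes F: "ac_deriv J F D" and eq: "AE x in lborel. x \<in> J \<longrightarrow> D x = D' x"
    and D': "\<And>a b. a \<le> b \<Longrightarrow> {a..b} \<subseteq> J \<Longrightarrow> set_integrable lborel {a..b} D'"
  shows "ac_deriv J F D'"
  unfolding ac_deriv_def
proof (intro allI impI conjI)
  fix a b :: real assume ab: "a \<le> b" "{a..b} \<subseteq> J"
  show D'i: "set_integrable lborel {a..b} D'" by (rule D'[OF ab])
  have "(LINT x:{a..b}|lborel. D' x) = (LINT x:{a..b}|lborel. D x)"
    unfolding set_lebesgue_integral_def
  proof (rule integral_cong_AE)
    show "AE x in lborel. indicat_real {a..b} x *\<^sub>R D' x = indicat_real {a..b} x *\<^sub>R D x"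
      using eq
    proof eventually_elim
      case (elim x) then show ?case using ab by (cases "x \<in> {a..b}") (auto simp: subset_iff)
    qed
  qed (use D'i ac_derivD(1)[OF F ab] in \<open>auto simp: set_integrable_def dest: borel_measurable_integrable\<close>)
  then show "(LINT x:{a..b}|lborel. D' x) = F b - F a" using ac_derivD(2)[OF F ab] by simp
qed

context open_interval
begin

text \<open>Local integrability gives measurability on compact subintervals only; countably many
  rational ones cover \<open>I\<close>. This is how a weak derivative obtained by Hilbert choice is
  seen to be measurable.\<close>

lemma locally_integrable_measurable:
  assumes "locally_integrable I w"
  shows "(\<lambda>x. indicator I x *\<^sub>R w x) \<in> borel_measurable borel"
proof -
  define C where "C = insert (- I) ((\<lambda>(a, b). {a..b}) ` ((\<rat> \<times> \<rat>) \<inter> {(a, b). {a..b} \<subseteq> I}))"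
  show ?thesis
  proof (rule measurable_piecewise_restrict[where C = C])
    show "countable C" unfolding C_def
      by (intro countable_insert countable_image countable_Int1 countable_SIGMA countable_rat)
    show "space borel \<subseteq> \<Union> C"
    proof
      fix x :: real
      show "x \<in> \<Union> C"
      proof (cases "x \<in> I")
        case True
        then obtain a' b' where "a' < x" "x < b'" "{a'..b'} \<subseteq> I" using enlarge[of x x] by auto
        moreover obtain a b where "a \<in> \<rat>" "a' < a" "a < x" "b \<in> \<rat>" "x < b" "b < b'"
          using Rats_dense_in_real calculation by meson
        moreover have "{a..b} \<subseteq> {a'..b'}" using calculation by auto
        ultimately have "(a, b) \<in> (\<rat> \<times> \<rat>) \<inter> {(a, b). {a..b} \<subseteq> I}" "x \<in> {a..b}" by auto
        then show ?thesis unfolding C_def by blast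
      qed (simp add: C_def)
    qed
    fix \<Omega> assume \<Omega>: "\<Omega> \<in> C"
    show m: "\<Omega> \<inter> space borel \<in> sets borel" using \<Omega> by (auto simp: C_def)
    show "(\<lambda>x. indicat_real I x *\<^sub>R w x) \<in> borel_measurable (restrict_space borel \<Omega>)"
    proof (subst borel_measurable_restrict_space_iff[OF m])
      consider "\<Omega> = - I" | a b where "\<Omega> = {a..b}" "{a..b} \<subseteq> I" using \<Omega> by (auto simp: C_def)
      then show "(\<lambda>x. indicat_real \<Omega> x *\<^sub>R indicat_real I x *\<^sub>R w x) \<in> borel_measurable borel"
      proof cases
        case 1
        then have "(\<lambda>x. indicat_real \<Omega> x *\<^sub>R indicat_real I x *\<^sub>R w x) = (\<lambda>x. 0)" by (auto simp: indicator_def)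
        then show ?thesis by simp
      next
        case 2
        then have "(\<lambda>x. indicat_real \<Omega> x *\<^sub>R indicat_real I x *\<^sub>R w x) = (\<lambda>x. indicat_real {a..b} x *\<^sub>R w x)"
          by (auto simp: fun_eq_iff indicator_def subset_iff)
        moreover have "integrable lborel (\<lambda>x. indicat_real {a..b} x *\<^sub>R w x)"
          using assms 2 unfolding locally_integrable_def set_integrable_def by blast
        ultimately show ?thesis using borel_measurable_integrable by fastforce
      qed
    qed
  qed
qed

lemma locally_integrable_cong_AE:
  assumes u: "locally_integrable I u" and eq: "AE x in lborel. x \<in> I \<longrightarrow> u x = u' x"
    and m: "(\<lambda>x. indicator I x *\<^sub>R u' x) \<in> borel_measurable borel"
  shows "locally_integrable I u'"
  unfolding locally_integrable_def set_integrable_def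
proof (intro allI impI)
  fix a b :: real assume ab: "{a..b} \<subseteq> I"
  have e: "indicat_real {a..b} x *\<^sub>R u' x = indicat_real {a..b} x *\<^sub>R (indicat_real I x *\<^sub>R u' x)" for x
    using ab by (cases "x \<in> I") (auto simp: indicator_def)
  show "integrable lborel (\<lambda>x. indicat_real {a..b} x *\<^sub>R u' x)"
  proof (rule integrable_AE_cong)
    show "integrable lborel (\<lambda>x. indicat_real {a..b} x *\<^sub>R u x)"
      using u ab unfolding locally_integrable_def set_integrable_def by blast
    show "(\<lambda>x. indicat_real {a..b} x *\<^sub>R u' x) \<in> borel_measurable lborel"
      unfolding e using m by measurable
    show "AE x in lborel. indicat_real {a..b} x *\<^sub>R u x = indicat_real {a..b} x *\<^sub>R u' x"
      using eq
    proof eventually_elim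
      case (elim x) then show ?case using ab by (cases "x \<in> {a..b}") (auto simp: subset_iff)
    qed
  qed
qed

lemma test_integral_cong_AE:
  assumes "\<phi> \<in> test_functions I" "locally_integrable I u" "locally_integrable I u'"
    and eq: "AE x in lborel. x \<in> I \<longrightarrow> u x = u' x"
  shows "(LINT x:I|lborel. \<phi> x *\<^sub>R u x) = (LINT x:I|lborel. \<phi> x *\<^sub>R u' x)"
  unfolding set_lebesgue_integral_def
proof (rule integral_cong_AE)
  show "AE x in lborel. indicat_real I x *\<^sub>R \<phi> x *\<^sub>R u x = indicat_real I x *\<^sub>R \<phi> x *\<^sub>R u' x"
    using eq
  proof eventually_elim
    case (elim x) then show ?case by (cases "x \<in> I") auto
  qed
qed (use test_integrable[OF assms(1,2)] test_integrable[OF assms(1,3)] in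
  \<open>auto simp: set_integrable_def dest: borel_measurable_integrable\<close>)

lemma test_deriv_pow: "\<phi> \<in> test_functions I \<Longrightarrow> (deriv ^^ k) \<phi> \<in> test_functions I"
  by (induction k) (auto intro: test_deriv)

text \<open>Measurability is assumed for the new functions because equality almost everywhere does
  not transfer it: Borel measurability is not complete.\<close>

lemma has_weak_deriv_cong_AE:
  assumes w: "has_weak_deriv I k u w"
    and equ: "AE x in lborel. x \<in> I \<longrightarrow> u x = u' x" and eqw: "AE x in lborel. x \<in> I \<longrightarrow> w x = w' x"
    and mu: "(\<lambda>x. indicator I x *\<^sub>R u' x) \<in> borel_measurable borel"
    and mw: "(\<lambda>x. indicator I x *\<^sub>R w' x) \<in> borel_measurable borel"
  shows "has_weak_deriv I k u' w'"
proof -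
  have li: "locally_integrable I u" "locally_integrable I w"
    using w by (auto simp: has_weak_deriv_def)
  have li': "locally_integrable I u'" "locally_integrable I w'"
    using locally_integrable_cong_AE[OF li(1) equ mu] locally_integrable_cong_AE[OF li(2) eqw mw] .
  show ?thesis
    unfolding has_weak_deriv_def
  proof (intro conjI li' ballI)
    fix \<phi> assume \<phi>: "\<phi> \<in> test_functions I"
    show "(LINT x:I|lborel. (deriv ^^ k) \<phi> x *\<^sub>R u' x) = (- 1) ^ k * (LINT x:I|lborel. \<phi> x *\<^sub>R w' x)"
      using w \<phi> test_integral_cong_AE[OF test_deriv_pow[OF \<phi>] li(1) li'(1) equ]
        test_integral_cong_AE[OF \<phi> li(2) li'(2) eqw]
      unfolding has_weak_deriv_def by metis
  qed
qed

lemma has_weak_deriv_unique: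
  assumes "has_weak_deriv I k u w" "has_weak_deriv I k u w'"
  shows "AE x in lborel. x \<in> I \<longrightarrow> w x = w' x"
proof -
  have li: "locally_integrable I w" "locally_integrable I w'"
    using assms by (auto simp: has_weak_deriv_def)
  have "AE x in lborel. x \<in> I \<longrightarrow> w x - w' x = 0"
  proof (rule fundamental_lemma[OF locally_integrable_diff[OF li]])
    fix \<phi> assume \<phi>: "\<phi> \<in> test_functions I"
    have "(-1) ^ k * (LINT x:I|lborel. \<phi> x *\<^sub>R w x) = (-1) ^ k * (LINT x:I|lborel. \<phi> x *\<^sub>R w' x)"
      using assms \<phi> unfolding has_weak_deriv_def by metis
    then have "(LINT x:I|lborel. \<phi> x *\<^sub>R w x) = (LINT x:I|lborel. \<phi> x *\<^sub>R w' x)" by simp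
    then show "(LINT x:I|lborel. \<phi> x *\<^sub>R (w x - w' x)) = 0"
      unfolding scaleR_diff_right set_integral_diff(2)[OF test_integrable[OF \<phi> li(1)] test_integrable[OF \<phi> li(2)]]
      by (rule right_minus_eq[THEN iffD2])
  qed
  then show ?thesis by simp
qed

lemma has_weak_deriv_ac:
  assumes "ac_deriv I F D" shows "has_weak_deriv I 1 F D"
  using integral_by_parts_test[OF assms] ac_deriv_locally_integrable[OF assms]
  by (auto simp: has_weak_deriv_def)

text \<open>Derivatives of test functions annihilate the difference of \<open>u\<close> and a
  primitive of \<open>w\<close>, so it is constant. \<open>J\<close> may be larger than
  \<open>I\<close>: the representative lives on the closed edge.\<close>

lemma has_weak_deriv_rep:
  assumes w: "has_weak_deriv I 1 u w" and J: "is_interval J" "I \<subseteq> J"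
    and int: "\<And>a b. {a..b} \<subseteq> J \<Longrightarrow> set_integrable lborel {a..b} w"
  obtains F where "ac_deriv J F w" "AE x in lborel. x \<in> I \<longrightarrow> u x = F x"
proof -
  obtain x0 where "x0 \<in> J" using nonempty_I J by blast
  then obtain F where F: "ac_deriv J F w" using ac_deriv_primitive[OF J(1) _ int] by metis
  have FI: "ac_deriv I F w" using ac_deriv_subset[OF F J(2)] .
  have li: "locally_integrable I u" "locally_integrable I F"
    using w ac_deriv_locally_integrable[OF FI] by (auto simp: has_weak_deriv_def)
  obtain c where c: "AE x in lborel. x \<in> I \<longrightarrow> u x - F x = c"
  proof (rule du_Bois_Reymond[OF locally_integrable_diff[OF li]])
    fix \<phi> assume \<phi>: "\<phi> \<in> test_functions I"
    have "(LINT x:I|lborel. deriv \<phi> x *\<^sub>R u x) = - (LINT x:I|lborel. \<phi> x *\<^sub>R w x)"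
      using w \<phi> by (simp add: has_weak_deriv_def)
    also have "\<dots> = (LINT x:I|lborel. deriv \<phi> x *\<^sub>R F x)"
      using integral_by_parts_test[OF FI \<phi>] by simp
    finally show "(LINT x:I|lborel. deriv \<phi> x *\<^sub>R (u x - F x)) = 0"
      unfolding scaleR_diff_right
        set_integral_diff(2)[OF test_integrable[OF test_deriv[OF \<phi>] li(1)] test_integrable[OF test_deriv[OF \<phi>] li(2)]]
      by (rule right_minus_eq[THEN iffD2])
  qed
  show ?thesis
  proof (rule that)
    show "ac_deriv J (\<lambda>x. F x + c) w"
      using ac_deriv_add[OF F ac_deriv_const[of _ c]] by simp
    show "AE x in lborel. x \<in> I \<longrightarrow> u x = F x + c" using c by eventually_elim (auto simp: algebra_simps)
  qed
qed

text \<open>\<open>deriv \<phi>\<close> is itself a test function, so the relation between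
  \<open>u\<close> and \<open>w1\<close> already performs one of the two integrations by
  parts.\<close>

lemma has_weak_deriv_2_iff:
  assumes "has_weak_deriv I 1 u w1"
  shows "has_weak_deriv I 2 u w2 \<longleftrightarrow> has_weak_deriv I 1 w1 w2"
proof -
  have "(LINT x:I|lborel. deriv (deriv \<phi>) x *\<^sub>R u x) = - (LINT x:I|lborel. deriv \<phi> x *\<^sub>R w1 x)"
    if "\<phi> \<in> test_functions I" for \<phi>
    using assms test_deriv[OF that] by (simp add: has_weak_deriv_def)
  then show ?thesis
    using assms by (auto simp: has_weak_deriv_def numeral_2_eq_2 neg_eq_iff_add_eq_0 add_eq_0_iff)
qed

end

section \<open>Gaussian weights on intervals\<close>

lemma ac_deriv_C1_mult:
  assumes "ac_deriv J F D" "\<And>x. (f has_real_derivative f' x) (at x)" "continuous_on UNIV f'"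
  shows "ac_deriv J (\<lambda>x. of_real (f x) * F x) (\<lambda>x. of_real (f' x) * F x + of_real (f x) * D x)"
proof (rule ac_deriv_mult[OF _ assms(1)], rule ac_deriv_C1)
  show "((\<lambda>x. complex_of_real (f x)) has_vector_derivative complex_of_real (f' x)) (at x)" for x
    using assms(2) by (intro has_vector_derivative_of_real) (simp add: has_real_derivative_iff_has_vector_derivative)
  show "continuous_on UNIV (\<lambda>x. complex_of_real (f' x))"
    using assms(3) by (intro continuous_intros)
qed

lemma ac_deriv_Re:
  assumes "ac_deriv J F D" "a \<le> b" "{a..b} \<subseteq> J"
  shows "set_integrable lborel {a..b} (\<lambda>x. Re (D x))" "(LINT x:{a..b}|lborel. Re (D x)) = Re (F b) - Re (F a)"
proof -
  have eq: "(\<lambda>x. indicat_real {a..b} x *\<^sub>R Re (D x)) = (\<lambda>x. Re (indicat_real {a..b} x *\<^sub>R D x))" by simp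
  show "set_integrable lborel {a..b} (\<lambda>x. Re (D x))"
    unfolding set_integrable_def eq
    by (rule integrable_Re) (use ac_derivD(1)[OF assms] in \<open>simp add: set_integrable_def\<close>)
  show "(LINT x:{a..b}|lborel. Re (D x)) = Re (F b) - Re (F a)"
    unfolding set_lebesgue_integral_def eq
    using ac_derivD[OF assms] by (simp add: set_lebesgue_integral_def set_integrable_def del: scaleR_complex.simps)
qed

lemma cmod_mult_le_squares: "cmod (a * b) \<le> (cmod a)\<^sup>2 + (cmod b)\<^sup>2"
proof -
  have "2 * (cmod a * cmod b) \<le> (cmod a)\<^sup>2 + (cmod b)\<^sup>2"
    using sum_squares_bound[of "cmod a" "cmod b"] by simp
  moreover have "0 \<le> cmod a * cmod b" by simp
  ultimately show ?thesis unfolding norm_mult by linarith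
qed

text \<open>A single edge in its arc length coordinate: \<open>hl\<close> marks a half-line,
  \<open>l\<close> is the length of a compact edge, and \<open>d\<close> is the distance of the
  starting point from the root, so that \<open>d + t\<close> is \<open>|x|\<close>.\<close>

locale gauss_interval =
  fixes hl :: bool and l d :: real
  assumes l_pos: "\<not> hl \<Longrightarrow> 0 < l" and d_nonneg: "0 \<le> d"
begin

definition I :: "real set" where "I = (if hl then {0<..} else {0<..<l})"
definition J :: "real set" where "J = (if hl then {0..} else {0..l})"
definition G :: "real \<Rightarrow> real" where "G t = 2 / sqrt pi * exp (- (d + t)\<^sup>2)"
definition M :: "real measure" where "M = density (restrict_space lborel I) (\<lambda>t. ennreal (G t))"
text \<open>The boundary term of the fundamental theorem of calculus; infinity contributes nothing
  on a half-line, as \<open>integral_ac_deriv\<close> justifies.\<close>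

definition bdry :: "(real \<Rightarrow> complex) \<Rightarrow> complex" where "bdry F = (if hl then 0 else F l) - F 0"

sublocale open_interval I
  by standard (use l_pos in \<open>auto simp: I_def is_interval_def dense\<close>)

lemma J_half_line: "hl \<Longrightarrow> J = {0..}" and J_compact: "\<not> hl \<Longrightarrow> J = {0..l}"
  unfolding J_def by simp_all

lemma I_half_line: "hl \<Longrightarrow> I = {0<..}" and I_compact: "\<not> hl \<Longrightarrow> I = {0<..<l}"
  unfolding I_def by simp_all

lemma I_subset_J: "I \<subseteq> J" by (auto simp: I_def J_def)

lemma interval_J: "is_interval J" by (auto simp: J_def)

lemma zero_in_J: "0 \<in> J" using l_pos by (auto simp: J_def less_imp_le)

lemma J_minus_I: "J - I \<subseteq> {0, l}" by (auto simp: I_def J_def)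

lemma AE_not_boundary: "AE t in lborel. t \<notin> J - I"
  using AE_lborel_singleton[of 0] AE_lborel_singleton[of l]
  by eventually_elim (use J_minus_I in auto)

lemma AE_J_iff: "(AE t in lborel. t \<in> J \<longrightarrow> P t) \<longleftrightarrow> (AE t in lborel. t \<in> I \<longrightarrow> P t)"
  using AE_not_boundary I_subset_J by (auto elim: eventually_elim2)

lemma G_pos: "0 < G t" by (simp add: G_def)

lemma G_continuous: "continuous_on A G" by (auto simp: G_def[abs_def] intro!: continuous_intros)

lemma G_measurable [measurable]: "G \<in> borel_measurable borel"
  by (rule borel_measurable_continuous_onI[OF G_continuous])

lemma G_deriv: "(G has_real_derivative - 2 * (d + t) * G t) (at t)"
proof -
  have "((\<lambda>t. exp (- (d + t)\<^sup>2)) has_real_derivative exp (- (d + t)\<^sup>2) * (- 2 * (d + t))) (at t)"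
    by (auto intro!: derivative_eq_intros)
  from DERIV_cmult[OF this, of "2 / sqrt pi"] show ?thesis
    unfolding G_def[abs_def] by (simp only: ac_simps)
qed

lemma measurable_M: 
  fixes u :: "real \<Rightarrow> 'b::real_normed_vector"
  shows "u \<in> borel_measurable M \<longleftrightarrow> (\<lambda>t. indicator I t *\<^sub>R u t) \<in> borel_measurable borel"
  unfolding M_def measurable_density_eq1 by (subst borel_measurable_restrict_space_iff) auto

lemma AE_M: "(AE t in M. P t) \<longleftrightarrow> (AE t in lborel. t \<in> I \<longrightarrow> P t)"
proof -
  have "(AE t in M. P t) \<longleftrightarrow> (AE t in restrict_space lborel I. P t)"
    unfolding M_def by (subst AE_density) (auto simp: G_pos intro!: measurable_restrict_space1)
  then show ?thesis by (subst (asm) AE_restrict_space_iff) auto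
qed

text \<open>Measurability of \<open>f\<close> need not be known beforehand: \<open>G\<close> is
  positive, so dividing by it recovers \<open>f\<close> from the integrand on the right.\<close>

lemma integrable_M:
  fixes f :: "real \<Rightarrow> 'b::{banach, second_countable_topology}"
  shows "integrable M f \<longleftrightarrow> set_integrable lborel I (\<lambda>t. G t *\<^sub>R f t)"
proof -
  have Gm: "G \<in> borel_measurable (restrict_space lborel I)" by (intro measurable_restrict_space1) auto
  have *: "integrable M f \<longleftrightarrow> set_integrable lborel I (\<lambda>t. G t *\<^sub>R f t)" if "f \<in> borel_measurable M"
    using that unfolding M_def measurable_density_eq1 set_integrable_def
    by (subst integrable_density) (auto simp: Gm integrable_restrict_space G_pos less_imp_le)
  have "f \<in> borel_measurable M" if "set_integrable lborel I (\<lambda>t. G t *\<^sub>R f t)"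
  proof -
    have "(\<lambda>t. indicator I t *\<^sub>R (G t *\<^sub>R f t)) \<in> borel_measurable borel"
      using that[unfolded set_integrable_def, THEN borel_measurable_integrable] by simp
    then have "(\<lambda>t. inverse (G t) *\<^sub>R (indicator I t *\<^sub>R (G t *\<^sub>R f t))) \<in> borel_measurable borel"
      by measurable
    moreover have "inverse (G t) *\<^sub>R (indicator I t *\<^sub>R (G t *\<^sub>R f t)) = indicator I t *\<^sub>R f t" for t
      using G_pos[of t] by simp
    ultimately show ?thesis unfolding measurable_M by (simp only:)
  qed
  with * show ?thesis by (meson borel_measurable_integrable)
qed

lemma integral_M:
  fixes f :: "real \<Rightarrow> 'b::{banach, second_countable_topology}"
  shows "(LINT t|M. f t) = (LINT t:I|lborel. G t *\<^sub>R f t)"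
proof (cases "f \<in> borel_measurable M")
  case True
  have Gm: "G \<in> borel_measurable (restrict_space lborel I)" by (intro measurable_restrict_space1) auto
  show ?thesis
    using True unfolding M_def measurable_density_eq1 set_lebesgue_integral_def
    by (subst integral_density) (auto simp: Gm integral_restrict_space G_pos less_imp_le)
next
  case False
  \<comment> \<open>Neither side is integrable, so both integrals have the default value 0.\<close>
  then have "\<not> integrable M f" "\<not> set_integrable lborel I (\<lambda>t. G t *\<^sub>R f t)"
    using integrable_M[of f] by (auto dest: borel_measurable_integrable)
  then show ?thesis
    by (simp add: not_integrable_integral_eq set_lebesgue_integral_def set_integrable_def)
qed

abbreviation sq :: "(real \<Rightarrow> complex) set" where "sq \<equiv> square_int M"

lemma sq_mult_integrable:
  assumes "u \<in> sq" "v \<in> sq"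
  shows "integrable M (\<lambda>t. u t * v t)"
proof (rule Bochner_Integration.integrable_bound)
  show "integrable M (\<lambda>t. (cmod (u t))\<^sup>2 + (cmod (v t))\<^sup>2)" using assms by (simp add: square_int_def)
  have [measurable]: "u \<in> borel_measurable M" "v \<in> borel_measurable M" using assms by (auto simp: square_int_def)
  show "(\<lambda>t. u t * v t) \<in> borel_measurable M" by measurable
  show "AE t in M. cmod (u t * v t) \<le> norm ((cmod (u t))\<^sup>2 + (cmod (v t))\<^sup>2)"
    using cmod_mult_le_squares by (intro AE_I2) (simp add: abs_of_nonneg)
qed

lemma sq_cmult: "u \<in> sq \<Longrightarrow> (\<lambda>t. c * u t) \<in> sq"
  by (auto simp: square_int_def norm_mult power_mult_distrib)

lemma sq_cnj: assumes "u \<in> sq" shows "(\<lambda>t. cnj (u t)) \<in> sq"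
proof -
  have [measurable]: "u \<in> borel_measurable M" using assms by (auto simp: square_int_def)
  have "(\<lambda>t. cnj (u t)) \<in> borel_measurable M"
    by (rule borel_measurable_continuous_on[where g=u]) (use assms in \<open>auto simp: square_int_def intro!: continuous_intros\<close>)
  then show ?thesis using assms by (simp add: square_int_def)
qed

lemma sq_add:
  assumes "u \<in> sq" "v \<in> sq" shows "(\<lambda>t. u t + v t) \<in> sq"
proof -
  have [measurable]: "u \<in> borel_measurable M" "v \<in> borel_measurable M" using assms by (auto simp: square_int_def)
  have "integrable M (\<lambda>t. (cmod (u t + v t))\<^sup>2)"
  proof (rule Bochner_Integration.integrable_bound)
    show "integrable M (\<lambda>t. 2 * (cmod (u t))\<^sup>2 + 2 * (cmod (v t))\<^sup>2)" using assms by (simp add: square_int_def)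
    show "AE t in M. norm ((cmod (u t + v t))\<^sup>2) \<le> norm (2 * (cmod (u t))\<^sup>2 + 2 * (cmod (v t))\<^sup>2)"
    proof (rule AE_I2)
      fix t
      have "(cmod (u t + v t))\<^sup>2 \<le> (cmod (u t) + cmod (v t))\<^sup>2"
        by (intro power_mono norm_triangle_ineq) simp
      also have "\<dots> \<le> 2 * (cmod (u t))\<^sup>2 + 2 * (cmod (v t))\<^sup>2"
        using sum_squares_bound[of "cmod (u t)" "cmod (v t)"] by (simp add: power2_sum)
      finally show "norm ((cmod (u t + v t))\<^sup>2) \<le> norm (2 * (cmod (u t))\<^sup>2 + 2 * (cmod (v t))\<^sup>2)" by simp
    qed
  qed measurable
  then show ?thesis by (simp add: square_int_def)
qed

lemma sq_diff: "u \<in> sq \<Longrightarrow> v \<in> sq \<Longrightarrow> (\<lambda>t. u t - v t) \<in> sq"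
  using sq_add[of u "\<lambda>t. - 1 * v t"] sq_cmult[of v "- 1"] by simp

lemma sq_zero: "(\<lambda>t. 0) \<in> sq"
  by (simp add: square_int_def)

lemma sq_cong_AE:
  assumes "u \<in> sq" "v \<in> borel_measurable M" "AE t in M. u t = v t"
  shows "v \<in> sq"
proof -
  have [measurable]: "u \<in> borel_measurable M" using assms by (simp add: square_int_def)
  note assms(2)[measurable]
  have "integrable M (\<lambda>t. (cmod (u t))\<^sup>2) \<longleftrightarrow> integrable M (\<lambda>t. (cmod (v t))\<^sup>2)"
    by (rule integrable_cong_AE) (use assms(3) in auto)
  then show ?thesis using assms by (simp add: square_int_def)
qed

lemma set_integrable_cong_boundary:
  fixes f :: "real \<Rightarrow> 'b::{banach, second_countable_topology}"
  assumes "{a..b} \<subseteq> J"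
  shows "set_integrable lborel {a..b} f \<longleftrightarrow> set_integrable lborel ({a..b} \<inter> I) f"
  unfolding set_integrable_def
proof (rule integrable_discrete_difference[where X="J - I"])
  show "countable (J - I)" using J_minus_I by (rule countable_subset) simp
  show "emeasure lborel {x} = 0" if "x \<in> J - I" for x by simp
qed (use assms in \<open>auto simp: indicator_def\<close>)

lemma G_lower_bound:
  obtains m where "m > 0" "\<And>t. t \<in> {a..b} \<Longrightarrow> m \<le> G t"
proof (cases "a \<le> b")
  case True
  then obtain x where x: "x \<in> {a..b}" "\<forall>y\<in>{a..b}. G x \<le> G y"
    using continuous_attains_inf[OF compact_Icc _ G_continuous] by (metis atLeastatMost_empty_iff2 linorder_not_less)
  then show ?thesis using that[of "G x"] G_pos by auto
next
  case False then show ?thesis using that[of 1] by auto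
qed

text \<open>On a compact interval \<open>G\<close> is bounded below, and
  \<open>cmod (u t) \<le> 1 + (cmod (u t))\<^sup>2\<close>. The interval may reach the ends of the
  edge, and this is what produces values at the vertices.\<close>

lemma sq_set_integrable:
  assumes "u \<in> sq" "{a..b} \<subseteq> J"
  shows "set_integrable lborel {a..b} u"
proof -
  obtain m where m: "m > 0" "\<And>t. t \<in> {a..b} \<Longrightarrow> m \<le> G t"
    using G_lower_bound[of a b] by blast
  have mu: "(\<lambda>t. indicator I t *\<^sub>R u t) \<in> borel_measurable borel"
    using assms by (simp add: square_int_def measurable_M)
  have i2: "set_integrable lborel I (\<lambda>t. G t *\<^sub>R (cmod (u t))\<^sup>2)"
    using assms unfolding square_int_def integrable_M by simp
  have "set_integrable lborel ({a..b} \<inter> I) u"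
    unfolding set_integrable_def
  proof (rule Bochner_Integration.integrable_bound)
    have "set_integrable lborel {a..b} (\<lambda>t. 1::real)" by (intro borel_integrable_atLeastAtMost' continuous_intros)
    then show "integrable lborel (\<lambda>t. indicator {a..b} t *\<^sub>R 1 + (1 / m) *\<^sub>R (indicator I t *\<^sub>R (G t *\<^sub>R (cmod (u t))\<^sup>2)))"
      using i2 unfolding set_integrable_def by (intro Bochner_Integration.integrable_add integrable_scaleR_right)
    have "(\<lambda>t. indicator {a..b} t *\<^sub>R (indicator I t *\<^sub>R u t)) \<in> borel_measurable borel" using mu by measurable
    then show "(\<lambda>t. indicator ({a..b} \<inter> I) t *\<^sub>R u t) \<in> borel_measurable lborel"
      by (simp add: indicator_inter_arith)
    show "AE t in lborel. norm (indicat_real ({a..b} \<inter> I) t *\<^sub>R u t) \<le>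
        norm (indicat_real {a..b} t *\<^sub>R (1::real) + (1 / m) *\<^sub>R (indicat_real I t *\<^sub>R (G t *\<^sub>R (cmod (u t))\<^sup>2)))"
    proof (rule AE_I2)
      fix t
      show "norm (indicat_real ({a..b} \<inter> I) t *\<^sub>R u t) \<le>
        norm (indicat_real {a..b} t *\<^sub>R (1::real) + (1 / m) *\<^sub>R (indicat_real I t *\<^sub>R (G t *\<^sub>R (cmod (u t))\<^sup>2)))"
      proof (cases "t \<in> {a..b} \<inter> I")
        case True
        have "cmod (u t) \<le> 1 + (cmod (u t))\<^sup>2"
          using sum_squares_bound[of 1 "cmod (u t)"] norm_ge_zero[of "u t"]
          unfolding mult_1_right power_one by linarith
        also have "\<dots> \<le> 1 + G t * (cmod (u t))\<^sup>2 / m"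
          using m True by (simp add: field_simps mult_right_mono)
        finally show ?thesis using True m G_pos[of t] by (simp add: abs_of_nonneg)
      qed auto
    qed
  qed
  then show ?thesis using set_integrable_cong_boundary[OF assms(2)] by blast
qed

lemma ac_deriv_continuous:
  assumes "ac_deriv J F D" shows "continuous_on J F"
proof (cases hl)
  case True
  note J = J_half_line[OF True]
  show ?thesis
    unfolding continuous_on_eq_continuous_within
  proof
    fix x assume x: "x \<in> J"
    have "continuous_on {0..x + 1} F" by (rule ac_deriv_continuous_Icc[OF assms]) (auto simp: J)
    then have "continuous (at x within {0..x + 1}) F"
      using x by (simp add: continuous_on_eq_continuous_within J)
    moreover have "at x within {0..x + 1} = at x within J"
      by (rule at_within_nhd[of _ "{..<x + 1}"]) (auto simp: J)
    ultimately show "continuous (at x within J) F" by simp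
  qed
next
  case False
  note J = J_compact[OF False]
  show ?thesis using ac_deriv_continuous_Icc[OF assms, of 0 l] unfolding J by simp
qed

lemma continuous_measurable:
  fixes F :: "real \<Rightarrow> 'b::real_normed_vector"
  assumes "continuous_on J F" shows "F \<in> borel_measurable M"
  unfolding measurable_M
  by (rule borel_measurable_continuous_on_indicator) (use assms I_subset_J continuous_on_subset in auto)

text \<open>A point of disagreement in \<open>I\<close> comes with a whole ball of disagreement,
  which is not a null set. Since \<open>I\<close> is dense in \<open>J\<close>, the ends follow by
  continuity.\<close>

lemma continuous_unique:
  assumes F: "continuous_on J F" and F': "continuous_on J F'" and eq: "AE t in M. F t = (F' t :: complex)" and x: "x \<in> J"
  shows "F x = F' x"
proof -
  have D: "F t = F' t" if t: "t \<in> I" for t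
  proof (rule ccontr)
    assume ne: "F t \<noteq> F' t"
    have "continuous_on I (\<lambda>t. F t - F' t)"
      by (intro continuous_intros) (use F F' I_subset_J continuous_on_subset in blast)+
    then have "open (I \<inter> (\<lambda>t. F t - F' t) -` (- {0}))"
      by (intro continuous_open_preimage open_I) auto
    moreover have "t \<in> I \<inter> (\<lambda>t. F t - F' t) -` (- {0})" using t ne by simp
    ultimately obtain e where e: "e > 0" "ball t e \<subseteq> I \<inter> (\<lambda>t. F t - F' t) -` (- {0})"
      using openE by blast
    have "AE s in lborel. s \<notin> ball t e"
      using eq[unfolded AE_M] by eventually_elim (use e in auto)
    then have "emeasure lborel {s \<in> space lborel. \<not> s \<notin> ball t e} = 0"
      by (subst (asm) AE_iff_measurable[OF _ refl]) auto
    moreover have "{s \<in> space lborel. \<not> s \<notin> ball t e} = {t - e<..<t + e}"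
      by (auto simp: dist_real_def)
    ultimately show False using e by simp
  qed
  have "J \<subseteq> closure I" using l_pos by (auto simp: I_def J_def split: if_splits)
  moreover have "closed {x \<in> J. F x = F' x}"
    by (intro continuous_closed_preimage_constant[of J "\<lambda>x. F x - F' x" 0, simplified] continuous_on_diff F F')
      (auto simp: J_def)
  ultimately show ?thesis
    using closure_minimal[of I "{x \<in> J. F x = F' x}"] D I_subset_J x by auto
qed

end

section \<open>Weighted estimates\<close>

text \<open>Young's inequality, from the squared modulus of \<open>s * a - b\<close>.\<close>

lemma Re_mult_cnj_le: "2 * s * Re (a * cnj b) \<le> s\<^sup>2 * (cmod a)\<^sup>2 + (cmod b)\<^sup>2"
proof -
  have "0 \<le> (s * Re a - Re b)\<^sup>2 + (s * Im a - Im b)\<^sup>2" by simp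
  then show ?thesis unfolding cmod_power2 by (simp add: power2_eq_square algebra_simps)
qed

context gauss_interval
begin

lemma set_integral_boundary:
  fixes f :: "real \<Rightarrow> 'b::{banach, second_countable_topology}"
  assumes "{a..b} \<subseteq> J"
  shows "(LINT t:{a..b}|lborel. f t) = (LINT t:{a..b} \<inter> I|lborel. f t)"
  unfolding set_lebesgue_integral_def
proof (rule integral_discrete_difference[where X="J - I"])
  show "countable (J - I)" using J_minus_I by (rule countable_subset) simp
  show "emeasure lborel {x} = 0" if "x \<in> J - I" for x by simp
qed (use assms in \<open>auto simp: indicator_def\<close>)

lemma set_integrable_Icc:
  fixes f :: "real \<Rightarrow> 'b::{banach, second_countable_topology}"
  assumes "set_integrable lborel I f" "{a..b} \<subseteq> J"
  shows "set_integrable lborel {a..b} f"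
  unfolding set_integrable_cong_boundary[OF assms(2)]
  by (rule set_integrable_subset[OF assms(1)]) auto

lemma set_integral_Icc_le:
  fixes f :: "real \<Rightarrow> real"
  assumes "set_integrable lborel I f" "{a..b} \<subseteq> J" "\<And>t. t \<in> I \<Longrightarrow> 0 \<le> f t"
  shows "(LINT t:{a..b}|lborel. f t) \<le> (LINT t:I|lborel. f t)"
  unfolding set_integral_boundary[OF assms(2)] unfolding set_lebesgue_integral_def
proof (rule integral_mono)
  show "integrable lborel (\<lambda>t. indicat_real ({a..b} \<inter> I) t *\<^sub>R f t)"
    using set_integrable_subset[OF assms(1), of "{a..b} \<inter> I"] by (simp add: set_integrable_def)
  show "integrable lborel (\<lambda>t. indicat_real I t *\<^sub>R f t)" using assms(1) by (simp add: set_integrable_def)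
  show "indicat_real ({a..b} \<inter> I) t *\<^sub>R f t \<le> indicat_real I t *\<^sub>R f t" for t
    using assms(3)[of t] by (auto simp: indicator_def)
qed

text \<open>The larger endpoint \<open>R2\<close> leaves room for a cutoff function.\<close>

lemma set_integrable_from_bounds:
  fixes f :: "real \<Rightarrow> real"
  assumes m: "(\<lambda>t. indicator I t *\<^sub>R f t) \<in> borel_measurable borel" and nn: "\<And>t. t \<in> I \<Longrightarrow> 0 \<le> f t"
    and bound: "\<And>R. 0 \<le> R \<Longrightarrow> {0..R} \<subseteq> J \<Longrightarrow> \<exists>R2\<ge>R. \<exists>h. {0..R2} \<subseteq> J \<and> set_integrable lborel {0..R2} h \<and>
      (\<forall>t\<in>I \<inter> {0..R2}. 0 \<le> h t) \<and> (\<forall>t\<in>I \<inter> {0..R}. f t \<le> h t) \<and> (LINT t:{0..R2}|lborel. h t) \<le> K"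
  shows "set_integrable lborel I f"
proof -
  \<comment> \<open>Continuity from below of this measure along \<open>{0..n}\<close> turns uniform
    bounds into integrability, and it asks only for measurability of \<open>f\<close>.\<close>
  define N where "N = density lborel (\<lambda>t. ennreal (indicator I t * f t))"
  define S where "S n = {0..(if hl then real n else l)}" for n
  have m' [measurable]: "(\<lambda>t. ennreal (indicator I t * f t)) \<in> borel_measurable lborel"
    using m by simp
  have SJ: "S n \<subseteq> J" for n
    using J_half_line J_compact by (cases hl) (auto simp: S_def)
  have "emeasure N (S n) \<le> ennreal K" for n
  proof -
    define R where "R = (if hl then real n else l)"
    have R: "0 \<le> R" "{0..R} \<subseteq> J" "S n = {0..R}" using SJ[of n] l_pos by (auto simp: S_def R_def)
    obtain R2 h where h: "R \<le> R2" "{0..R2} \<subseteq> J" "set_integrable lborel {0..R2} h"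
      "\<And>t. t \<in> I \<inter> {0..R2} \<Longrightarrow> 0 \<le> h t" "\<And>t. t \<in> I \<inter> {0..R} \<Longrightarrow> f t \<le> h t"
      "(LINT t:{0..R2}|lborel. h t) \<le> K" using bound[OF R(1,2)] by auto
    have "emeasure N (S n) = (\<integral>\<^sup>+t. ennreal (indicator I t * f t) * indicator {0..R} t \<partial>lborel)"
      unfolding N_def R(3) by (rule emeasure_density) (use m' in auto)
    also have "\<dots> \<le> (\<integral>\<^sup>+t. ennreal (indicator ({0..R2} \<inter> I) t *\<^sub>R h t) \<partial>lborel)"
    proof (rule nn_integral_mono)
      fix t show "ennreal (indicator I t * f t) * indicator {0..R} t \<le> ennreal (indicator ({0..R2} \<inter> I) t *\<^sub>R h t)"
      proof (cases "t \<in> I \<inter> {0..R}")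
        case True
        then have "t \<in> {0..R2} \<inter> I" using h(1) by auto
        then show ?thesis using True h(5)[OF True] by (simp add: ennreal_leI)
      qed (auto simp: indicator_def)
    qed
    also have "\<dots> = ennreal (LINT t|lborel. indicator ({0..R2} \<inter> I) t *\<^sub>R h t)"
    proof (rule nn_integral_eq_integral)
      show "integrable lborel (\<lambda>t. indicator ({0..R2} \<inter> I) t *\<^sub>R h t)"
        using h(3) unfolding set_integrable_cong_boundary[OF h(2)] by (simp add: set_integrable_def)
      show "AE t in lborel. 0 \<le> indicator ({0..R2} \<inter> I) t *\<^sub>R h t"
        using h(4) by (intro AE_I2) (auto simp: indicator_def)
    qed
    also have "(LINT t|lborel. indicator ({0..R2} \<inter> I) t *\<^sub>R h t) = (LINT t:{0..R2}|lborel. h t)"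
      unfolding set_integral_boundary[OF h(2)] unfolding set_lebesgue_integral_def ..
    also have "ennreal (LINT t:{0..R2}|lborel. h t) \<le> ennreal K" using h(6) by (rule ennreal_leI)
    finally show ?thesis .
  qed
  moreover have "(SUP n. emeasure N (S n)) = emeasure N (\<Union>n. S n)"
    by (rule SUP_emeasure_incseq) (auto simp: S_def N_def incseq_def)
  ultimately have fin: "emeasure N (\<Union>n. S n) \<le> ennreal K" by (metis SUP_least)
  have IS: "I \<subseteq> (\<Union>n. S n)"
  proof
    fix t assume "t \<in> I"
    then have t: "t \<in> J" using I_subset_J by blast
    obtain n where "t \<le> real n" using real_arch_simple by blast
    then have "t \<in> S n" using t J_half_line J_compact by (cases hl) (auto simp: S_def)
    then show "t \<in> (\<Union>n. S n)" by blast
  qed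
  have "(\<integral>\<^sup>+t. ennreal (norm (indicat_real I t *\<^sub>R f t)) \<partial>lborel)
      = (\<integral>\<^sup>+t. ennreal (indicator I t * f t) * indicator (\<Union>n. S n) t \<partial>lborel)"
  proof (rule nn_integral_cong)
    fix t
    show "ennreal (norm (indicat_real I t *\<^sub>R f t)) = ennreal (indicator I t * f t) * indicator (\<Union>n. S n) t"
    proof (cases "t \<in> I")
      case True
      then have "t \<in> (\<Union>n. S n)" using IS by blast
      then show ?thesis using True nn[OF True] by simp
    qed simp
  qed
  also have "\<dots> = emeasure N (\<Union>n. S n)"
    unfolding N_def by (rule emeasure_density[symmetric]) (use m' in \<open>auto simp: S_def\<close>)
  also have "\<dots> < \<infinity>" using fin by (simp add: order_le_less_trans)
  finally show ?thesis
    unfolding set_integrable_def by (intro integrableI_bounded) (use m in simp)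
qed

lemma sq_iff:
  "u \<in> sq \<longleftrightarrow> u \<in> borel_measurable M \<and> set_integrable lborel I (\<lambda>t. G t * (cmod (u t))\<^sup>2)"
  unfolding square_int_def integrable_M by simp

lemma weighted_measurable:
  assumes "u \<in> borel_measurable M"
  shows "(\<lambda>t. indicator I t *\<^sub>R (c * (G t * (cmod (u t))\<^sup>2))) \<in> borel_measurable borel"
proof -
  have m: "(\<lambda>t. indicator I t *\<^sub>R u t) \<in> borel_measurable borel" using assms by (simp add: measurable_M)
  have "indicator I t *\<^sub>R (c * (G t * (cmod (u t))\<^sup>2)) = c * (G t * (cmod (indicator I t *\<^sub>R u t))\<^sup>2)" for t
    by (auto simp: indicator_def)
  moreover have "(\<lambda>t. c * (G t * (cmod (indicator I t *\<^sub>R u t))\<^sup>2)) \<in> borel_measurable borel"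
    using m by measurable
  ultimately show ?thesis by (simp only:)
qed

lemma sqI_scaled:
  assumes "u \<in> borel_measurable M" "c > 0" "set_integrable lborel I (\<lambda>t. c * (G t * (cmod (u t))\<^sup>2))"
  shows "u \<in> sq"
proof -
  have "set_integrable lborel I (\<lambda>t. (1 / c) * (c * (G t * (cmod (u t))\<^sup>2)))"
    by (rule set_integrable_mult_right) (rule assms(3))
  then show ?thesis using assms by (simp add: sq_iff)
qed

lemma continuous_x_mult: "continuous_on J u \<Longrightarrow> continuous_on J (\<lambda>t. complex_of_real (d + t) * u t)"
  by (intro continuous_intros)

text \<open>With \<open>x = d + t\<close>, the derivative of \<open>x G |u|\<^sup>2\<close> contains \<open>- 2 x\<^sup>2 G |u|\<^sup>2\<close>, which dominates the mixed term.\<close>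

lemma sq_x_mult:
  assumes u: "ac_deriv J u w" and usq: "u \<in> sq" and wsq: "w \<in> sq"
  shows "(\<lambda>t. of_real (d + t) * u t) \<in> sq"
proof (rule sqI_scaled[of _ 1])
  show m: "(\<lambda>t. of_real (d + t) * u t) \<in> borel_measurable M"
    by (intro continuous_measurable continuous_x_mult ac_deriv_continuous[OF u])
  define P where "P t = of_real ((d + t) * G t) * (u t * cnj (u t))" for t
  define D where "D t = of_real (G t - 2 * (d + t)\<^sup>2 * G t) * (u t * cnj (u t)) +
      of_real ((d + t) * G t) * (w t * cnj (u t) + u t * cnj (w t))" for t
  define g where "g t = G t * (cmod (u t))\<^sup>2 + G t * (cmod (w t))\<^sup>2" for t
  have P: "ac_deriv J P D"
    unfolding P_def[abs_def] D_def[abs_def]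
  proof (intro ac_deriv_C1_mult ac_deriv_mult u ac_deriv_cnj)
    show "((\<lambda>t. (d + t) * G t) has_real_derivative G t - 2 * (d + t)\<^sup>2 * G t) (at t)" for t
      by (rule derivative_eq_intros G_deriv refl | simp add: algebra_simps power2_eq_square)+
    show "continuous_on UNIV (\<lambda>t. G t - 2 * (d + t)\<^sup>2 * G t)"
      by (intro continuous_intros G_continuous)
  qed
  have ReD: "Re (D t) = (G t - 2 * (d + t)\<^sup>2 * G t) * (cmod (u t))\<^sup>2 + G t * (2 * (d + t) * Re (u t * cnj (w t)))" for t
    unfolding D_def by (simp add: complex_norm_square[symmetric] algebra_simps cmod_power2 power2_eq_square)
  have gi: "set_integrable lborel I g"
    using usq wsq unfolding g_def[abs_def] sq_iff by (intro set_integral_add) auto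
  have g0: "0 \<le> g t" for t using G_pos[of t] by (simp add: g_def)
  \<comment> \<open>Of the two copies of \<open>x\<^sup>2 G |u|\<^sup>2\<close> supplied by the
    weight, Young's inequality spends one on the mixed term; the other remains.\<close>
  have le: "1 * (G t * (cmod (of_real (d + t) * u t))\<^sup>2) \<le> g t - Re (D t)" for t
  proof -
    have "G t * (2 * (d + t) * Re (u t * cnj (w t))) \<le> G t * ((d + t)\<^sup>2 * (cmod (u t))\<^sup>2 + (cmod (w t))\<^sup>2)"
      using Re_mult_cnj_le[of "d + t" "u t" "w t"] G_pos[of t] by (intro mult_left_mono) auto
    moreover have "(cmod (of_real (d + t) * u t))\<^sup>2 = (d + t)\<^sup>2 * (cmod (u t))\<^sup>2"
      unfolding norm_mult power_mult_distrib norm_of_real by simp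
    ultimately show ?thesis unfolding ReD g_def by (simp add: algebra_simps)
  qed
  show "set_integrable lborel I (\<lambda>t. 1 * (G t * (cmod (of_real (d + t) * u t))\<^sup>2))"
  proof (rule set_integrable_from_bounds)
    show "(\<lambda>t. indicat_real I t *\<^sub>R (1 * (G t * (cmod (of_real (d + t) * u t))\<^sup>2))) \<in> borel_measurable borel"
      by (rule weighted_measurable[OF m])
    show "0 \<le> 1 * (G t * (cmod (of_real (d + t) * u t))\<^sup>2)" for t using G_pos[of t] by simp
    fix R assume R: "0 \<le> R" "{0..R} \<subseteq> J"
    show "\<exists>R2\<ge>R. \<exists>h. {0..R2} \<subseteq> J \<and> set_integrable lborel {0..R2} h \<and>
        (\<forall>t\<in>I \<inter> {0..R2}. 0 \<le> h t) \<and> (\<forall>t\<in>I \<inter> {0..R}. 1 * (G t * (cmod (of_real (d + t) * u t))\<^sup>2) \<le> h t) \<and>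
        (LINT t:{0..R2}|lborel. h t) \<le> (LINT t:I|lborel. g t) + Re (P 0)"
    proof (intro exI[of _ R] exI[of _ "\<lambda>t. g t - Re (D t)"] conjI ballI order_refl R(2) le)
      note i = set_integrable_Icc[OF gi R(2)] ac_deriv_Re(1)[OF P R]
      show "set_integrable lborel {0..R} (\<lambda>t. g t - Re (D t))" by (rule set_integral_diff(1)[OF i])
      show "0 \<le> g t - Re (D t)" for t
        by (rule order_trans[OF _ le]) (use G_pos[of t] in simp)
      have "(LINT t:{0..R}|lborel. g t - Re (D t)) = (LINT t:{0..R}|lborel. g t) - (Re (P R) - Re (P 0))"
        unfolding set_integral_diff(2)[OF i] ac_deriv_Re(2)[OF P R] ..
      moreover have "(LINT t:{0..R}|lborel. g t) \<le> (LINT t:I|lborel. g t)"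
        by (rule set_integral_Icc_le[OF gi R(2) g0])
      moreover have "0 \<le> Re (P R)"
        using R(1) d_nonneg G_pos[of R] unfolding P_def complex_norm_square[symmetric]
        by (simp add: zero_le_mult_iff)
      ultimately show "(LINT t:{0..R}|lborel. g t - Re (D t)) \<le> (LINT t:I|lborel. g t) + Re (P 0)" by linarith
    qed
  qed
qed simp

lemma continuous_sq_compact:
  assumes "\<not> hl" "continuous_on J F" shows "F \<in> sq"
proof -
  have "set_integrable lborel J (\<lambda>t. G t * (cmod (F t))\<^sup>2)"
    using assms(2) unfolding J_compact[OF assms(1)]
    by (intro borel_integrable_atLeastAtMost' continuous_intros G_continuous)
  then have "set_integrable lborel I (\<lambda>t. G t * (cmod (F t))\<^sup>2)"
    by (rule set_integrable_subset) (auto simp: I_subset_J)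
  then show ?thesis using continuous_measurable[OF assms(2)] by (simp add: sq_iff)
qed

lemma flux_continuous:
  assumes "ac_deriv J (\<lambda>t. of_real (G t) * p t) D"
  shows "continuous_on J p"
proof -
  have "continuous_on J (\<lambda>t. of_real (G t) * p t / of_real (G t))"
    using G_pos by (intro continuous_intros ac_deriv_continuous[OF assms] continuous_on_of_real G_continuous) (simp add: less_imp_neq[symmetric])
  moreover have "of_real (G t) * p t / of_real (G t) = p t" for t using G_pos[of t] by simp
  ultimately show ?thesis by simp
qed

text \<open>
  On a half-line the derivative of \<open>(cut)\<^sup>2 G p (cnj g)\<close> is integrated over \<open>{0..R}\<close>. The cutoff removes
  the unknown boundary term at \<open>R\<close>, and its derivative \<open>- 1 / R\<close> is harmless.
\<close>

lemma sq_flux: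
  assumes g: "ac_deriv J g p" and y: "ac_deriv J (\<lambda>t. of_real (G t) * p t) (\<lambda>t. - 2 * of_real (G t) * h t)"
    and gsq: "g \<in> sq" and hsq: "h \<in> sq"
  shows "p \<in> sq"
proof (cases hl)
  case False
  then show ?thesis using continuous_sq_compact flux_continuous[OF y] by blast
next
  case True
  have m: "p \<in> borel_measurable M" by (rule continuous_measurable[OF flux_continuous[OF y]])
  \<comment> \<open>The coefficient 5 is 4 from the slope of the cutoff, where
    \<open>(2 / R)\<^sup>2 \<le> 4\<close>, plus 1 from pairing \<open>h\<close> with
    \<open>g\<close>.\<close>
  define k where "k t = 5 * (G t * (cmod (g t))\<^sup>2) + G t * (cmod (h t))\<^sup>2" for t
  have ki: "set_integrable lborel I k"
    using gsq hsq unfolding k_def[abs_def] sq_iff by (intro set_integral_add set_integrable_mult_right) auto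
  have k0: "0 \<le> k t" for t using G_pos[of t] by (simp add: k_def)
  show ?thesis
  \<comment> \<open>The estimate \<open>le\<close> keeps \<open>3 / 4\<close> of
    \<open>cut\<^sup>2 G |p|\<^sup>2\<close>, and \<open>cut\<close> is at least
    \<open>1 / 2\<close> where it is used; \<open>1 / 8\<close> lies below the resulting
    \<open>3 / 16\<close>.\<close>
  proof (rule sqI_scaled[OF m, of "1 / 8"])
    show "set_integrable lborel I (\<lambda>t. 1 / 8 * (G t * (cmod (p t))\<^sup>2))"
    proof (rule set_integrable_from_bounds)
      show "(\<lambda>t. indicat_real I t *\<^sub>R (1 / 8 * (G t * (cmod (p t))\<^sup>2))) \<in> borel_measurable borel"
        by (rule weighted_measurable[OF m])
      show "0 \<le> 1 / 8 * (G t * (cmod (p t))\<^sup>2)" for t using G_pos[of t] by simp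
      fix R' :: real assume R': "0 \<le> R'" 
      \<comment> \<open>The factor 2 keeps \<open>cut\<close> above \<open>1 / 2\<close> on
        \<open>{0..R'}\<close>; the summand 1 ensures \<open>1 \<le> R\<close>, which bounds the
        slope of the cutoff uniformly.\<close>
      define R where "R = 2 * R' + 1"
      have R: "1 \<le> R" "0 \<le> R" "R' \<le> R" "{0..R} \<subseteq> J" using R' J_half_line[OF True] by (auto simp: R_def)
      define cut where "cut t = 1 - t / R" for t
      define P where "P t = of_real ((cut t)\<^sup>2) * ((of_real (G t) * p t) * cnj (g t))" for t
      define D where "D t = of_real (- 2 * cut t / R) * ((of_real (G t) * p t) * cnj (g t)) +
          of_real ((cut t)\<^sup>2) * ((- 2 * of_real (G t) * h t) * cnj (g t) + (of_real (G t) * p t) * cnj (p t))" for t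
      have P: "ac_deriv J P D"
        unfolding P_def[abs_def] D_def[abs_def]
      proof (intro ac_deriv_C1_mult ac_deriv_mult y ac_deriv_cnj g)
        show "((\<lambda>t. (cut t)\<^sup>2) has_real_derivative - 2 * cut t / R) (at t)" for t
        proof -
          have c: "(cut has_real_derivative - 1 / R) (at t)"
            unfolding cut_def[abs_def] using R(1) by (auto intro!: derivative_eq_intros)
          show ?thesis by (auto intro!: derivative_eq_intros c)
        qed
        show "continuous_on UNIV (\<lambda>t. - 2 * cut t / R)" unfolding cut_def[abs_def] using R(1) by (intro continuous_intros) auto
      qed
      have ReD: "Re (D t) = - (2 * cut t / R) * (G t * Re (p t * cnj (g t))) +
          (cut t)\<^sup>2 * (- 2 * (G t * Re (h t * cnj (g t))) + G t * (cmod (p t))\<^sup>2)" for t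
        unfolding D_def cmod_power2 by (simp add: algebra_simps power2_eq_square add_divide_distrib diff_divide_distrib)
      have le: "3 / 4 * ((cut t)\<^sup>2 * (G t * (cmod (p t))\<^sup>2)) \<le> k t + Re (D t)" if t: "t \<in> {0..R}" for t
      proof -
        have chi: "0 \<le> cut t" "cut t \<le> 1" using t R(1) by (auto simp: cut_def)
        have c2: "(cut t)\<^sup>2 \<le> 1" using chi by (simp add: power_le_one)
        have r2: "(2 / R)\<^sup>2 \<le> 4" using R(1) by (simp add: power_divide divide_le_eq)
        \<comment> \<open>The cutoff enters squared so that its derivative keeps a factor
          \<open>cut\<close>. Half of that factor is attached to \<open>p\<close>, which costs a
          quarter of \<open>cut\<^sup>2 |p|\<^sup>2\<close>; the remaining \<open>2 / R\<close> is
          attached to \<open>g\<close>.\<close>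
        have "(2 * cut t / R) * Re (p t * cnj (g t)) = 2 * (cut t / 2) * Re (p t * cnj (of_real (2 / R) * g t))"
          by (simp add: algebra_simps add_divide_distrib)
        also have "\<dots> \<le> (cut t / 2)\<^sup>2 * (cmod (p t))\<^sup>2 + (cmod (of_real (2 / R) * g t))\<^sup>2"
          by (rule Re_mult_cnj_le)
        also have "(cmod (of_real (2 / R) * g t))\<^sup>2 = (2 / R)\<^sup>2 * (cmod (g t))\<^sup>2"
          unfolding norm_mult power_mult_distrib norm_of_real power2_abs ..
        also have "\<dots> \<le> 4 * (cmod (g t))\<^sup>2" using r2 by (intro mult_right_mono) auto
        finally have A: "(2 * cut t / R) * Re (p t * cnj (g t)) \<le> 1 / 4 * (cut t)\<^sup>2 * (cmod (p t))\<^sup>2 + 4 * (cmod (g t))\<^sup>2"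
          by (simp add: power_divide)
        have "2 * Re (h t * cnj (g t)) \<le> (cmod (h t))\<^sup>2 + (cmod (g t))\<^sup>2"
          using Re_mult_cnj_le[of 1 "h t" "g t"] by simp
        then have "(cut t)\<^sup>2 * (2 * Re (h t * cnj (g t))) \<le> (cut t)\<^sup>2 * ((cmod (h t))\<^sup>2 + (cmod (g t))\<^sup>2)"
          by (intro mult_left_mono) auto
        also have "\<dots> \<le> 1 * ((cmod (h t))\<^sup>2 + (cmod (g t))\<^sup>2)" using c2 by (intro mult_right_mono) auto
        finally have B: "(cut t)\<^sup>2 * (2 * Re (h t * cnj (g t))) \<le> (cmod (h t))\<^sup>2 + (cmod (g t))\<^sup>2" by simp
        have "0 \<le> G t * (4 * (cmod (g t))\<^sup>2 + 1 / 4 * (cut t)\<^sup>2 * (cmod (p t))\<^sup>2 - (2 * cut t / R) * Re (p t * cnj (g t))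
            + ((cmod (h t))\<^sup>2 + (cmod (g t))\<^sup>2 - (cut t)\<^sup>2 * (2 * Re (h t * cnj (g t)))))"
          using A B G_pos[of t] by (intro mult_nonneg_nonneg) auto
        then show ?thesis unfolding ReD k_def by (simp add: algebra_simps)
      qed
      show "\<exists>R2\<ge>R'. \<exists>f. {0..R2} \<subseteq> J \<and> set_integrable lborel {0..R2} f \<and>
        (\<forall>t\<in>I \<inter> {0..R2}. 0 \<le> f t) \<and> (\<forall>t\<in>I \<inter> {0..R'}. 1 / 8 * (G t * (cmod (p t))\<^sup>2) \<le> f t) \<and>
        (LINT t:{0..R2}|lborel. f t) \<le> (LINT t:I|lborel. k t) - Re (of_real (G 0) * p 0 * cnj (g 0))"
      proof (intro exI[of _ R] exI[of _ "\<lambda>t. k t + Re (D t)"] conjI ballI R)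
        note i = set_integrable_Icc[OF ki R(4)] ac_deriv_Re(1)[OF P R(2,4)]
        show "set_integrable lborel {0..R} (\<lambda>t. k t + Re (D t))" by (rule set_integral_add(1)[OF i])
        show "0 \<le> k t + Re (D t)" if "t \<in> I \<inter> {0..R}" for t
          by (rule order_trans[OF _ le]) (use G_pos[of t] that in auto)
        show "1 / 8 * (G t * (cmod (p t))\<^sup>2) \<le> k t + Re (D t)" if t: "t \<in> I \<inter> {0..R'}" for t
        proof -
          have "1 / 2 \<le> cut t" using t R(1) by (auto simp: cut_def R_def field_simps)
          then have "(1 / 2)\<^sup>2 \<le> (cut t)\<^sup>2" by (intro power_mono) auto
          then have "(1 / 2)\<^sup>2 * (G t * (cmod (p t))\<^sup>2) \<le> (cut t)\<^sup>2 * (G t * (cmod (p t))\<^sup>2)"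
            using G_pos[of t] by (intro mult_right_mono) auto
          moreover have "t \<in> {0..R}" using t R(3) by auto
          moreover have "0 \<le> G t * (cmod (p t))\<^sup>2" using G_pos[of t] by simp
          ultimately show ?thesis using le[of t] by (simp add: power_divide)
        qed
        have "(LINT t:{0..R}|lborel. k t + Re (D t)) = (LINT t:{0..R}|lborel. k t) + (Re (P R) - Re (P 0))"
          unfolding set_integral_add(2)[OF i] ac_deriv_Re(2)[OF P R(2,4)] ..
        moreover have "(LINT t:{0..R}|lborel. k t) \<le> (LINT t:I|lborel. k t)"
          by (rule set_integral_Icc_le[OF ki R(4) k0])
        moreover have "P R = 0" "P 0 = of_real (G 0) * p 0 * cnj (g 0)" using R(1) by (simp_all add: P_def cut_def)
        ultimately show "(LINT t:{0..R}|lborel. k t + Re (D t)) \<le> (LINT t:I|lborel. k t) - Re (of_real (G 0) * p 0 * cnj (g 0))"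
          by simp
      qed
    qed
  qed simp
qed

text \<open>The same argument for \<open>cut x G |p|\<^sup>2\<close>, written as \<open>(cut x / G) |G p|\<^sup>2\<close> because \<open>G p\<close> is the function with known derivative.\<close>

lemma sq_x_flux:
  assumes y: "ac_deriv J (\<lambda>t. of_real (G t) * p t) (\<lambda>t. - 2 * of_real (G t) * h t)"
    and psq: "p \<in> sq" and hsq: "h \<in> sq"
  shows "(\<lambda>t. of_real (d + t) * p t) \<in> sq"
proof (cases hl)
  case False
  then show ?thesis using continuous_sq_compact continuous_x_mult flux_continuous[OF y] by blast
next
  case True
  have m: "(\<lambda>t. of_real (d + t) * p t) \<in> borel_measurable M"
    by (intro continuous_measurable continuous_x_mult flux_continuous[OF y])
  \<comment> \<open>\<open>d + 1\<close> bounds \<open>(d + t) / R\<close> for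
    \<open>t \<le> R\<close> and \<open>1 \<le> R\<close>; 4 is the square of the factor in
    \<open>2 * h t\<close>.\<close>
  define k where "k t = (d + 1) * (G t * (cmod (p t))\<^sup>2) + 4 * (G t * (cmod (h t))\<^sup>2)" for t
  have ki: "set_integrable lborel I k"
    using psq hsq unfolding k_def[abs_def] sq_iff by (intro set_integral_add set_integrable_mult_right) auto
  have k0: "0 \<le> k t" for t using G_pos[of t] d_nonneg by (simp add: k_def)
  have n2: "(cmod (of_real (d + t) * p t))\<^sup>2 = (d + t)\<^sup>2 * (cmod (p t))\<^sup>2" for t
    unfolding norm_mult power_mult_distrib norm_of_real by simp
  show ?thesis
  proof (rule sqI_scaled[OF m, of "1 / 2"])
    show "set_integrable lborel I (\<lambda>t. 1 / 2 * (G t * (cmod (of_real (d + t) * p t))\<^sup>2))"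
    proof (rule set_integrable_from_bounds)
      show "(\<lambda>t. indicat_real I t *\<^sub>R (1 / 2 * (G t * (cmod (of_real (d + t) * p t))\<^sup>2))) \<in> borel_measurable borel"
        by (rule weighted_measurable[OF m])
      show "0 \<le> 1 / 2 * (G t * (cmod (of_real (d + t) * p t))\<^sup>2)" for t using G_pos[of t] by simp
      fix R' :: real assume R': "0 \<le> R'" 
      define R where "R = 2 * R' + 1"
      have R: "1 \<le> R" "0 \<le> R" "R' \<le> R" "{0..R} \<subseteq> J" using R' J_half_line[OF True] by (auto simp: R_def)
      define cut where "cut t = 1 - t / R" for t
      \<comment> \<open>The first power of the cutoff suffices: its derivative meets only
        \<open>x G |p|\<^sup>2 / R\<close>, which is controlled by the square integrability of
        \<open>p\<close>.\<close>
      define r where "r t = cut t * (d + t) / G t" for t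
      define r' where "r' t = (- (d + t) / R + cut t + 2 * cut t * (d + t)\<^sup>2) / G t" for t
      define y where "y t = of_real (G t) * p t" for t
      define z where "z t = - 2 * of_real (G t) * h t" for t
      define P where "P t = of_real (r t) * (y t * cnj (y t))" for t
      define D where "D t = of_real (r' t) * (y t * cnj (y t)) + of_real (r t) * (z t * cnj (y t) + y t * cnj (z t))" for t
      have yz: "ac_deriv J y z" using y unfolding y_def[abs_def] z_def[abs_def] .
      have P: "ac_deriv J P D"
        unfolding P_def[abs_def] D_def[abs_def]
      proof (intro ac_deriv_C1_mult ac_deriv_mult yz ac_deriv_cnj)
        show "(r has_real_derivative r' t) (at t)" for t
        proof -
          have c: "(cut has_real_derivative - 1 / R) (at t)"
            unfolding cut_def[abs_def] using R(1) by (auto intro!: derivative_eq_intros)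
          show ?thesis unfolding r_def[abs_def] r'_def using G_pos[of t] R(1)
            by (auto intro!: derivative_eq_intros c G_deriv simp: field_simps power2_eq_square)
        qed
        have c: "continuous_on UNIV cut" unfolding cut_def[abs_def] using R(1) by (intro continuous_intros) auto
        show "continuous_on UNIV r'" unfolding r'_def[abs_def] using R(1) G_pos
          by (intro continuous_intros G_continuous c) (auto simp: less_imp_neq[symmetric])
      qed
      have ReD: "Re (D t) = (- (d + t) / R + cut t + 2 * cut t * (d + t)\<^sup>2) * (G t * (cmod (p t))\<^sup>2)
          - cut t * (G t * (2 * (d + t) * Re (p t * cnj (2 * h t))))" for t
      proof -
        have 1: "Re (y t * cnj (y t)) = G t * (G t * (cmod (p t))\<^sup>2)" "Im (y t * cnj (y t)) = 0"
          unfolding cmod_power2 by (simp_all add: y_def power2_eq_square algebra_simps)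
        have 2: "Re (z t * cnj (y t) + y t * cnj (z t)) = - G t * (G t * (2 * Re (p t * cnj (2 * h t))))"
          by (simp add: y_def z_def algebra_simps)
        have "Re (D t) = r' t * Re (y t * cnj (y t)) + r t * Re (z t * cnj (y t) + y t * cnj (z t))"
          unfolding D_def by (simp add: algebra_simps)
        also have "\<dots> = (r' t * G t) * (G t * (cmod (p t))\<^sup>2) - (r t * G t) * (G t * (2 * Re (p t * cnj (2 * h t))))"
          unfolding 1 2 by (simp add: algebra_simps)
        also have "r' t * G t = - (d + t) / R + cut t + 2 * cut t * (d + t)\<^sup>2" using G_pos[of t] by (simp add: r'_def)
        also have "r t * G t = cut t * (d + t)" using G_pos[of t] by (simp add: r_def)
        finally show ?thesis by (simp add: algebra_simps)
      qed
      \<comment> \<open>Differentiating \<open>1 / G\<close> yields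
        \<open>2 cut x\<^sup>2 G |p|\<^sup>2\<close>. Half of it pays for the term with
        \<open>h\<close>, half remains, and \<open>cut G |p|\<^sup>2\<close> is dropped as
        nonnegative.\<close>
      have le: "cut t * ((d + t)\<^sup>2 * (G t * (cmod (p t))\<^sup>2)) \<le> k t + Re (D t)" if t: "t \<in> {0..R}" for t
      proof -
        have chi: "0 \<le> cut t" "cut t \<le> 1" using t R(1) by (auto simp: cut_def)
        have "d \<le> d * R" using R(1) d_nonneg mult_left_mono[of 1 R d] by simp
        then have xR: "(d + t) / R \<le> d + 1" using t R(1) by (simp add: divide_le_eq algebra_simps)
        have "2 * (d + t) * Re (p t * cnj (2 * h t)) \<le> (d + t)\<^sup>2 * (cmod (p t))\<^sup>2 + (cmod (2 * h t))\<^sup>2"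
          by (rule Re_mult_cnj_le)
        then have "cut t * (G t * (2 * (d + t) * Re (p t * cnj (2 * h t))))
          \<le> cut t * (G t * ((d + t)\<^sup>2 * (cmod (p t))\<^sup>2 + 4 * (cmod (h t))\<^sup>2))"
          using chi G_pos[of t] by (intro mult_left_mono) (auto simp: norm_mult power_mult_distrib)
        moreover have "cut t * (4 * (G t * (cmod (h t))\<^sup>2)) \<le> 1 * (4 * (G t * (cmod (h t))\<^sup>2))"
          using chi G_pos[of t] by (intro mult_right_mono) auto
        moreover have "(d + t) / R * (G t * (cmod (p t))\<^sup>2) \<le> (d + 1) * (G t * (cmod (p t))\<^sup>2)"
          using xR G_pos[of t] by (intro mult_right_mono) auto
        moreover have "0 \<le> cut t * (G t * (cmod (p t))\<^sup>2)" using chi G_pos[of t] by simp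
        ultimately show ?thesis
          unfolding ReD k_def by (simp add: algebra_simps add_divide_distrib diff_divide_distrib)
      qed
      show "\<exists>R2\<ge>R'. \<exists>f. {0..R2} \<subseteq> J \<and> set_integrable lborel {0..R2} f \<and>
        (\<forall>t\<in>I \<inter> {0..R2}. 0 \<le> f t) \<and> (\<forall>t\<in>I \<inter> {0..R'}. 1 / 2 * (G t * (cmod (of_real (d + t) * p t))\<^sup>2) \<le> f t) \<and>
        (LINT t:{0..R2}|lborel. f t) \<le> (LINT t:I|lborel. k t) - Re (of_real (d / G 0) * (y 0 * cnj (y 0)))"
      proof (intro exI[of _ R] exI[of _ "\<lambda>t. k t + Re (D t)"] conjI ballI R)
        note i = set_integrable_Icc[OF ki R(4)] ac_deriv_Re(1)[OF P R(2,4)]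
        show "set_integrable lborel {0..R} (\<lambda>t. k t + Re (D t))" by (rule set_integral_add(1)[OF i])
        show "0 \<le> k t + Re (D t)" if "t \<in> I \<inter> {0..R}" for t
        proof (rule order_trans[OF _ le])
          have "0 \<le> cut t" using that R(1) by (auto simp: cut_def)
          then show "0 \<le> cut t * ((d + t)\<^sup>2 * (G t * (cmod (p t))\<^sup>2))" using G_pos[of t] by simp
        qed (use that in auto)
        show "1 / 2 * (G t * (cmod (of_real (d + t) * p t))\<^sup>2) \<le> k t + Re (D t)" if t: "t \<in> I \<inter> {0..R'}" for t
        proof -
          have "1 / 2 \<le> cut t" using t R(1) by (auto simp: cut_def R_def field_simps)
          then have "1 / 2 * ((d + t)\<^sup>2 * (G t * (cmod (p t))\<^sup>2)) \<le> cut t * ((d + t)\<^sup>2 * (G t * (cmod (p t))\<^sup>2))"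
            using G_pos[of t] by (intro mult_right_mono) auto
          moreover have "t \<in> {0..R}" using t R(3) by auto
          ultimately show ?thesis using le[of t] unfolding n2 by (simp add: algebra_simps)
        qed
        have "(LINT t:{0..R}|lborel. k t + Re (D t)) = (LINT t:{0..R}|lborel. k t) + (Re (P R) - Re (P 0))"
          unfolding set_integral_add(2)[OF i] ac_deriv_Re(2)[OF P R(2,4)] ..
        moreover have "(LINT t:{0..R}|lborel. k t) \<le> (LINT t:I|lborel. k t)"
          by (rule set_integral_Icc_le[OF ki R(4) k0])
        moreover have "P R = 0" "P 0 = of_real (d / G 0) * (y 0 * cnj (y 0))"
          using R(1) by (simp_all add: P_def r_def cut_def)
        ultimately show "(LINT t:{0..R}|lborel. k t + Re (D t)) \<le> (LINT t:I|lborel. k t) - Re (of_real (d / G 0) * (y 0 * cnj (y 0)))"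
          by simp
      qed
    qed
  qed simp
qed

end

section \<open>Green's formula and the adjoint equation on an edge\<close>

context gauss_interval
begin

lemma bdry_half_line: "hl \<Longrightarrow> bdry F = - F 0" and bdry_compact: "\<not> hl \<Longrightarrow> bdry F = F l - F 0"
  unfolding bdry_def by simp_all

text \<open>On a half-line \<open>F\<close> has a limit at infinity, which vanishes because \<open>F\<close> is integrable.\<close>

lemma integral_ac_deriv:
  assumes F: "ac_deriv J F D" and Fi: "set_integrable lborel I F" and Di: "set_integrable lborel I D"
  shows "(LINT t:I|lborel. D t) = bdry F"
proof (cases hl)
  case False
  have sub: "{0..l} \<subseteq> J" using J_compact[OF False] by simp
  have "(LINT t:I|lborel. D t) = (LINT t:{0..l} \<inter> I|lborel. D t)"
    using I_compact[OF False] by (intro arg_cong2[where f="\<lambda>A. set_lebesgue_integral lborel A"]) auto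
  also have "\<dots> = (LINT t:{0..l}|lborel. D t)" by (rule set_integral_boundary[OF sub, symmetric])
  also have "\<dots> = F l - F 0" using ac_derivD(2)[OF F _ sub] l_pos[OF False] by simp
  finally show ?thesis by (simp only: bdry_compact[OF False])
next
  case True
  note J = J_half_line[OF True] and I = I_half_line[OF True]
  define L where "L = (LINT t:I|lborel. D t)"
  have part: "(LINT t|lborel. indicator {..R} t *\<^sub>R (indicator I t *\<^sub>R D t)) = F R - F 0" if "0 \<le> R" for R
  proof -
    have sub: "{0..R} \<subseteq> J" using J by auto
    have "(LINT t|lborel. indicator {..R} t *\<^sub>R (indicator I t *\<^sub>R D t)) = (LINT t:{0..R} \<inter> I|lborel. D t)"
      unfolding set_lebesgue_integral_def I by (intro Bochner_Integration.integral_cong) (auto simp: indicator_def)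
    also have "\<dots> = (LINT t:{0..R}|lborel. D t)" by (rule set_integral_boundary[OF sub, symmetric])
    finally show ?thesis using ac_derivD(2)[OF F that sub] by simp
  qed
  have "((\<lambda>R. LINT t|lborel. indicator {..R} t *\<^sub>R (indicator I t *\<^sub>R D t)) \<longlongrightarrow> L) at_top"
    unfolding L_def set_lebesgue_integral_def
    by (rule tendsto_integral_at_top) (use Di in \<open>auto simp: set_integrable_def\<close>)
  then have "((\<lambda>R. F R - F 0) \<longlongrightarrow> L) at_top"
  proof (rule Lim_transform_eventually)
    show "eventually (\<lambda>R. (LINT t|lborel. indicator {..R} t *\<^sub>R (indicator I t *\<^sub>R D t)) = F R - F 0) at_top"
      using eventually_ge_at_top[of 0] by eventually_elim (rule part)
  qed
  from tendsto_add[OF this tendsto_const[of "F 0"]]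
  have lim: "(F \<longlongrightarrow> L + F 0) at_top" by simp
  have "L + F 0 = 0"
  proof (rule ccontr)
    assume ne: "L + F 0 \<noteq> 0"
    define c where "c = norm (L + F 0) / 2"
    have c: "c > 0" "c < norm (L + F 0)" using ne by (auto simp: c_def)
    have "eventually (\<lambda>R. c < norm (F R)) at_top"
      by (rule order_tendstoD(1)[OF tendsto_norm[OF lim] c(2)])
    then obtain N0 where N0: "\<And>R. N0 \<le> R \<Longrightarrow> c < norm (F R)" by (auto simp: eventually_at_top_linorder)
    \<comment> \<open>At least 1, so that \<open>{N..N + real n}\<close> lies inside the open
      half-line, where \<open>F\<close> is integrable.\<close>
    define N where "N = max 1 N0"
    define B where "B = (LINT t:I|lborel. norm (F t))"
    have bound: "real n * c \<le> B" for n
    proof -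
      have "(LINT t|lborel. indicat_real {N..N + real n} t * c) \<le> B"
        unfolding B_def set_lebesgue_integral_def
      proof (rule integral_mono)
        show "integrable lborel (\<lambda>t. indicat_real {N..N + real n} t * c)" by simp
        show "integrable lborel (\<lambda>t. indicat_real I t *\<^sub>R norm (F t))"
          using integrable_norm[OF Fi[unfolded set_integrable_def]] by simp
        show "indicat_real {N..N + real n} t * c \<le> indicat_real I t *\<^sub>R norm (F t)" for t
          using N0[of t] by (auto simp: indicator_def I N_def)
      qed
      then show ?thesis by simp
    qed
    obtain n where "B < real n * c" using reals_Archimedean3[OF c(1)] by blast
    with bound[of n] show False by simp
  qed
  then show ?thesis unfolding bdry_half_line[OF True] L_def by (simp only: eq_neg_iff_add_eq_0)
qed

lemma sq_mult_cnj_integrable: "u \<in> sq \<Longrightarrow> v \<in> sq \<Longrightarrow> integrable M (\<lambda>t. u t * cnj (v t))"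
  by (rule sq_mult_integrable[OF _ sq_cnj])

text \<open>Product rule for \<open>G p (cnj H)\<close>, where \<open>G' = - 2 x G\<close>
  contributes the drift. That the drift term is integrable is the point on a half-line, and
  \<open>sq_x_mult\<close> for \<open>p\<close> provides it.\<close>

theorem green_formula:
  assumes p: "ac_deriv J p q" "p \<in> sq" "q \<in> sq" and H: "ac_deriv J H r" "H \<in> sq" "r \<in> sq"
  shows "(LINT t|M. p t * cnj (r t)) = bdry (\<lambda>t. of_real (G t) * (p t * cnj (H t)))
    + (LINT t|M. (- q t + 2 * (of_real (d + t) * p t)) * cnj (H t))"
proof -
  have xp: "(\<lambda>t. of_real (d + t) * p t) \<in> sq" by (rule sq_x_mult[OF p])
  define E where "E t = - 2 * (of_real (d + t) * p t * cnj (H t)) + (q t * cnj (H t) + p t * cnj (r t))" for t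
  define D where "D t = of_real (- 2 * (d + t) * G t) * (p t * cnj (H t)) + of_real (G t) * (q t * cnj (H t) + p t * cnj (r t))" for t
  have DE: "D t = G t *\<^sub>R E t" for t
    by (simp add: D_def E_def scaleR_conv_of_real algebra_simps)
  have ac: "ac_deriv J (\<lambda>t. of_real (G t) * (p t * cnj (H t))) D"
    unfolding D_def[abs_def]
    by (intro ac_deriv_C1_mult ac_deriv_mult p ac_deriv_cnj H G_deriv continuous_intros G_continuous)
  note i = sq_mult_cnj_integrable[OF xp H(2)] sq_mult_cnj_integrable[OF p(3) H(2)] sq_mult_cnj_integrable[OF p(2) H(3)]
  have Ei: "integrable M E"
    unfolding E_def[abs_def] using i by (intro Bochner_Integration.integrable_add integrable_mult_right) auto
  have "(LINT t:I|lborel. D t) = bdry (\<lambda>t. of_real (G t) * (p t * cnj (H t)))"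
  proof (rule integral_ac_deriv[OF ac])
    show "set_integrable lborel I (\<lambda>t. of_real (G t) * (p t * cnj (H t)))"
      using sq_mult_cnj_integrable[OF p(2) H(2)] unfolding integrable_M by (simp add: scaleR_conv_of_real)
    show "set_integrable lborel I D" using Ei unfolding integrable_M DE .
  qed
  moreover have "(LINT t:I|lborel. D t) = (LINT t|M. E t)" unfolding integral_M DE ..
  moreover have "(LINT t|M. E t) = - 2 * (LINT t|M. of_real (d + t) * p t * cnj (H t)) +
      ((LINT t|M. q t * cnj (H t)) + (LINT t|M. p t * cnj (r t)))"
    unfolding E_def[abs_def] using i by (simp del: of_real_add)
  moreover have "(LINT t|M. (- q t + 2 * (of_real (d + t) * p t)) * cnj (H t))
      = - (LINT t|M. q t * cnj (H t)) + 2 * (LINT t|M. of_real (d + t) * p t * cnj (H t))"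
  proof -
    have "(- q t + 2 * (of_real (d + t) * p t)) * cnj (H t)
      = - (q t * cnj (H t)) + 2 * (of_real (d + t) * p t * cnj (H t))" for t
      by (simp only: ring_distribs mult.assoc minus_mult_left)
    then show ?thesis using i by (simp del: of_real_add)
  qed
  moreover have "P = b + L" if "D' = b" "D' = E'" "E' = - 2 * X + (Q + P)" "L = - Q + 2 * X"
    for P b L D' E' X Q :: complex
    using that by (auto simp: complex_eq_iff)
  ultimately show ?thesis by blast
qed

lemma AE_M_J: "(AE t in M. P t) \<longleftrightarrow> (AE t in lborel. t \<in> J \<longrightarrow> P t)"
  unfolding AE_M AE_J_iff ..

lemma G_mult_sq_set_integrable:
  assumes "u \<in> sq" "{a..b} \<subseteq> J"
  shows "set_integrable lborel {a..b} (\<lambda>t. of_real (G t) * u t)"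
  using set_integrable_mult_continuous[OF sq_set_integrable[OF assms], of "\<lambda>t. of_real (G t)"]
  by (simp add: mult.commute continuous_on_of_real G_continuous)

text \<open>
  With \<open>v = G g\<close>, and \<open>K\<close>, \<open>Q\<close> primitives of \<open>2 G k\<close> and \<open>2 x v + K\<close>, the hypothesis says that the second
  distributional derivative of \<open>v + Q\<close> vanishes.
\<close>

theorem adjoint_weak_solution:
  assumes g: "g \<in> sq" and k: "k \<in> sq"
    and adj: "\<And>\<phi>. \<phi> \<in> test_functions I \<Longrightarrow>
      (LINT t:I|lborel. (- 1 / 2 * deriv (deriv \<phi>) t + (d + t) * deriv \<phi> t) *\<^sub>R (of_real (G t) * g t))
      = (LINT t:I|lborel. \<phi> t *\<^sub>R (of_real (G t) * k t))"
  obtains F p where "ac_deriv J F p" "AE t in M. F t = g t"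
    "ac_deriv J (\<lambda>t. of_real (G t) * p t) (\<lambda>t. - 2 * of_real (G t) * k t)"
proof -
  define v where "v t = of_real (G t) * g t" for t
  have gi: "set_integrable lborel {a..b} v" if "{a..b} \<subseteq> J" for a b
    unfolding v_def[abs_def] by (rule G_mult_sq_set_integrable[OF g that])
  have xi: "set_integrable lborel {a..b} (\<lambda>t. v t * (2 * of_real (d + t)))" if "{a..b} \<subseteq> J" for a b
    by (rule set_integrable_mult_continuous[OF gi[OF that]]) (intro continuous_intros)
  have "set_integrable lborel {a..b} (\<lambda>t. 2 * of_real (G t) * k t)" if "{a..b} \<subseteq> J" for a b
    using set_integrable_mult_right[OF G_mult_sq_set_integrable[OF k that], of 2] by (simp add: mult.assoc)
  then obtain K where K: "ac_deriv J K (\<lambda>t. 2 * of_real (G t) * k t)"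
    using ac_deriv_primitive[OF interval_J zero_in_J] by metis
  have Ki: "set_integrable lborel {a..b} K" if "{a..b} \<subseteq> J" for a b
    by (rule borel_integrable_atLeastAtMost'[OF continuous_on_subset[OF ac_deriv_continuous[OF K] that]])
  have "set_integrable lborel {a..b} (\<lambda>t. v t * (2 * of_real (d + t)) + K t)" if "{a..b} \<subseteq> J" for a b
    by (intro set_integral_add xi Ki that)
  then obtain Q where Q: "ac_deriv J Q (\<lambda>t. v t * (2 * of_real (d + t)) + K t)"
    using ac_deriv_primitive[OF interval_J zero_in_J] by metis
  note KI = ac_deriv_subset[OF K I_subset_J] and QI = ac_deriv_subset[OF Q I_subset_J]
  have lv: "locally_integrable I v" "locally_integrable I (\<lambda>t. v t * (2 * of_real (d + t)))"
    using gi xi I_subset_J unfolding locally_integrable_def by blast+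
  note lK = ac_deriv_locally_integrable(1)[OF KI] and lQ = ac_deriv_locally_integrable(1)[OF QI]
  obtain c m where cm: "AE t in lborel. t \<in> I \<longrightarrow> v t + Q t = c + of_real t * m"
  proof (rule du_Bois_Reymond_2[OF locally_integrable_add[OF lv(1) lQ]])
    fix \<phi> assume \<phi>: "\<phi> \<in> test_functions I"
    note \<phi>' = test_deriv[OF \<phi>] note \<phi>'' = test_deriv[OF \<phi>']
    note i = test_integrable[OF \<phi>'' lv(1)] test_integrable[OF \<phi>'' lQ] test_integrable[OF \<phi>' lv(2)] test_integrable[OF \<phi>' lK]
    let ?A = "LINT t:I|lborel. deriv (deriv \<phi>) t *\<^sub>R v t"
    let ?B = "LINT t:I|lborel. deriv \<phi> t *\<^sub>R (v t * (2 * of_real (d + t)))"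
    let ?C = "LINT t:I|lborel. deriv \<phi> t *\<^sub>R K t"
    have "(- 1 / 2) *\<^sub>R ?A + (1 / 2) *\<^sub>R ?B
      = (LINT t:I|lborel. (- 1 / 2) *\<^sub>R (deriv (deriv \<phi>) t *\<^sub>R v t) + (1 / 2) *\<^sub>R (deriv \<phi> t *\<^sub>R (v t * (2 * of_real (d + t)))))"
      unfolding set_integral_scaleR_right[symmetric]
      by (intro set_integral_add(2)[symmetric] set_integrable_scaleR_right i)
    also have "\<dots> = (LINT t:I|lborel. (- 1 / 2 * deriv (deriv \<phi>) t + (d + t) * deriv \<phi> t) *\<^sub>R v t)"
      by (rule set_lebesgue_integral_cong) (auto simp: scaleR_conv_of_real algebra_simps)
    also have "\<dots> = (LINT t:I|lborel. \<phi> t *\<^sub>R (of_real (G t) * k t))"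
      unfolding v_def by (rule adj[OF \<phi>])
    also have "\<dots> = (LINT t:I|lborel. (1 / 2) *\<^sub>R (\<phi> t *\<^sub>R (2 * of_real (G t) * k t)))"
      by (rule set_lebesgue_integral_cong) (auto simp: scaleR_conv_of_real)
    also have "\<dots> = (1 / 2) *\<^sub>R (LINT t:I|lborel. \<phi> t *\<^sub>R (2 * of_real (G t) * k t))"
      by (rule set_integral_scaleR_right)
    also have "(LINT t:I|lborel. \<phi> t *\<^sub>R (2 * of_real (G t) * k t)) = - ?C"
      using integral_by_parts_test[OF KI \<phi>] by simp
    finally have 0: "(- 1 / 2) *\<^sub>R ?A + (1 / 2) *\<^sub>R ?B = (1 / 2) *\<^sub>R - ?C" .
    have "A = B + C" if "(- 1 / 2) *\<^sub>R A + (1 / 2) *\<^sub>R B = (1 / 2) *\<^sub>R - C" for A B C :: complex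
      using that by (simp add: complex_eq_iff)
    then have "?A = ?B + ?C" using 0 by blast
    also have "\<dots> = (LINT t:I|lborel. deriv \<phi> t *\<^sub>R (v t * (2 * of_real (d + t)) + K t))"
      unfolding scaleR_add_right by (rule set_integral_add(2)[OF i(3,4), symmetric])
    also have "\<dots> = - (LINT t:I|lborel. deriv (deriv \<phi>) t *\<^sub>R Q t)"
      using integral_by_parts_test[OF QI \<phi>'] by simp
    finally show "(LINT t:I|lborel. deriv (deriv \<phi>) t *\<^sub>R (v t + Q t)) = 0"
      unfolding scaleR_add_right set_integral_add(2)[OF i(1,2)] by simp
  qed
  \<comment> \<open>The continuous representative of \<open>v = G g\<close>; dividing it by
    \<open>G\<close> gives the representative of \<open>g\<close>.\<close>
  define V where "V t = - 1 * Q t + (c + m * of_real t)" for t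
  have Vv: "AE t in lborel. t \<in> J \<longrightarrow> v t = V t"
    unfolding AE_J_iff using cm by eventually_elim (simp add: V_def algebra_simps eq_diff_eq)
  have lin: "ac_deriv J (\<lambda>t. c + m * of_real t) (\<lambda>t. m)"
    by (rule ac_deriv_C1) (auto intro!: derivative_eq_intros continuous_intros)
  have V0: "ac_deriv J V (\<lambda>t. - 1 * (v t * (2 * of_real (d + t)) + K t) + m)"
    unfolding V_def[abs_def] by (intro ac_deriv_add ac_deriv_cmult Q lin)
  \<comment> \<open>In \<open>V0\<close> the derivative still involves \<open>v\<close>, which is
    known only almost everywhere. With \<open>V\<close> in its place the cancellation below is
    pointwise.\<close>
  have V1: "ac_deriv J V (\<lambda>t. - 1 * (V t * (2 * of_real (d + t)) + K t) + m)"
  proof (rule ac_deriv_cong_AE[OF V0])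
    show "AE t in lborel. t \<in> J \<longrightarrow> - 1 * (v t * (2 * of_real (d + t)) + K t) + m = - 1 * (V t * (2 * of_real (d + t)) + K t) + m"
      using Vv by eventually_elim auto
    show "set_integrable lborel {a..b} (\<lambda>t. - 1 * (V t * (2 * of_real (d + t)) + K t) + m)" if "{a..b} \<subseteq> J" for a b
      by (intro borel_integrable_atLeastAtMost' continuous_intros continuous_on_subset[OF ac_deriv_continuous[OF K] that]
          continuous_on_subset[OF ac_deriv_continuous[OF V0] that])
  qed
  \<comment> \<open>In the derivative of \<open>V / G\<close> the contributions
    \<open>2 x V / G\<close> of \<open>1 / G\<close> and of \<open>V\<close> cancel, leaving
    \<open>(m - K) / G\<close>.\<close>
  define p where "p t = of_real (1 / G t) * (m - K t)" for t
  have F: "ac_deriv J (\<lambda>t. of_real (1 / G t) * V t) p"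
  proof (rule ac_deriv_cong)
    show "ac_deriv J (\<lambda>t. of_real (1 / G t) * V t) (\<lambda>t. of_real (2 * (d + t) / G t) * V t + of_real (1 / G t) * (- 1 * (V t * (2 * of_real (d + t)) + K t) + m))"
    proof (rule ac_deriv_C1_mult[OF V1])
      show "((\<lambda>t. 1 / G t) has_real_derivative 2 * (d + t) / G t) (at t)" for t
        using G_pos[of t] by (auto intro!: derivative_eq_intros G_deriv simp: field_simps power2_eq_square)
      show "continuous_on UNIV (\<lambda>t. 2 * (d + t) / G t)"
        using G_pos by (intro continuous_intros G_continuous) (simp add: less_imp_neq[symmetric])
    qed
    show "of_real (2 * (d + t) / G t) * V t + of_real (1 / G t) * (- 1 * (V t * (2 * of_real (d + t)) + K t) + m) = p t" for t
      using G_pos[of t] by (simp add: p_def field_simps)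
  qed simp
  have y: "ac_deriv J (\<lambda>t. of_real (G t) * p t) (\<lambda>t. - 2 * of_real (G t) * k t)"
  proof (rule ac_deriv_cong)
    show "ac_deriv J (\<lambda>t. - 1 * K t + m) (\<lambda>t. - 1 * (2 * of_real (G t) * k t) + 0)"
      by (intro ac_deriv_add ac_deriv_cmult K ac_deriv_const)
    show "- 1 * K t + m = of_real (G t) * p t" for t using G_pos[of t] by (simp add: p_def)
  qed simp
  have "AE t in M. of_real (1 / G t) * V t = g t"
    unfolding AE_M_J using Vv
  proof eventually_elim
    case (elim t)
    have eq: "of_real (1 / G t) * (of_real (G t) * g t) = g t" using G_pos[of t] by simp
    show ?case
    proof
      assume "t \<in> J"
      then have "V t = of_real (G t) * g t" using elim by (simp only: v_def simp_thms)
      then show "of_real (1 / G t) * V t = g t" by (simp only: eq)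
    qed
  qed
  then show ?thesis using that[OF F _ y] by blast
qed

text \<open>The order is forced: \<open>sq_flux\<close> uses only \<open>F\<close> and
  \<open>k\<close>, \<open>sq_x_flux\<close> then uses \<open>p\<close>, and \<open>q\<close> is
  solved from the equation. \<open>sq_x_mult\<close> could not give the second step, since it
  presupposes that \<open>q\<close> is square integrable.\<close>

theorem adjoint_regularity:
  assumes g: "g \<in> sq" and k: "k \<in> sq"
    and adj: "\<And>\<phi>. \<phi> \<in> test_functions I \<Longrightarrow>
      (LINT t:I|lborel. (- 1 / 2 * deriv (deriv \<phi>) t + (d + t) * deriv \<phi> t) *\<^sub>R (of_real (G t) * g t))
      = (LINT t:I|lborel. \<phi> t *\<^sub>R (of_real (G t) * k t))"
  obtains F p q where "ac_deriv J F p" "ac_deriv J p q" "AE t in M. F t = g t" "F \<in> sq" "p \<in> sq" "q \<in> sq"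
    "\<And>t. k t = - (1 / 2) * q t + of_real (d + t) * p t"
proof -
  obtain F p where F: "ac_deriv J F p" "AE t in M. F t = g t"
    and y: "ac_deriv J (\<lambda>t. of_real (G t) * p t) (\<lambda>t. - 2 * of_real (G t) * k t)"
    using adjoint_weak_solution[OF assms] by blast
  have Fs: "F \<in> sq"
    by (rule sq_cong_AE[OF g continuous_measurable[OF ac_deriv_continuous[OF F(1)]]]) (use F(2) in auto)
  have ps: "p \<in> sq" by (rule sq_flux[OF F(1) y Fs k])
  have xps: "(\<lambda>t. of_real (d + t) * p t) \<in> sq" by (rule sq_x_flux[OF y ps k])
  define q where "q t = 2 * (of_real (d + t) * p t) - 2 * k t" for t
  have qs: "q \<in> sq" unfolding q_def[abs_def] by (intro sq_diff sq_cmult xps k)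
  have "ac_deriv J p q"
  proof (rule ac_deriv_cong)
    show "ac_deriv J (\<lambda>t. of_real (1 / G t) * (of_real (G t) * p t))
      (\<lambda>t. of_real (2 * (d + t) / G t) * (of_real (G t) * p t) + of_real (1 / G t) * (- 2 * of_real (G t) * k t))"
    proof (rule ac_deriv_C1_mult[OF y])
      show "((\<lambda>t. 1 / G t) has_real_derivative 2 * (d + t) / G t) (at t)" for t
        using G_pos[of t] by (auto intro!: derivative_eq_intros G_deriv simp: field_simps power2_eq_square)
      show "continuous_on UNIV (\<lambda>t. 2 * (d + t) / G t)"
        using G_pos by (intro continuous_intros G_continuous) (simp add: less_imp_neq[symmetric])
    qed
    show "of_real (1 / G t) * (of_real (G t) * p t) = p t" for t using G_pos[of t] by simp
    show "of_real (2 * (d + t) / G t) * (of_real (G t) * p t) + of_real (1 / G t) * (- 2 * of_real (G t) * k t) = q t" for t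
      using G_pos[of t] by (simp add: q_def field_simps)
  qed
  moreover have "k t = - (1 / 2) * q t + of_real (d + t) * p t" for t
    by (simp add: q_def algebra_simps)
  ultimately show ?thesis using that[OF F(1) _ F(2) Fs ps qs] by blast
qed

section \<open>Sobolev functions and boundary data on an edge\<close>

text \<open>This and the next two definitions restate \<open>edge_sobolev\<close>,
  \<open>wderiv\<close> and \<open>is_cont_rep\<close> for an isolated edge, so that both versions
  agree by unfolding.\<close>

definition sobolev :: "nat \<Rightarrow> (real \<Rightarrow> complex) set" where
  "sobolev k = {u \<in> sq. \<forall>j\<in>{1..k}. \<exists>w\<in>sq. has_weak_deriv I j u w}"

definition weak_deriv :: "nat \<Rightarrow> (real \<Rightarrow> complex) \<Rightarrow> real \<Rightarrow> complex" where
  "weak_deriv k u = (SOME w. has_weak_deriv I k u w)"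

definition cont_rep :: "(real \<Rightarrow> complex) \<Rightarrow> (real \<Rightarrow> complex) \<Rightarrow> bool" where
  "cont_rep u F \<longleftrightarrow> continuous_on J F \<and> (AE t in M. F t = u t)"

text \<open>Continuous representatives agree on all of \<open>J\<close>, ends included, so the
  Hilbert choice behind \<open>vertex_value\<close> is harmless.\<close>

lemma cont_rep_value:
  assumes "cont_rep u F" "t \<in> J" shows "(SOME F. cont_rep u F) t = F t"
proof -
  have s: "cont_rep u (SOME F. cont_rep u F)" using someI[where P="cont_rep u", OF assms(1)] .
  have "AE t in M. (SOME F. cont_rep u F) t = F t"
    using s assms(1) unfolding cont_rep_def by (auto elim: eventually_elim2)
  then show ?thesis using continuous_unique s assms unfolding cont_rep_def by blast
qed

lemma weak_deriv_eq_AE: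
  assumes "has_weak_deriv I k u w"
  shows "has_weak_deriv I k u (weak_deriv k u)" "AE t in M. weak_deriv k u t = w t"
proof -
  show s: "has_weak_deriv I k u (weak_deriv k u)"
    unfolding weak_deriv_def using someI[where P="has_weak_deriv I k u", OF assms] .
  show "AE t in M. weak_deriv k u t = w t"
    unfolding AE_M by (rule has_weak_deriv_unique[OF s assms])
qed

lemma weak_deriv_sq:
  assumes "has_weak_deriv I k u w" "w \<in> sq"
  shows "weak_deriv k u \<in> sq"
proof (rule sq_cong_AE[OF assms(2)])
  show "weak_deriv k u \<in> borel_measurable M"
    unfolding measurable_M
    by (rule locally_integrable_measurable) (use weak_deriv_eq_AE(1)[OF assms(1)] in \<open>simp add: has_weak_deriv_def\<close>)
  show "AE t in M. w t = weak_deriv k u t"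
    using weak_deriv_eq_AE(2)[OF assms(1)] by eventually_elim simp
qed

lemma sobolev_1_rep:
  assumes "u \<in> sobolev 1"
  obtains F where "ac_deriv J F (weak_deriv 1 u)" "cont_rep u F" "F \<in> sq" "weak_deriv 1 u \<in> sq"
proof -
  obtain w where w: "w \<in> sq" "has_weak_deriv I 1 u w" and u: "u \<in> sq" using assms by (auto simp: sobolev_def)
  note d = weak_deriv_eq_AE(1)[OF w(2)] weak_deriv_sq[OF w(2,1)]
  obtain F where F: "ac_deriv J F (weak_deriv 1 u)" "AE t in lborel. t \<in> I \<longrightarrow> u t = F t"
    using has_weak_deriv_rep[OF d(1) interval_J I_subset_J sq_set_integrable[OF d(2)]] by blast
  have AE: "AE t in M. u t = F t" using F(2) by (simp add: AE_M)
  then have "cont_rep u F" using ac_deriv_continuous[OF F(1)] by (auto simp: cont_rep_def)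
  moreover have "F \<in> sq"
    by (rule sq_cong_AE[OF u continuous_measurable[OF ac_deriv_continuous[OF F(1)]] AE])
  ultimately show ?thesis using that F(1) d(2) by blast
qed

text \<open>The definition asks for the weak derivatives of orders one and two of \<open>u\<close>
  separately. Here they become iterated derivatives, so that the first-order representation can be
  applied twice.\<close>

lemma sobolev_2_deriv:
  assumes "u \<in> sobolev 2"
  shows "u \<in> sobolev 1" "weak_deriv 1 u \<in> sobolev 1"
    "AE t in M. weak_deriv 1 (weak_deriv 1 u) t = weak_deriv 2 u t" "weak_deriv 2 u \<in> sq"
proof -
  show "u \<in> sobolev 1" using assms by (auto simp: sobolev_def)
  obtain w1 w2 where w: "w1 \<in> sq" "has_weak_deriv I 1 u w1" "w2 \<in> sq" "has_weak_deriv I 2 u w2"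
  proof -
    have "\<forall>j\<in>{1..2}. \<exists>w\<in>sq. has_weak_deriv I j u w" using assms by (simp add: sobolev_def)
    then have "\<exists>w\<in>sq. has_weak_deriv I 1 u w" "\<exists>w\<in>sq. has_weak_deriv I 2 u w" by auto
    then show ?thesis using that by blast
  qed
  have 2: "has_weak_deriv I 1 (weak_deriv 1 u) w2"
    using has_weak_deriv_2_iff[OF weak_deriv_eq_AE(1)[OF w(2)]] w(4) by blast
  then show "weak_deriv 1 u \<in> sobolev 1"
    using weak_deriv_sq[OF w(2,1)] w(3) by (auto simp: sobolev_def)
  show "AE t in M. weak_deriv 1 (weak_deriv 1 u) t = weak_deriv 2 u t"
    using weak_deriv_eq_AE(2)[OF 2] weak_deriv_eq_AE(2)[OF w(4)] by eventually_elim simp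
  show "weak_deriv 2 u \<in> sq" by (rule weak_deriv_sq[OF w(4,3)])
qed

lemma sobolev_2_rep:
  assumes "u \<in> sobolev 2"
  obtains F p where "ac_deriv J F (weak_deriv 1 u)" "ac_deriv J p (weak_deriv 1 (weak_deriv 1 u))"
    "cont_rep u F" "cont_rep (weak_deriv 1 u) p" "p \<in> sq" "weak_deriv 1 (weak_deriv 1 u) \<in> sq"
  using sobolev_1_rep[OF sobolev_2_deriv(1)[OF assms]] sobolev_1_rep[OF sobolev_2_deriv(2)[OF assms]] by metis

lemma has_weak_deriv_of_rep:
  assumes F: "ac_deriv J F p" and u: "u \<in> borel_measurable M" "AE t in M. F t = u t" and p: "p \<in> sq"
  shows "has_weak_deriv I 1 u p"
proof (rule has_weak_deriv_cong_AE[OF has_weak_deriv_ac[OF ac_deriv_subset[OF F I_subset_J]]])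
  show "AE x in lborel. x \<in> I \<longrightarrow> F x = u x" using u(2) by (simp add: AE_M)
  show "(\<lambda>x. indicat_real I x *\<^sub>R u x) \<in> borel_measurable borel" using u(1) by (simp add: measurable_M)
  show "(\<lambda>x. indicat_real I x *\<^sub>R p x) \<in> borel_measurable borel" using p by (simp add: measurable_M square_int_def)
qed simp

lemma sobolev_2I:
  assumes F: "ac_deriv J F p" "ac_deriv J p q" and sq: "F \<in> sq" "p \<in> sq" "q \<in> sq"
    and u: "u \<in> borel_measurable M" "AE t in M. F t = u t"
  shows "u \<in> sobolev 2" "cont_rep u F" "cont_rep (weak_deriv 1 u) p"
    "AE t in M. weak_deriv 1 u t = p t" "AE t in M. weak_deriv 2 u t = q t"
proof -
  have w1: "has_weak_deriv I 1 u p" by (rule has_weak_deriv_of_rep[OF F(1) u sq(2)])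
  have w2: "has_weak_deriv I 2 u q"
    unfolding has_weak_deriv_2_iff[OF w1]
    by (rule has_weak_deriv_of_rep[OF F(2) _ _ sq(3)]) (use sq(2) in \<open>auto simp: square_int_def\<close>)
  have us: "u \<in> sq" by (rule sq_cong_AE[OF sq(1) u])
  have "\<exists>w\<in>sq. has_weak_deriv I j u w" if "j \<in> {1..2}" for j
  proof -
    have "j = 1 \<or> j = 2" using that by auto
    then show ?thesis using w1 w2 sq by blast
  qed
  then show "u \<in> sobolev 2" using us by (auto simp: sobolev_def)
  show "cont_rep u F" using ac_deriv_continuous[OF F(1)] u(2) by (simp add: cont_rep_def)
  show 1: "AE t in M. weak_deriv 1 u t = p t" "AE t in M. weak_deriv 2 u t = q t"
    using weak_deriv_eq_AE(2)[OF w1] weak_deriv_eq_AE(2)[OF w2] .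
  have "AE t in M. p t = weak_deriv 1 u t" using 1(1) by eventually_elim simp
  then show "cont_rep (weak_deriv 1 u) p" using ac_deriv_continuous[OF F(2)] by (simp add: cont_rep_def)
qed

section \<open>Elements of the weighted space and prescribed boundary data\<close>

lemma const_sq: "(\<lambda>t. c) \<in> sq"
proof (cases hl)
  case False
  then show ?thesis by (rule continuous_sq_compact) simp
next
  case True
  have "integrable lborel (\<lambda>t. indicator {0..} t *\<^sub>R exp (- t\<^sup>2) :: real)"
    using gaussian_moment_0 by (rule integrable.intros)
  \<comment> \<open>After the shift by \<open>d\<close> the half Gaussian covers the edge, because
    \<open>d + t\<close> is nonnegative there.\<close>
  from lborel_integrable_real_affine[OF this, of 1 d]
  have "integrable lborel (\<lambda>t. 2 / sqrt pi * (indicator {0..} (d + t) * exp (- (d + t)\<^sup>2)))" by simp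
  then have "integrable lborel (\<lambda>t. indicator I t *\<^sub>R (2 / sqrt pi * (indicator {0..} (d + t) * exp (- (d + t)\<^sup>2))))"
    by (intro integrable_mult_indicator) auto
  moreover have "indicator I t *\<^sub>R (2 / sqrt pi * (indicator {0..} (d + t) * exp (- (d + t)\<^sup>2))) = indicator I t *\<^sub>R G t" for t
    using d_nonneg by (auto simp: indicator_def I_half_line[OF True] G_def)
  ultimately have "set_integrable lborel I G" unfolding set_integrable_def by simp
  then have "set_integrable lborel I (\<lambda>t. G t * (cmod c)\<^sup>2)" by (rule set_integrable_mult_left[rotated])
  then show ?thesis by (simp add: sq_iff)
qed

lemma bounded_sq:
  assumes "u \<in> borel_measurable M" "\<And>t. cmod (u t) \<le> B"
  shows "u \<in> sq"
proof -
  have "integrable M (\<lambda>t. (cmod (u t))\<^sup>2)"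
  proof (rule Bochner_Integration.integrable_bound)
    show "integrable M (\<lambda>t. (cmod (of_real B))\<^sup>2)" using const_sq[of "of_real B"] by (simp only: square_int_def mem_Collect_eq)
    show "(\<lambda>t. (cmod (u t))\<^sup>2) \<in> borel_measurable M" using assms(1) by measurable
    show "AE t in M. norm ((cmod (u t))\<^sup>2) \<le> norm ((cmod (of_real B))\<^sup>2)"
    proof (rule AE_I2)
      fix t
      have "0 \<le> B" using assms(2)[of t] norm_ge_zero order_trans by blast
      then show "norm ((cmod (u t))\<^sup>2) \<le> norm ((cmod (of_real B))\<^sup>2)" using assms(2)[of t] by (simp add: power_mono)
    qed
  qed
  then show ?thesis using assms(1) by (simp add: square_int_def)
qed

text \<open>The second moment of the Gaussian, obtained from \<open>sq_x_mult\<close> for the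
  constant function 1.\<close>

lemma coordinate_sq: "(\<lambda>t. of_real t) \<in> sq"
proof -
  have "(\<lambda>t. of_real (d + t) * 1) \<in> sq"
    by (rule sq_x_mult[OF ac_deriv_const const_sq sq_zero])
  from sq_add[OF this const_sq[of "- of_real d"]] show ?thesis by simp
qed

lemma boundary_data:
  fixes v0 s0 v1 s1 :: complex
  obtains F p q where "ac_deriv J F p" "ac_deriv J p q" "F \<in> sq" "p \<in> sq" "q \<in> sq"
    "F 0 = v0" "p 0 = s0" "\<not> hl \<Longrightarrow> F l = v1" "\<not> hl \<Longrightarrow> p l = s1"
proof (cases hl)
  case True
  have "ac_deriv J (\<lambda>t. v0 + s0 * of_real t) (\<lambda>t. s0)"
    by (rule ac_deriv_C1) (auto intro!: derivative_eq_intros continuous_intros)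
  moreover have "(\<lambda>t. v0 + s0 * of_real t) \<in> sq" by (intro sq_add sq_cmult const_sq coordinate_sq)
  ultimately show ?thesis
    by (rule that[OF _ ac_deriv_const _ const_sq sq_zero]) (simp_all add: True)
next
  case False
  define L where "L = complex_of_real l"
  have L: "L \<noteq> 0" using l_pos[OF False] by (simp add: L_def)
  \<comment> \<open>Coefficients of the cubic Hermite interpolant, solved from
    \<open>F l = v1\<close> and \<open>p l = s1\<close>.\<close>
  define a where "a = 3 * (v1 - v0) / L\<^sup>2 - (2 * s0 + s1) / L"
  define b where "b = (s0 + s1) / L\<^sup>2 - 2 * (v1 - v0) / L ^ 3"
  define F where "F t = v0 + of_real t * (s0 + of_real t * (a + of_real t * b))" for t :: real
  define p where "p t = s0 + of_real t * (2 * a + of_real t * (3 * b))" for t :: real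
  define q where "q t = 2 * a + of_real t * (6 * b)" for t :: real
  have F: "ac_deriv J F p"
    unfolding F_def[abs_def] p_def[abs_def]
    by (rule ac_deriv_C1) (auto intro!: derivative_eq_intros continuous_intros simp: algebra_simps)
  have p: "ac_deriv J p q"
    unfolding p_def[abs_def] q_def[abs_def]
    by (rule ac_deriv_C1) (auto intro!: derivative_eq_intros continuous_intros simp: algebra_simps)
  have "continuous_on J q" unfolding q_def[abs_def] by (intro continuous_intros)
  then have sq: "F \<in> sq" "p \<in> sq" "q \<in> sq"
    using ac_deriv_continuous[OF F] ac_deriv_continuous[OF p] continuous_sq_compact[OF False] by auto
  have "F l = v1" "p l = s1"
    unfolding F_def p_def a_def b_def L_def[symmetric] using L by (simp_all add: field_simps power2_eq_square power3_eq_cube)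
  then show ?thesis using that[OF F p sq] by (simp add: F_def p_def)
qed

text \<open>\<open>test_functions\<close> are real valued, but density in a complex space needs
  complex ones.\<close>

definition test_complex :: "(real \<Rightarrow> complex) set" where
  "test_complex = {\<lambda>t. of_real (\<phi> t) + \<i> * of_real (\<psi> t) |\<phi> \<psi>. \<phi> \<in> test_functions I \<and> \<psi> \<in> test_functions I}"

lemma test_zero_outside: "\<phi> \<in> test_functions I \<Longrightarrow> t \<notin> I \<Longrightarrow> \<phi> t = 0"
  unfolding test_functions_def by blast

lemma boundary_not_in_I: "0 \<notin> I" "l \<notin> I \<or> hl"
  by (auto simp: I_def)

lemma test_measurable: "\<phi> \<in> test_functions I \<Longrightarrow> (\<lambda>t. complex_of_real (\<phi> t)) \<in> borel_measurable M"
  by (intro continuous_measurable continuous_on_of_real smooth_continuous_on test_smooth)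

lemma test_sq:
  assumes "\<phi> \<in> test_functions I" shows "(\<lambda>t. complex_of_real (\<phi> t)) \<in> sq"
proof -
  obtain a b where ab: "smooth \<phi>" "a < b" "\<And>x. x \<notin> {a<..<b} \<Longrightarrow> \<phi> x = 0"
    using assms test_functionsE by metis
  have "bounded (\<phi> ` {a..b})"
    by (intro compact_imp_bounded compact_continuous_image smooth_continuous_on ab compact_Icc)
  then obtain B where B: "\<And>x. x \<in> {a..b} \<Longrightarrow> norm (\<phi> x) \<le> B" unfolding bounded_iff by blast
  have "cmod (of_real (\<phi> t)) \<le> \<bar>B\<bar>" for t
  proof (cases "t \<in> {a<..<b}")
    case True then have "norm (\<phi> t) \<le> B" by (intro B) auto
    then show ?thesis by simp
  qed (simp add: ab(3))
  then show ?thesis by (rule bounded_sq[OF test_measurable[OF assms]])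
qed

lemma test_ac_deriv:
  assumes "\<phi> \<in> test_functions I"
  shows "ac_deriv J (\<lambda>t. of_real (\<phi> t)) (\<lambda>t. of_real (deriv \<phi> t))"
proof (rule ac_deriv_C1)
  note s = test_smooth[OF assms]
  show "((\<lambda>t. complex_of_real (\<phi> t)) has_vector_derivative of_real (deriv \<phi> x)) (at x)" for x
    using smooth_has_deriv[OF s] by (intro has_vector_derivative_of_real) (simp add: has_real_derivative_iff_has_vector_derivative)
  show "continuous_on UNIV (\<lambda>t. complex_of_real (deriv \<phi> t))"
    by (intro continuous_on_of_real smooth_continuous_on smooth_deriv s)
qed

lemma test_complex_rep:
  assumes "h \<in> test_complex"
  obtains p q where "ac_deriv J h p" "ac_deriv J p q" "h \<in> sq" "p \<in> sq" "q \<in> sq"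
    "\<And>t. t \<notin> I \<Longrightarrow> h t = 0" "\<And>t. t \<notin> I \<Longrightarrow> p t = 0"
proof -
  obtain \<phi> \<psi> where h: "h = (\<lambda>t. of_real (\<phi> t) + \<i> * of_real (\<psi> t))" and t: "\<phi> \<in> test_functions I" "\<psi> \<in> test_functions I"
    using assms unfolding test_complex_def by blast
  note t' = t[THEN test_deriv] note t'' = t'[THEN test_deriv]
  show ?thesis
  proof (rule that)
    show "ac_deriv J h (\<lambda>t. of_real (deriv \<phi> t) + \<i> * of_real (deriv \<psi> t))"
      unfolding h by (intro ac_deriv_add ac_deriv_cmult test_ac_deriv t)
    show "ac_deriv J (\<lambda>t. of_real (deriv \<phi> t) + \<i> * of_real (deriv \<psi> t)) (\<lambda>t. of_real (deriv (deriv \<phi>) t) + \<i> * of_real (deriv (deriv \<psi>) t))"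
      by (intro ac_deriv_add ac_deriv_cmult test_ac_deriv t')
    show "h \<in> sq" "(\<lambda>t. of_real (deriv \<phi> t) + \<i> * of_real (deriv \<psi> t)) \<in> sq"
      "(\<lambda>t. of_real (deriv (deriv \<phi>) t) + \<i> * of_real (deriv (deriv \<psi>) t)) \<in> sq"
      unfolding h by (intro sq_add sq_cmult test_sq t t' t'')+
    show "h t = 0" "of_real (deriv \<phi> t) + \<i> * of_real (deriv \<psi> t) = 0" if "t \<notin> I" for t
      using that t t' by (simp_all add: h test_zero_outside)
  qed
qed

text \<open>Squared distances keep everything an integral. The price is the factor 2 in
  \<open>sq_dist_add\<close>, for which \<open>\<epsilon> / 4\<close> pays.\<close>

definition approximable :: "(real \<Rightarrow> complex) \<Rightarrow> bool" where
  "approximable u \<longleftrightarrow> (\<forall>\<epsilon>>0. \<exists>h\<in>test_complex. (LINT t|M. (cmod (u t - h t))\<^sup>2) < \<epsilon>)"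

lemma test_complex_sq: "h \<in> test_complex \<Longrightarrow> h \<in> sq"
  by (erule test_complex_rep)

lemma sq_dist_integrable: "u \<in> sq \<Longrightarrow> v \<in> sq \<Longrightarrow> integrable M (\<lambda>t. (cmod (u t - v t))\<^sup>2)"
  using sq_diff[of u v] by (simp add: square_int_def)

lemma sq_dist_add:
  assumes "u \<in> sq" "v \<in> sq" "u' \<in> sq" "v' \<in> sq"
  shows "(LINT t|M. (cmod ((u t + v t) - (u' t + v' t)))\<^sup>2)
    \<le> 2 * (LINT t|M. (cmod (u t - u' t))\<^sup>2) + 2 * (LINT t|M. (cmod (v t - v' t))\<^sup>2)"
proof -
  note i = sq_dist_integrable[OF assms(1,3)] sq_dist_integrable[OF assms(2,4)]
  have "(LINT t|M. (cmod ((u t + v t) - (u' t + v' t)))\<^sup>2)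
     \<le> (LINT t|M. 2 * (cmod (u t - u' t))\<^sup>2 + 2 * (cmod (v t - v' t))\<^sup>2)"
  proof (rule integral_mono)
    show "integrable M (\<lambda>t. (cmod ((u t + v t) - (u' t + v' t)))\<^sup>2)"
      by (rule sq_dist_integrable) (intro sq_add assms)+
    show "integrable M (\<lambda>t. 2 * (cmod (u t - u' t))\<^sup>2 + 2 * (cmod (v t - v' t))\<^sup>2)" using i by simp
    fix t
    have "(cmod ((u t + v t) - (u' t + v' t)))\<^sup>2 \<le> (cmod (u t - u' t) + cmod (v t - v' t))\<^sup>2"
      by (intro power_mono) (use norm_triangle_ineq[of "u t - u' t" "v t - v' t"] in \<open>simp_all add: algebra_simps\<close>)
    also have "\<dots> \<le> 2 * (cmod (u t - u' t))\<^sup>2 + 2 * (cmod (v t - v' t))\<^sup>2"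
      using sum_squares_bound[of "cmod (u t - u' t)" "cmod (v t - v' t)"] by (simp add: power2_sum)
    finally show "(cmod ((u t + v t) - (u' t + v' t)))\<^sup>2 \<le> 2 * (cmod (u t - u' t))\<^sup>2 + 2 * (cmod (v t - v' t))\<^sup>2" .
  qed
  then show ?thesis using i by simp
qed

lemma test_complex_add:
  assumes "h \<in> test_complex" "k \<in> test_complex" shows "(\<lambda>t. h t + k t) \<in> test_complex"
proof -
  obtain \<phi> \<psi> \<phi>' \<psi>' where "h = (\<lambda>t. of_real (\<phi> t) + \<i> * of_real (\<psi> t))" "k = (\<lambda>t. of_real (\<phi>' t) + \<i> * of_real (\<psi>' t))"
    "\<phi> \<in> test_functions I" "\<psi> \<in> test_functions I" "\<phi>' \<in> test_functions I" "\<psi>' \<in> test_functions I"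
    using assms unfolding test_complex_def by blast
  then show ?thesis unfolding test_complex_def
    by (intro CollectI exI[of _ "\<lambda>t. \<phi> t + \<phi>' t"] exI[of _ "\<lambda>t. \<psi> t + \<psi>' t"])
      (auto simp: algebra_simps intro: test_add)
qed

lemma test_complex_cmult:
  assumes "h \<in> test_complex" shows "(\<lambda>t. c * h t) \<in> test_complex"
proof -
  obtain \<phi> \<psi> where h: "h = (\<lambda>t. of_real (\<phi> t) + \<i> * of_real (\<psi> t))" and t: "\<phi> \<in> test_functions I" "\<psi> \<in> test_functions I"
    using assms unfolding test_complex_def by blast
  have "(\<lambda>t. c * h t) = (\<lambda>t. of_real (Re c * \<phi> t + - Im c * \<psi> t) + \<i> * of_real (Im c * \<phi> t + Re c * \<psi> t))"
    by (auto simp: h complex_eq_iff)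
  moreover have "(\<lambda>t. Re c * \<phi> t + - Im c * \<psi> t) \<in> test_functions I" "(\<lambda>t. Im c * \<phi> t + Re c * \<psi> t) \<in> test_functions I"
    by (intro test_add test_cmult t)+
  ultimately show ?thesis unfolding test_complex_def by (intro CollectI exI conjI)
qed

lemma approximable_add:
  assumes "u \<in> sq" "v \<in> sq" "approximable u" "approximable v"
  shows "approximable (\<lambda>t. u t + v t)"
  unfolding approximable_def
proof (intro allI impI)
  fix \<epsilon> :: real assume "\<epsilon> > 0"
  then have "\<epsilon> / 4 > 0" by simp
  then obtain h k where hk: "h \<in> test_complex" "k \<in> test_complex"
    "(LINT t|M. (cmod (u t - h t))\<^sup>2) < \<epsilon> / 4" "(LINT t|M. (cmod (v t - k t))\<^sup>2) < \<epsilon> / 4"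
    using assms(3,4) unfolding approximable_def by meson
  show "\<exists>h\<in>test_complex. (LINT t|M. (cmod (u t + v t - h t))\<^sup>2) < \<epsilon>"
    using sq_dist_add[OF assms(1,2) test_complex_sq test_complex_sq, OF hk(1,2)] hk(3,4)
    by (intro bexI[of _ "\<lambda>t. h t + k t"] test_complex_add hk) linarith
qed

lemma approximable_cmult:
  assumes "approximable u" shows "approximable (\<lambda>t. c * u t)"
  unfolding approximable_def
proof (intro allI impI)
  fix \<epsilon> :: real assume e: "\<epsilon> > 0"
  \<comment> \<open>The summand 1 allows the division also when \<open>c\<close> is zero.\<close>
  have c: "(cmod c)\<^sup>2 < (cmod c)\<^sup>2 + 1" "0 < (cmod c)\<^sup>2 + 1" by (auto intro: add_nonneg_pos)
  with e have "\<epsilon> / ((cmod c)\<^sup>2 + 1) > 0" by simp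
  then obtain h where h: "h \<in> test_complex" "(LINT t|M. (cmod (u t - h t))\<^sup>2) < \<epsilon> / ((cmod c)\<^sup>2 + 1)"
    using assms unfolding approximable_def by meson
  have "(LINT t|M. (cmod (c * u t - c * h t))\<^sup>2) = (cmod c)\<^sup>2 * (LINT t|M. (cmod (u t - h t))\<^sup>2)"
    by (simp flip: right_diff_distrib add: norm_mult power_mult_distrib)
  also have "\<dots> \<le> ((cmod c)\<^sup>2 + 1) * (LINT t|M. (cmod (u t - h t))\<^sup>2)"
    by (intro mult_right_mono integral_nonneg_AE) auto
  also have "\<dots> < ((cmod c)\<^sup>2 + 1) * (\<epsilon> / ((cmod c)\<^sup>2 + 1))"
    by (rule mult_strict_left_mono[OF h(2) c(2)])
  also have "\<dots> = \<epsilon>" using c(2) by simp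
  finally show "\<exists>h\<in>test_complex. (LINT t|M. (cmod (c * u t - h t))\<^sup>2) < \<epsilon>"
    by (intro bexI[of _ "\<lambda>t. c * h t"] test_complex_cmult h)
qed

lemma approximable_limit:
  assumes u: "u \<in> sq" and U: "\<And>n. U n \<in> sq" "\<And>n. approximable (U n)"
    and b: "b \<in> sq" "\<And>n. AE t in M. cmod (u t - U n t) \<le> cmod (b t)"
    and lim: "AE t in M. (\<lambda>n::nat. U n t) \<longlonglongrightarrow> u t"
  shows "approximable u"
  unfolding approximable_def
proof (intro allI impI)
  fix \<epsilon> :: real assume e: "\<epsilon> > 0"
  have "(\<lambda>n. LINT t|M. (cmod (u t - U n t))\<^sup>2) \<longlonglongrightarrow> (LINT t|M. 0)"
  proof (rule integral_dominated_convergence[where w="\<lambda>t. (cmod (b t))\<^sup>2"])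
    show "integrable M (\<lambda>t. (cmod (b t))\<^sup>2)" using b by (simp add: square_int_def)
    show "(\<lambda>t. (cmod (u t - U n t))\<^sup>2) \<in> borel_measurable M" for n
      using sq_dist_integrable[OF u U(1)] by (rule borel_measurable_integrable)
    show "AE t in M. (\<lambda>n. (cmod (u t - U n t))\<^sup>2) \<longlonglongrightarrow> 0"
      using lim
    proof eventually_elim
      case (elim t)
      have "(\<lambda>n. (cmod (u t - U n t))\<^sup>2) \<longlonglongrightarrow> (cmod (u t - u t))\<^sup>2" by (intro tendsto_intros elim)
      then show ?case by simp
    qed
    show "AE t in M. norm ((cmod (u t - U n t))\<^sup>2) \<le> (cmod (b t))\<^sup>2" for n
      using b(2)[of n] by eventually_elim (simp add: power_mono)
  qed simp
  then have lim0: "(\<lambda>n. LINT t|M. (cmod (u t - U n t))\<^sup>2) \<longlonglongrightarrow> 0" by simp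
  have "eventually (\<lambda>n. (LINT t|M. (cmod (u t - U n t))\<^sup>2) < \<epsilon> / 4) sequentially"
    by (rule order_tendstoD(2)[OF lim0]) (use e in simp)
  then obtain n where n: "(LINT t|M. (cmod (u t - U n t))\<^sup>2) < \<epsilon> / 4" by (auto simp: eventually_sequentially)
  have "\<epsilon> / 4 > 0" using e by simp
  then obtain h where h: "h \<in> test_complex" "(LINT t|M. (cmod (U n t - h t))\<^sup>2) < \<epsilon> / 4"
    using U(2) unfolding approximable_def by meson
  have "(LINT t|M. (cmod (u t - h t))\<^sup>2) = (LINT t|M. (cmod (u t + U n t - (U n t + h t)))\<^sup>2)" by simp
  also have "\<dots> \<le> 2 * (LINT t|M. (cmod (u t - U n t))\<^sup>2) + 2 * (LINT t|M. (cmod (U n t - h t))\<^sup>2)"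
    by (rule sq_dist_add[OF u U(1) U(1) test_complex_sq[OF h(1)]])
  also have "\<dots> < \<epsilon>" using n h(2) by linarith
  finally show "\<exists>h\<in>test_complex. (LINT t|M. (cmod (u t - h t))\<^sup>2) < \<epsilon>" using h(1) by blast
qed

lemma approximable_test: "h \<in> test_complex \<Longrightarrow> approximable h"
  unfolding approximable_def by (auto intro!: bexI[of _ h])

section \<open>Density of test functions\<close>

lemma indicator_sq: "A \<in> sets borel \<Longrightarrow> (\<lambda>t. of_bool (t \<in> A)) \<in> sq"
  by (rule bounded_sq[where B=1]) (auto simp: measurable_M)

lemma dominated_sq:
  assumes g: "g \<in> sq" and m: "f \<in> borel_measurable M" and le: "\<And>t. t \<in> space M \<Longrightarrow> cmod (f t) \<le> cmod (g t)"
  shows "f \<in> sq"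
proof -
  have "integrable M (\<lambda>t. (cmod (f t))\<^sup>2)"
  proof (rule Bochner_Integration.integrable_bound)
    show "integrable M (\<lambda>t. (cmod (g t))\<^sup>2)" using g by (simp add: square_int_def)
    show "(\<lambda>t. (cmod (f t))\<^sup>2) \<in> borel_measurable M" using m by measurable
    show "AE t in M. norm ((cmod (f t))\<^sup>2) \<le> norm ((cmod (g t))\<^sup>2)"
      by (intro AE_I2) (simp add: le power_mono)
  qed
  then show ?thesis using m by (simp add: square_int_def)
qed

lemma approximable_AE:
  assumes "approximable u" "u \<in> sq" "v \<in> sq" "AE t in M. u t = v t"
  shows "approximable v"
  by (rule approximable_limit[of v "\<lambda>_. u" "\<lambda>_. 0"])
    (use assms sq_zero in \<open>auto elim: eventually_mono\<close>)

lemma approximable_indicator_bounded_limit: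
  assumes "A \<in> sets borel" "\<And>n. U n \<in> sq" "\<And>n. approximable (U n)" "\<And>n t. cmod (U n t) \<le> 1"
    and "AE t in M. (\<lambda>n. U n t) \<longlonglongrightarrow> of_bool (t \<in> A)"
  shows "approximable (\<lambda>t. of_bool (t \<in> A))"
proof (rule approximable_limit[where b="\<lambda>_. 2", OF indicator_sq[OF assms(1)] assms(2,3) const_sq _ assms(5)])
  show "AE t in M. cmod (of_bool (t \<in> A) - U n t) \<le> cmod 2" for n
  proof (rule AE_I2)
    fix t
    have "cmod (of_bool (t \<in> A) - U n t) \<le> cmod (of_bool (t \<in> A)) + cmod (U n t)" by (rule norm_triangle_ineq4)
    also have "\<dots> \<le> 1 + 1" by (intro add_mono assms(4)) simp
    finally show "cmod (of_bool (t \<in> A) - U n t) \<le> cmod 2" by simp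
  qed
qed

lemma approximable_interval:
  assumes "{a..b} \<subseteq> I" shows "approximable (\<lambda>t. of_bool (t \<in> {a<..<b}))"
proof (rule approximable_indicator_bounded_limit)
  have z: "(\<lambda>t. 0) \<in> test_functions I" using test_cmult[OF bump_test[OF assms], of 0] by simp
  have t: "(\<lambda>t. complex_of_real (bump a b n t)) \<in> test_complex" for n
    unfolding test_complex_def using bump_test[OF assms] z by (intro CollectI exI[of _ "bump a b n"] exI[of _ "\<lambda>_. 0"]) auto
  then show "(\<lambda>t. complex_of_real (bump a b n t)) \<in> sq" "approximable (\<lambda>t. complex_of_real (bump a b n t))" for n
    by (rule test_complex_sq, rule approximable_test)
  show "cmod (complex_of_real (bump a b n t)) \<le> 1" for n t using bump_bounds[of a b n t] by simp
  show "AE t in M. (\<lambda>n. complex_of_real (bump a b n t)) \<longlonglongrightarrow> of_bool (t \<in> {a<..<b})"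
  proof (rule AE_I2)
    fix t
    have "(\<lambda>n. complex_of_real (bump a b n t)) \<longlonglongrightarrow> of_real (indicator {a<..<b} t)"
      by (intro tendsto_of_real bump_tendsto)
    then show "(\<lambda>n. complex_of_real (bump a b n t)) \<longlonglongrightarrow> of_bool (t \<in> {a<..<b})" by (simp only: indicator_def of_bool_def of_real_1 of_real_0 if_distrib[of complex_of_real])
  qed
qed simp

text \<open>The interval touches 0, and possibly \<open>l\<close>, so its bumps need not be
  supported compactly inside \<open>I\<close>; it is exhausted by shorter intervals whose bumps
  are.\<close>

lemma approximable_initial:
  assumes "hl \<or> s \<le> l" shows "approximable (\<lambda>t. of_bool (t \<in> {0<..<s}))"
proof (rule approximable_indicator_bounded_limit)
  define a where "a n = 1 / real (Suc n)" for n
  have a: "a n > 0" for n by (simp add: a_def)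
  have a0: "a \<longlonglongrightarrow> 0" unfolding a_def[abs_def] by (rule LIMSEQ_Suc[OF lim_1_over_n])
  have sub: "{a n..s - a n} \<subseteq> I" for n
  proof
    fix t assume t: "t \<in> {a n..s - a n}"
    note a[of n]
    then have "0 < t" "t < s" using t by auto
    then show "t \<in> I" using assms by (auto simp: I_def)
  qed
  show "(\<lambda>t. of_bool (t \<in> {a n<..<s - a n})) \<in> sq" for n by (rule indicator_sq) simp
  show "approximable (\<lambda>t. of_bool (t \<in> {a n<..<s - a n}))" for n by (rule approximable_interval[OF sub])
  show "AE t in M. (\<lambda>n. of_bool (t \<in> {a n<..<s - a n}) :: complex) \<longlonglongrightarrow> of_bool (t \<in> {0<..<s})"
  proof (rule AE_I2)
    fix t
    show "(\<lambda>n. of_bool (t \<in> {a n<..<s - a n}) :: complex) \<longlonglongrightarrow> of_bool (t \<in> {0<..<s})"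
    proof (cases "t \<in> {0<..<s}")
      case True
      then have "eventually (\<lambda>n. a n < min t (s - t)) sequentially"
        by (intro order_tendstoD(2)[OF a0]) auto
      then have "eventually (\<lambda>n. of_bool (t \<in> {a n<..<s - a n}) = (of_bool (t \<in> {0<..<s}) :: complex)) sequentially"
        by eventually_elim (use True in auto)
      then show ?thesis by (rule tendsto_eventually)
    next
      case False
      have "t \<notin> {a n<..<s - a n}" for n
      proof
        assume t: "t \<in> {a n<..<s - a n}"
        note a[of n]
        then show False using False t by auto
      qed
      then have "of_bool (t \<in> {a n<..<s - a n}) = (of_bool (t \<in> {0<..<s}) :: complex)" for n
        using False by (simp only: of_bool_eq)
      then show ?thesis by (simp only: tendsto_const)
    qed
  qed
qed auto

text \<open>Dynkin argument once more, with rays as generator. Complements use that the constant 1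
  is approximable, disjoint unions that partial unions converge boundedly.\<close>

lemma approximable_indicator:
  assumes "A \<in> sets borel" shows "approximable (\<lambda>t. of_bool (t \<in> A))"
proof -
  have ray: "approximable (\<lambda>t. of_bool (t \<in> {..s}))" for s
  proof -
    \<comment> \<open>Inside the edge and up to the point \<open>s\<close>, the ray
      \<open>{..s}\<close> is \<open>{0<..<s'}\<close>.\<close>
    define s' where "s' = (if hl then s else min s l)"
    have a: "approximable (\<lambda>t. of_bool (t \<in> {0<..<s'}))" by (rule approximable_initial) (auto simp: s'_def)
    have e: "AE t in M. of_bool (t \<in> {0<..<s'}) = (of_bool (t \<in> {..s}) :: complex)"
      unfolding AE_M using AE_lborel_singleton[of s]
    proof eventually_elim
      case (elim t)
      have "t \<in> {0<..<s'} \<longleftrightarrow> t \<in> {..s}" if "t \<in> I"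
      proof (cases hl)
        case True
        show ?thesis using that elim True unfolding s'_def I_half_line[OF True] by auto
      next
        case False
        show ?thesis using that elim False unfolding s'_def I_compact[OF False] by auto
      qed
      then show ?case by (intro impI arg_cong[where f=of_bool])
    qed
    show ?thesis by (rule approximable_AE[OF a indicator_sq indicator_sq e]) simp_all
  qed
  have one: "approximable (\<lambda>t. of_bool (t \<in> UNIV))"
  proof (rule approximable_indicator_bounded_limit)
    show "approximable (\<lambda>t. of_bool (t \<in> {..real n}))" for n by (rule ray)
    show "AE t in M. (\<lambda>n. of_bool (t \<in> {..real n}) :: complex) \<longlonglongrightarrow> of_bool (t \<in> UNIV)"
    proof (rule AE_I2, rule tendsto_eventually)
      fix t
      obtain N where N: "t \<le> real N" using real_arch_simple by blast
      show "eventually (\<lambda>n. of_bool (t \<in> {..real n}) = (of_bool (t \<in> UNIV) :: complex)) sequentially"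
        using eventually_ge_at_top[of N]
      proof eventually_elim
        case (elim n)
        then have "t \<le> real n" using N by linarith
        then show ?case by simp
      qed
    qed
    show "(\<lambda>t. of_bool (t \<in> {..real n})) \<in> sq" for n by (rule indicator_sq) simp
  qed auto
  have borel: "B \<in> sets borel" if "B \<in> sigma_sets UNIV (range (\<lambda>t::real. {..t}))" for B
    using that by (simp add: borel_eq_atMost)
  have "Int_stable (range (\<lambda>t::real. {..t}))"
    by (auto simp: Int_stable_def intro!: image_eqI[of _ _ "min _ _"])
  moreover have "range (\<lambda>t::real. {..t}) \<subseteq> Pow UNIV" by simp
  moreover have "A \<in> sigma_sets UNIV (range (\<lambda>t::real. {..t}))" using assms by (simp add: borel_eq_atMost)
  ultimately show ?thesis
  proof (induction A rule: sigma_sets_induct_disjoint)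
    case (basic A) then show ?case using ray by auto
  next
    case empty
    show ?case using approximable_cmult[OF one, of 0] by simp
  next
    case (compl A)
    note A = borel[OF compl(1)]
    have "approximable (\<lambda>t. of_bool (t \<in> UNIV) + (- 1) * of_bool (t \<in> A))"
      by (intro approximable_add approximable_cmult one compl indicator_sq A sq_cmult) auto
    moreover have "(\<lambda>t. of_bool (t \<in> UNIV) + (- 1) * of_bool (t \<in> A)) = (\<lambda>t. of_bool (t \<in> UNIV - A) :: complex)"
      by auto
    ultimately show ?case by (simp only:)
  next
    case (union A)
    have meas: "A i \<in> sets borel" for i using union(2) borel by blast
    show ?case
    proof (rule approximable_indicator_bounded_limit)
      show "(\<Union>i. A i) \<in> sets borel" using meas by auto
      show sq: "(\<lambda>t. of_bool (t \<in> (\<Union>i<n. A i))) \<in> sq" for n by (rule indicator_sq) (use meas in auto)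
      show "approximable (\<lambda>t. of_bool (t \<in> (\<Union>i<n. A i)))" for n
      proof (induction n)
        case 0 show ?case using approximable_cmult[OF one, of 0] by simp
      next
        case (Suc n)
        have "approximable (\<lambda>t. of_bool (t \<in> (\<Union>i<n. A i)) + of_bool (t \<in> A n))"
          by (intro approximable_add Suc sq indicator_sq meas union)
        moreover have "of_bool (t \<in> (\<Union>i<n. A i)) + of_bool (t \<in> A n) = (of_bool (t \<in> (\<Union>i<Suc n. A i)) :: complex)" for t
        proof -
          have "A i \<inter> A n = {}" if "i < n" for i using union(1) that by (auto simp: disjoint_family_on_def)
          then have "t \<in> A n \<Longrightarrow> t \<notin> (\<Union>i<n. A i)" by blast
          moreover have "t \<in> (\<Union>i<Suc n. A i) \<longleftrightarrow> t \<in> (\<Union>i<n. A i) \<or> t \<in> A n" by (simp add: lessThan_Suc disj_commute)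
          ultimately show ?thesis by (cases "t \<in> A n") (simp_all only: of_bool_eq simp_thms add_0_left add_0_right)
        qed
        ultimately show ?case by (simp only:)
      qed
      show "AE t in M. (\<lambda>n. of_bool (t \<in> (\<Union>i<n. A i)) :: complex) \<longlonglongrightarrow> of_bool (t \<in> (\<Union>i. A i))"
      proof (rule AE_I2)
        fix t
        have "(\<lambda>n. complex_of_real (indicator (\<Union>i<n. A i) t)) \<longlonglongrightarrow> of_real (indicator (\<Union>i. A i) t)"
          by (intro tendsto_of_real LIMSEQ_indicator_UN)
        then show "(\<lambda>n. of_bool (t \<in> (\<Union>i<n. A i)) :: complex) \<longlonglongrightarrow> of_bool (t \<in> (\<Union>i. A i))"
          by (simp only: indicator_def of_bool_def of_real_1 of_real_0 if_distrib[of complex_of_real])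
      qed
    qed auto
  qed
qed

text \<open>Square integrability is the premise of an implication rather than an assumption, because
  the induction builds \<open>u\<close> from other functions. In the sum and limit cases these
  inherit it by being dominated by \<open>u\<close>.\<close>

lemma approximable_nonneg:
  fixes u :: "real \<Rightarrow> real"
  assumes "u \<in> borel_measurable M" "\<And>t. 0 \<le> u t"
  shows "(\<lambda>t. complex_of_real (u t)) \<in> sq \<longrightarrow> approximable (\<lambda>t. complex_of_real (u t))"
  using assms
proof (induction u rule: borel_measurable_induct_real)
  case (set A)
  have "A \<in> sets borel"
    using set by (auto simp: M_def sets_restrict_space)
  then show ?case using approximable_indicator[of A] by (simp add: indicator_def of_bool_def if_distrib cong: if_cong)
next
  case (mult u c)
  show ?case
  proof (cases "c = 0")
    case True
    \<comment> \<open>Here \<open>u\<close> itself may fail to be square integrable, but the product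
      is zero.\<close>
    then show ?thesis using approximable_cmult[OF approximable_indicator[of UNIV], of 0] by simp
  next
    case False
    show ?thesis
    proof
      assume "(\<lambda>t. complex_of_real (c * u t)) \<in> sq"
      from sq_cmult[OF this, of "of_real (1 / c)"] have "(\<lambda>t. complex_of_real (u t)) \<in> sq" using False by simp
      then show "approximable (\<lambda>t. complex_of_real (c * u t))"
        using mult approximable_cmult[of "\<lambda>t. complex_of_real (u t)" "of_real c"] by simp
    qed
  qed
next
  case (add u v)
  show ?case
  proof
    assume a: "(\<lambda>t. complex_of_real (v t + u t)) \<in> sq"
    have "(\<lambda>t. complex_of_real (v t)) \<in> sq" "(\<lambda>t. complex_of_real (u t)) \<in> sq"
      by (rule dominated_sq[OF a]; use add.hyps in \<open>simp flip: of_real_add\<close>)+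
    then show "approximable (\<lambda>t. complex_of_real (v t + u t))"
      using add.IH approximable_add[of "\<lambda>t. complex_of_real (v t)" "\<lambda>t. complex_of_real (u t)"] by simp
  qed
next
  case (seq U)
  have lim: "(\<lambda>i. U i t) \<longlonglongrightarrow> u t" if "t \<in> space M" for t using seq.hyps that by blast
  have inc: "incseq U" by fact
  have U0: "0 \<le> U i t" and Um [measurable]: "U i \<in> borel_measurable M" for i t by fact+
  have le: "U n t \<le> u t" if "t \<in> space M" for n t
    by (rule incseq_le[OF _ lim[OF that]]) (use inc in \<open>auto simp: incseq_def le_fun_def\<close>)
  have b: "cmod (complex_of_real (U n t)) \<le> cmod (complex_of_real (u t))"
    "cmod (complex_of_real (u t) - complex_of_real (U n t)) \<le> cmod (complex_of_real (u t))" if "t \<in> space M" for n t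
    using le[OF that, of n] U0[of n t] unfolding of_real_diff[symmetric] norm_of_real by simp_all
  show ?case
  proof
    assume us: "(\<lambda>t. complex_of_real (u t)) \<in> sq"
    have Us: "(\<lambda>t. complex_of_real (U n t)) \<in> sq" for n
      by (rule dominated_sq[OF us _ b(1)]) measurable
    show "approximable (\<lambda>t. complex_of_real (u t))"
    proof (rule approximable_limit[OF us Us _ us])
      show "approximable (\<lambda>t. complex_of_real (U n t))" for n using seq.IH Us by blast
      show "AE t in M. cmod (complex_of_real (u t) - complex_of_real (U n t)) \<le> cmod (complex_of_real (u t))" for n
        by (intro AE_I2 b)
      show "AE t in M. (\<lambda>n. complex_of_real (U n t)) \<longlonglongrightarrow> complex_of_real (u t)"
        by (intro AE_I2 tendsto_of_real lim)
    qed
  qed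
qed

theorem test_functions_dense:
  assumes u: "u \<in> sq" shows "approximable u"
proof -
  have [measurable]: "u \<in> borel_measurable M" using u by (simp add: square_int_def)
  have part: "(\<lambda>t. complex_of_real (f t)) \<in> sq" "approximable (\<lambda>t. complex_of_real (f t))"
    if [measurable]: "f \<in> borel_measurable M" and "\<And>t. 0 \<le> f t" "\<And>t. f t \<le> cmod (u t)" for f
  proof -
    show "(\<lambda>t. complex_of_real (f t)) \<in> sq" by (rule dominated_sq[OF u]) (use that in auto)
    then show "approximable (\<lambda>t. complex_of_real (f t))" using approximable_nonneg that by blast
  qed
  have mRe [measurable]: "(\<lambda>t. Re (u t)) \<in> borel_measurable M" "(\<lambda>t. Im (u t)) \<in> borel_measurable M" by measurable
  have b: "\<bar>Re (u t)\<bar> \<le> cmod (u t)" "\<bar>Im (u t)\<bar> \<le> cmod (u t)" for t by (rule abs_Re_le_cmod, rule abs_Im_le_cmod)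
  have b': "max 0 (Re (u t)) \<le> cmod (u t)" "max 0 (- Re (u t)) \<le> cmod (u t)"
    "max 0 (Im (u t)) \<le> cmod (u t)" "max 0 (- Im (u t)) \<le> cmod (u t)" for t
    using b[of t] by auto
  have p1: "(\<lambda>t. complex_of_real (max 0 (Re (u t)))) \<in> sq" "approximable (\<lambda>t. complex_of_real (max 0 (Re (u t))))"
    by (rule part; use b' in \<open>simp del: max.bounded_iff\<close>)+
  have p2: "(\<lambda>t. complex_of_real (max 0 (- Re (u t)))) \<in> sq" "approximable (\<lambda>t. complex_of_real (max 0 (- Re (u t))))"
    by (rule part; use b' in \<open>simp del: max.bounded_iff\<close>)+
  have p3: "(\<lambda>t. complex_of_real (max 0 (Im (u t)))) \<in> sq" "approximable (\<lambda>t. complex_of_real (max 0 (Im (u t))))"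
    by (rule part; use b' in \<open>simp del: max.bounded_iff\<close>)+
  have p4: "(\<lambda>t. complex_of_real (max 0 (- Im (u t)))) \<in> sq" "approximable (\<lambda>t. complex_of_real (max 0 (- Im (u t))))"
    by (rule part; use b' in \<open>simp del: max.bounded_iff\<close>)+
  have "approximable (\<lambda>t. (complex_of_real (max 0 (Re (u t))) + (- 1) * complex_of_real (max 0 (- Re (u t))))
      + (\<i> * complex_of_real (max 0 (Im (u t))) + (- \<i>) * complex_of_real (max 0 (- Im (u t)))))"
    by (intro approximable_add sq_add approximable_cmult sq_cmult p1 p2 p3 p4)
  moreover have "(complex_of_real (max 0 (Re (u t))) + (- 1) * complex_of_real (max 0 (- Re (u t))))
      + (\<i> * complex_of_real (max 0 (Im (u t))) + (- \<i>) * complex_of_real (max 0 (- Im (u t)))) = u t" for t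
    by (auto simp: complex_eq_iff max_def)
  ultimately show ?thesis by (simp only:)
qed

end

section \<open>Edges and vertices of the tree\<close>

context metric_tree
begin

lemma finite_edges: "finite (edges T)"
  unfolding edges_def by (simp add: finite_halflines)

lemma start_arc: "e \<in> arcs (core T) \<Longrightarrow> start T e = tail (core T) e"
  using halflines_disjoint by (auto simp: start_def)

lemma foot_in_verts: "e \<in> halflines T \<Longrightarrow> foot T e \<in> verts (core T)"
  using halflines_at_leaves by (auto simp: leaves_def)

lemma start_in_verts: "e \<in> edges T \<Longrightarrow> start T e \<in> verts (core T)"
  using foot_in_verts start_arc by (auto simp: edges_def start_def)

lemma vertex_dist_walk: "core.awalk (root T) p v \<Longrightarrow> vertex_dist T v = sum_list (map (len T) p)"
  using the1_equality[OF unique_walk] core.awalk_last_in_verts[of "root T" p v]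
  unfolding vertex_dist_def by metis

lemma walk_extend:
  assumes "e \<in> arcs (core T)" "core.awalk (root T) p (tail (core T) e)"
  shows "core.awalk (root T) (p @ [e]) (head (core T) e)"
  using core.awalk_appendI[OF assms(2) core.arc_implies_awalk[OF assms(1)]] .

lemma arc_to_tail_walk:
  assumes "e \<in> arcs (core T)"
  obtains p where "core.awalk (root T) p (tail (core T) e)"
  using unique_walk[of "tail (core T) e"] assms by auto

text \<open>A loop could be appended to any walk reaching it, against uniqueness of walks. Hence an
  arc has two distinct ends, and its data there can be prescribed independently.\<close>

lemma tail_neq_head:
  assumes "e \<in> arcs (core T)" shows "tail (core T) e \<noteq> head (core T) e"
proof
  assume eq: "tail (core T) e = head (core T) e"
  obtain p where p: "core.awalk (root T) p (tail (core T) e)" using arc_to_tail_walk[OF assms] .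
  have p': "core.awalk (root T) (p @ [e]) (tail (core T) e)" using walk_extend[OF assms p] eq by simp
  have v: "tail (core T) e \<in> verts (core T)" using assms by simp
  have "p @ [e] = p"
    using the1_equality[OF unique_walk[OF v] p] the1_equality[OF unique_walk[OF v] p'] by simp
  then show False by simp
qed

text \<open>Appending the arc to the walk to its tail gives the unique walk to its head. So
  \<open>|x|\<close>, and with it the Gaussian weight, is continuous across vertices.\<close>

lemma vertex_dist_head:
  assumes "e \<in> arcs (core T)"
  shows "vertex_dist T (head (core T) e) = vertex_dist T (tail (core T) e) + len T e"
proof -
  obtain p where p: "core.awalk (root T) p (tail (core T) e)" using arc_to_tail_walk[OF assms] .
  then show ?thesis using vertex_dist_walk[OF p] vertex_dist_walk[OF walk_extend[OF assms p]] by simp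
qed

lemma vertex_dist_nonneg:
  assumes "v \<in> verts (core T)" shows "0 \<le> vertex_dist T v"
proof -
  obtain p where p: "core.awalk (root T) p v" using unique_walk[OF assms] by blast
  then have "set p \<subseteq> arcs (core T)" by (auto simp: core.awalk_def)
  then have "0 \<le> sum_list (map (len T) p)" using len_pos by (intro sum_list_nonneg) (auto intro: less_imp_le)
  then show ?thesis using vertex_dist_walk[OF p] by simp
qed

definition ends :: "'e \<Rightarrow> 'v set" where
  "ends e = {v \<in> verts (core T). e \<in> incident T v}"

lemma ends_halfline: "e \<in> halflines T \<Longrightarrow> ends e = {start T e}"
  using halflines_disjoint foot_in_verts by (auto simp: ends_def incident_def edges_def start_def)

lemma ends_arc: "e \<in> arcs (core T) \<Longrightarrow> ends e = {tail (core T) e, head (core T) e}"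
  using start_arc by (auto simp: ends_def incident_def edges_def)

lemma incident_edges: "incident T v \<subseteq> edges T"
  by (auto simp: incident_def)

lemma finite_incident: "finite (incident T v)"
  using finite_subset[OF incident_edges finite_edges] .

text \<open>Double counting of incidences: Green's formula yields boundary terms edge by edge,
  whereas the conditions are imposed vertex by vertex.\<close>

lemma sum_vertices_edges:
  "(\<Sum>v\<in>verts (core T). \<Sum>e\<in>incident T v. \<phi> e v) = (\<Sum>e\<in>edges T. \<Sum>v\<in>ends e. \<phi> e v)"
proof -
  have "incident T v = {e \<in> edges T. e \<in> incident T v}" for v using incident_edges by blast
  then have "(\<Sum>v\<in>verts (core T). \<Sum>e\<in>incident T v. \<phi> e v)
      = (\<Sum>v\<in>verts (core T). \<Sum>e\<in>{e \<in> edges T. e \<in> incident T v}. \<phi> e v)" by simp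
  also have "\<dots> = (\<Sum>e\<in>edges T. \<Sum>v\<in>ends e. \<phi> e v)"
    unfolding ends_def by (rule sum.swap_restrict) (auto simp: finite_edges)
  finally show ?thesis .
qed

end

text \<open>\<open>normal_deriv\<close> for an explicitly given derivative \<open>p\<close>, free of
  Hilbert choice.\<close>

definition outward :: "('v, 'e) tree \<Rightarrow> (real \<Rightarrow> complex) \<Rightarrow> 'e \<Rightarrow> 'v \<Rightarrow> complex" where
  "outward T p e v = (if start T e = v then p 0 else - p (len T e))"

locale tree_edge = metric_tree T for T :: "('v, 'e) tree" +
  fixes e :: 'e
  assumes edge: "e \<in> edges T"
begin

sublocale gauss_interval "e \<in> halflines T" "len T e" "vertex_dist T (start T e)"
  using edge len_pos vertex_dist_nonneg[OF start_in_verts[OF edge]]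
  by unfold_locales (auto simp: edges_def)

lemma open_edge_eq: "open_edge T e = I" by (simp add: open_edge_def I_def)

lemma closed_edge_eq: "closed_edge T e = J" by (simp add: closed_edge_def J_def)

lemma gauss_edge_eq: "gauss_edge T e = M"
  unfolding gauss_edge_def M_def G_def[abs_def] root_dist_def open_edge_eq ..

lemma edge_sobolev_eq: "edge_sobolev T k e = sobolev k"
  unfolding edge_sobolev_def sobolev_def gauss_edge_eq open_edge_eq ..

lemma wderiv_eq: "wderiv T k f e = weak_deriv k (f e)"
  unfolding wderiv_def weak_deriv_def open_edge_eq ..

lemma is_cont_rep_eq: "is_cont_rep T e u F = cont_rep u F"
  unfolding is_cont_rep_def cont_rep_def gauss_edge_eq closed_edge_eq ..

lemma end_coord_in_J:
  assumes "e \<in> incident T v" shows "end_coord T e v \<in> J"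
proof (cases "start T e = v")
  case True then show ?thesis using zero_in_J by (simp add: end_coord_def)
next
  case False
  then have a: "e \<in> arcs (core T)" using assms by (simp add: incident_def)
  then have "\<not> e \<in> halflines T" using halflines_disjoint by blast
  then show ?thesis using False len_pos[OF a] J_compact by (simp add: end_coord_def)
qed

lemma end_coord_not_in_I:
  assumes "e \<in> incident T v" shows "end_coord T e v \<notin> I" "start T e \<noteq> v \<Longrightarrow> len T e \<notin> I"
proof -
  have "len T e \<notin> I" if "start T e \<noteq> v"
  proof -
    have "e \<in> arcs (core T)" using assms that by (simp add: incident_def)
    then have "\<not> e \<in> halflines T" using halflines_disjoint by blast
    then show ?thesis using boundary_not_in_I(2) by blast
  qed
  then show "end_coord T e v \<notin> I" "start T e \<noteq> v \<Longrightarrow> len T e \<notin> I"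
    using boundary_not_in_I(1) by (auto simp: end_coord_def)
qed

lemma vertex_value_eq:
  assumes "cont_rep (f e) F" "e \<in> incident T v"
  shows "vertex_value T f e v = F (end_coord T e v)"
  using cont_rep_value[OF assms(1) end_coord_in_J[OF assms(2)]]
  unfolding vertex_value_def is_cont_rep_eq .

lemma normal_deriv_eq:
  assumes "cont_rep (wderiv T 1 f e) p" "e \<in> incident T v"
  shows "normal_deriv T f e v = outward T p e v"
  using vertex_value_eq[of "wderiv T 1 f", OF assms]
  by (simp add: normal_deriv_def outward_def end_coord_def)

text \<open>By \<open>vertex_dist_head\<close> the value of \<open>G\<close> at an end is determined
  by the vertex, whichever edge leads there. The minus sign arises because \<open>outward\<close> is
  directed away from the vertex into the edge, whereas \<open>bdry\<close> is oriented out of the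
  edge.\<close>

lemma bdry_eq:
  "bdry (\<lambda>t. of_real (G t) * (p t * cnj (H t))) =
    - (\<Sum>v\<in>ends e. of_real (2 / sqrt pi * exp (- (vertex_dist T v)\<^sup>2)) * (outward T p e v * cnj (H (end_coord T e v))))"
proof (cases "e \<in> halflines T")
  case True
  show ?thesis unfolding bdry_half_line[OF True] ends_halfline[OF True]
    by (simp add: G_def outward_def end_coord_def)
next
  case False
  then have a: "e \<in> arcs (core T)" using edge by (simp add: edges_def)
  note [simp] = start_arc[OF a] tail_neq_head[OF a]
  have "G (len T e) = 2 / sqrt pi * exp (- (vertex_dist T (head (core T) e))\<^sup>2)"
    unfolding G_def by (simp add: vertex_dist_head[OF a])
  moreover have "G 0 = 2 / sqrt pi * exp (- (vertex_dist T (tail (core T) e))\<^sup>2)"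
    unfolding G_def by simp
  ultimately show ?thesis unfolding bdry_compact[OF False] ends_arc[OF a]
    by (simp add: outward_def end_coord_def)
qed

lemma weighted_test_integral:
  fixes \<psi> :: "real \<Rightarrow> real"
  shows "(LINT t|M. of_real (\<psi> t) * cnj (u t)) = cnj (LINT t:I|lborel. \<psi> t *\<^sub>R (of_real (G t) * u t))"
  unfolding integral_M set_lebesgue_integral_def
  by (subst Bochner_Integration.integral_cnj[symmetric], rule Bochner_Integration.integral_cong)
    (auto simp: scaleR_conv_of_real indicator_def)

end

context metric_tree
begin

section \<open>Representatives on the whole tree\<close>

lemma tree_edgeI: "e \<in> edges T \<Longrightarrow> tree_edge T e"
  by unfold_locales

text \<open>
  \<open>F\<close>, \<open>p\<close>, \<open>q\<close> are the continuous representative of \<open>f\<close> and the first two derivatives. They are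
  primitives on the closed edges, so that point evaluation at the vertices makes sense.
\<close>

definition rep1 :: "'e tree_fun \<Rightarrow> 'e tree_fun \<Rightarrow> 'e tree_fun \<Rightarrow> bool" where
  "rep1 f F p \<longleftrightarrow> (\<forall>e\<in>edges T. ac_deriv (closed_edge T e) (F e) (p e) \<and> is_cont_rep T e (f e) (F e) \<and>
     F e \<in> square_int (gauss_edge T e) \<and> p e \<in> square_int (gauss_edge T e) \<and> f e \<in> borel_measurable (gauss_edge T e))"

definition edge_rep2 :: "'e \<Rightarrow> (real \<Rightarrow> complex) \<Rightarrow> (real \<Rightarrow> complex) \<Rightarrow> (real \<Rightarrow> complex) \<Rightarrow> (real \<Rightarrow> complex) \<Rightarrow> bool" where
  "edge_rep2 e u F p q \<longleftrightarrow> ac_deriv (closed_edge T e) F p \<and> ac_deriv (closed_edge T e) p q \<and> is_cont_rep T e u F \<and>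
     F \<in> square_int (gauss_edge T e) \<and> p \<in> square_int (gauss_edge T e) \<and> q \<in> square_int (gauss_edge T e) \<and>
     u \<in> borel_measurable (gauss_edge T e)"

definition rep2 :: "'e tree_fun \<Rightarrow> 'e tree_fun \<Rightarrow> 'e tree_fun \<Rightarrow> 'e tree_fun \<Rightarrow> bool" where
  "rep2 f F p q \<longleftrightarrow> (\<forall>e\<in>edges T. edge_rep2 e (f e) (F e) (p e) (q e))"

lemma rep2_rep1: "rep2 f F p q \<Longrightarrow> rep1 f F p"
  unfolding rep1_def rep2_def edge_rep2_def by blast

text \<open>Choice over the edges; \<open>Q\<close> carries whatever else the edgewise construction
  guarantees.\<close>

lemma rep2_choice:
  assumes "\<And>e. e \<in> edges T \<Longrightarrow> \<exists>F p q. edge_rep2 e (f e) F p q \<and> Q e F p q"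
  obtains F p q where "rep2 f F p q" "\<And>e. e \<in> edges T \<Longrightarrow> Q e (F e) (p e) (q e)"
proof -
  let ?P = "\<lambda>e x. edge_rep2 e (f e) (fst x) (fst (snd x)) (snd (snd x)) \<and> Q e (fst x) (fst (snd x)) (snd (snd x))"
  have "\<exists>x. ?P e x" if e: "e \<in> edges T" for e
  proof -
    obtain F p q where "edge_rep2 e (f e) F p q \<and> Q e F p q" using assms[OF e] by blast
    then show ?thesis by (intro exI[of _ "(F, p, q)"], unfold fst_conv snd_conv)
  qed
  then have "\<forall>e\<in>edges T. \<exists>x. ?P e x" ..
  from bchoice[OF this] obtain x where x: "\<forall>e\<in>edges T. ?P e (x e)" ..
  then have "rep2 f (\<lambda>e. fst (x e)) (\<lambda>e. fst (snd (x e))) (\<lambda>e. snd (snd (x e)))"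
    unfolding rep2_def by blast
  then show ?thesis using that x by blast
qed

text \<open>For functions that are constructed rather than given: each is its own continuous
  representative.\<close>

lemma rep2_choice_self:
  assumes "\<And>e. e \<in> edges T \<Longrightarrow> \<exists>u p q. edge_rep2 e u u p q \<and> Q e u p q"
  obtains f p q where "rep2 f f p q" "\<And>e. e \<in> edges T \<Longrightarrow> Q e (f e) (p e) (q e)"
proof -
  have "\<forall>e\<in>edges T. \<exists>u p q. edge_rep2 e u u p q \<and> Q e u p q" using assms ..
  from bchoice[OF this] obtain f where f: "\<forall>e\<in>edges T. \<exists>p q. edge_rep2 e (f e) (f e) p q \<and> Q e (f e) p q" ..
  obtain F p q where F: "rep2 f F p q" "\<And>e. e \<in> edges T \<Longrightarrow> F e = f e \<and> Q e (F e) (p e) (q e)"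
    by (rule rep2_choice[of f "\<lambda>e F p q. F = f e \<and> Q e F p q"]) (use f in blast)+
  then have "rep2 f f p q" unfolding rep2_def by auto
  moreover have "Q e (f e) (p e) (q e)" if "e \<in> edges T" for e
    using F(2)[OF that] by (elim conjE) (rule back_subst[where P="\<lambda>u. Q e u (p e) (q e)"])
  ultimately show ?thesis using that by blast
qed

lemma rep1_vertex_value:
  assumes "rep1 f F p" "e \<in> incident T v"
  shows "vertex_value T f e v = F e (end_coord T e v)"
proof -
  have e: "e \<in> edges T" using assms(2) incident_edges by blast
  interpret tree_edge T e by (rule tree_edgeI[OF e])
  show ?thesis using assms e by (intro vertex_value_eq) (auto simp: rep1_def is_cont_rep_eq)
qed

lemma rep1_wderiv:
  assumes "rep1 f F p" "e \<in> edges T"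
  shows "AE t in gauss_edge T e. wderiv T 1 f e t = p e t" "f e \<in> edge_sobolev T 1 e"
proof -
  interpret tree_edge T e by (rule tree_edgeI[OF assms(2)])
  have a: "ac_deriv J (F e) (p e)" "cont_rep (f e) (F e)" "F e \<in> sq" "p e \<in> sq" "f e \<in> borel_measurable M"
    using assms by (auto simp: rep1_def closed_edge_eq is_cont_rep_eq gauss_edge_eq)
  have AE: "AE t in M. F e t = f e t" using a(2) by (simp add: cont_rep_def)
  have w: "has_weak_deriv I 1 (f e) (p e)" by (rule has_weak_deriv_of_rep[OF a(1,5) AE a(4)])
  show "AE t in gauss_edge T e. wderiv T 1 f e t = p e t"
    unfolding gauss_edge_eq wderiv_eq by (rule weak_deriv_eq_AE(2)[OF w])
  show "f e \<in> edge_sobolev T 1 e"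
    unfolding edge_sobolev_eq sobolev_def using w a(4) sq_cong_AE[OF a(3,5) AE] by auto
qed

lemma rep2_facts:
  assumes "rep2 f F p q" "e \<in> edges T"
  shows "f e \<in> edge_sobolev T 2 e" "AE t in gauss_edge T e. wderiv T 2 f e t = q e t"
    "is_cont_rep T e (wderiv T 1 f e) (p e)" "AE t in gauss_edge T e. wderiv T 1 f e t = p e t"
proof -
  interpret tree_edge T e by (rule tree_edgeI[OF assms(2)])
  have a: "ac_deriv J (F e) (p e)" "ac_deriv J (p e) (q e)" "F e \<in> sq" "p e \<in> sq" "q e \<in> sq"
    "f e \<in> borel_measurable M" "AE t in M. F e t = f e t"
    using assms by (auto simp: rep2_def edge_rep2_def closed_edge_eq is_cont_rep_eq gauss_edge_eq cont_rep_def)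
  note s = sobolev_2I[OF a]
  show "f e \<in> edge_sobolev T 2 e" "AE t in gauss_edge T e. wderiv T 2 f e t = q e t"
    "is_cont_rep T e (wderiv T 1 f e) (p e)" "AE t in gauss_edge T e. wderiv T 1 f e t = p e t"
    unfolding edge_sobolev_eq wderiv_eq gauss_edge_eq is_cont_rep_eq using s by blast+
qed

lemma rep2_normal_deriv:
  assumes "rep2 f F p q" "e \<in> incident T v"
  shows "normal_deriv T f e v = outward T (p e) e v"
proof -
  have e: "e \<in> edges T" using assms(2) incident_edges by blast
  interpret tree_edge T e by (rule tree_edgeI[OF e])
  show ?thesis using rep2_facts(3)[OF assms(1) e] assms(2) by (intro normal_deriv_eq) (simp_all add: is_cont_rep_eq)
qed

lemma sobolev_1_rep1:
  assumes "f \<in> sobolev_tilde T 1"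
  obtains F where "rep1 f F (wderiv T 1 f)"
proof -
  have "\<exists>F. ac_deriv (closed_edge T e) F (wderiv T 1 f e) \<and> is_cont_rep T e (f e) F \<and>
     F \<in> square_int (gauss_edge T e) \<and> wderiv T 1 f e \<in> square_int (gauss_edge T e) \<and> f e \<in> borel_measurable (gauss_edge T e)"
    if e: "e \<in> edges T" for e
  proof -
    interpret tree_edge T e by (rule tree_edgeI[OF e])
    have "f e \<in> edge_sobolev T 1 e" using assms e unfolding sobolev_tilde_def by blast
    then have s: "f e \<in> sobolev 1" unfolding edge_sobolev_eq .
    obtain F where "ac_deriv J F (weak_deriv 1 (f e))" "cont_rep (f e) F" "F \<in> sq" "weak_deriv 1 (f e) \<in> sq"
      using sobolev_1_rep[OF s] by blast
    moreover have "f e \<in> borel_measurable M" using s by (simp add: sobolev_def square_int_def)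
    ultimately show ?thesis unfolding closed_edge_eq is_cont_rep_eq gauss_edge_eq wderiv_eq by blast
  qed
  then have "\<exists>F. rep1 f F (wderiv T 1 f)" unfolding rep1_def by (intro bchoice) blast
  then show ?thesis using that by blast
qed

lemma sobolev_2_rep2:
  assumes "f \<in> sobolev_tilde T 2"
  obtains F p q where "rep2 f F p q"
proof -
  have "\<exists>F p q. edge_rep2 e (f e) F p q \<and> True" if e: "e \<in> edges T" for e
  proof -
    interpret tree_edge T e by (rule tree_edgeI[OF e])
    have "f e \<in> edge_sobolev T 2 e" using assms e unfolding sobolev_tilde_def by blast
    then have s: "f e \<in> sobolev 2" unfolding edge_sobolev_eq .
    then have m: "f e \<in> borel_measurable M" "f e \<in> sq" by (simp_all add: sobolev_def square_int_def)
    obtain F p where Fp: "ac_deriv J F (weak_deriv 1 (f e))" "ac_deriv J p (weak_deriv 1 (weak_deriv 1 (f e)))"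
      "cont_rep (f e) F" "cont_rep (weak_deriv 1 (f e)) p" "p \<in> sq" "weak_deriv 1 (weak_deriv 1 (f e)) \<in> sq"
      using sobolev_2_rep[OF s] by blast
    have Fs: "F \<in> sq"
      by (rule sq_cong_AE[OF m(2) continuous_measurable[OF ac_deriv_continuous[OF Fp(1)]]])
        (use Fp(3) in \<open>auto simp: cont_rep_def elim: eventually_mono\<close>)
    \<comment> \<open>The derivative of \<open>F\<close> so far is the arbitrarily chosen weak
      derivative; it is replaced by the continuous \<open>p\<close>, which equals it almost
      everywhere.\<close>
    have "ac_deriv J F p"
    proof (rule ac_deriv_cong_AE[OF Fp(1)])
      have "AE t in M. p t = weak_deriv 1 (f e) t" using Fp(4) by (simp add: cont_rep_def)
      then show "AE t in lborel. t \<in> J \<longrightarrow> weak_deriv 1 (f e) t = p t"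
        unfolding AE_M_J by eventually_elim auto
    qed (rule sq_set_integrable[OF Fp(5)])
    with Fp Fs m show ?thesis
      unfolding edge_rep2_def closed_edge_eq is_cont_rep_eq gauss_edge_eq by blast
  qed
  then show ?thesis using that by (rule rep2_choice)
qed

section \<open>The form and the operator on the tree\<close>

definition weight :: "'v \<Rightarrow> complex" where
  "weight v = of_real (2 / sqrt pi * exp (- (vertex_dist T v)\<^sup>2))"

lemma weight_nonzero: "weight v \<noteq> 0"
  by (simp add: weight_def)

lemma inner_L2_cong:
  assumes "\<And>e. e \<in> edges T \<Longrightarrow> f e \<in> borel_measurable (gauss_edge T e) \<and> f' e \<in> borel_measurable (gauss_edge T e) \<and>
      (AE t in gauss_edge T e. f e t = f' e t)"
    and "\<And>e. e \<in> edges T \<Longrightarrow> g e \<in> borel_measurable (gauss_edge T e) \<and> g' e \<in> borel_measurable (gauss_edge T e) \<and>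
      (AE t in gauss_edge T e. g e t = g' e t)"
  shows "inner_L2 T f g = inner_L2 T f' g'"
  unfolding inner_L2_def
proof (rule sum.cong[OF refl])
  fix e assume e: "e \<in> edges T"
  note f = assms(1)[OF e] and g = assms(2)[OF e]
  have cm: "(\<lambda>t. cnj (u t)) \<in> borel_measurable M" if "u \<in> borel_measurable M" for u :: "real \<Rightarrow> complex" and M
    by (rule borel_measurable_continuous_on[where g=u]) (use that in \<open>auto intro!: continuous_intros\<close>)
  show "(LINT t|gauss_edge T e. f e t * cnj (g e t)) = (LINT t|gauss_edge T e. f' e t * cnj (g' e t))"
  proof (rule integral_cong_AE)
    show "AE t in gauss_edge T e. f e t * cnj (g e t) = f' e t * cnj (g' e t)"
      using conjunct2[OF conjunct2[OF f]] conjunct2[OF conjunct2[OF g]] by eventually_elim simp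
  qed (use f g cm in \<open>auto intro!: borel_measurable_times\<close>)
qed

lemma inner_L2_commute: "inner_L2 T g f = cnj (inner_L2 T f g)"
  unfolding inner_L2_def cnj_sum
  by (intro sum.cong refl, subst Bochner_Integration.integral_cnj[symmetric]) (simp add: mult.commute)

lemma L2D: "f \<in> L2 T \<Longrightarrow> e \<in> edges T \<Longrightarrow> f e \<in> square_int (gauss_edge T e)"
  by (simp add: L2_def)

lemma square_int_measurable: "u \<in> square_int M \<Longrightarrow> u \<in> borel_measurable M"
  by (simp add: square_int_def)

definition boundary_form :: "'e tree_fun \<Rightarrow> 'e tree_fun \<Rightarrow> complex" where
  "boundary_form p H = (\<Sum>v\<in>verts (core T). weight v *
     (\<Sum>e\<in>incident T v. outward T (p e) e v * cnj (H e (end_coord T e v))))"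

text \<open>The drift term is square integrable by \<open>sq_x_mult\<close>, since \<open>p\<close>
  and its derivative \<open>q\<close> are. So the operator maps into the weighted space although its
  definition does not ask for it.\<close>

lemma OU_expr_rep:
  assumes "rep2 f F p q" "e \<in> edges T"
  shows "(\<lambda>t. - (1 / 2) * q e t + of_real (root_dist T e t) * p e t) \<in> square_int (gauss_edge T e)"
    "OU_expr T f e \<in> square_int (gauss_edge T e)"
    "AE t in gauss_edge T e. OU_expr T f e t = - (1 / 2) * q e t + of_real (root_dist T e t) * p e t"
proof -
  interpret tree_edge T e by (rule tree_edgeI[OF assms(2)])
  have a: "ac_deriv J (p e) (q e)" "p e \<in> sq" "q e \<in> sq"
    using assms by (auto simp: rep2_def edge_rep2_def closed_edge_eq gauss_edge_eq)
  have x: "(\<lambda>t. of_real (root_dist T e t) * p e t) \<in> sq"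
    unfolding root_dist_def by (rule sq_x_mult[OF a])
  show s: "(\<lambda>t. - (1 / 2) * q e t + of_real (root_dist T e t) * p e t) \<in> square_int (gauss_edge T e)"
    unfolding gauss_edge_eq by (intro sq_add sq_cmult a x)
  show AE: "AE t in gauss_edge T e. OU_expr T f e t = - (1 / 2) * q e t + of_real (root_dist T e t) * p e t"
    using rep2_facts(2,4)[OF assms] unfolding OU_expr_def by eventually_elim simp
  have "f e \<in> sobolev 2" using rep2_facts(1)[OF assms] unfolding edge_sobolev_eq .
  note d = sobolev_2_deriv[OF this]
  have "weak_deriv 1 (f e) \<in> borel_measurable M" "weak_deriv 2 (f e) \<in> borel_measurable M"
    using d(2,4) by (auto simp: sobolev_def square_int_def)
  moreover have c: "(\<lambda>t. complex_of_real (vertex_dist T (start T e) + t)) \<in> borel_measurable M"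
    by (intro continuous_measurable continuous_intros)
  ultimately have m: "OU_expr T f e \<in> borel_measurable M"
    unfolding OU_expr_def wderiv_eq root_dist_def
    by (intro borel_measurable_add borel_measurable_times borel_measurable_const c)
  show "OU_expr T f e \<in> square_int (gauss_edge T e)"
    unfolding gauss_edge_eq
    by (rule sq_cong_AE[OF s[unfolded gauss_edge_eq] m]) (use AE[unfolded gauss_edge_eq] in \<open>auto elim: eventually_mono\<close>)
qed

text \<open>Asymmetric on purpose: \<open>f\<close> has two derivatives, \<open>h\<close> only one,
  because \<open>h\<close> has to range over the whole form domain.\<close>

theorem green_formula_tree:
  assumes f: "rep2 f F p q" and h: "rep1 h H r"
  shows "OU_form T f h = inner_L2 T (OU_expr T f) h - 1 / 2 * boundary_form p H"
proof -
  have edge: "(LINT t|gauss_edge T e. wderiv T 1 f e t * cnj (wderiv T 1 h e t))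
      = 2 * (LINT t|gauss_edge T e. OU_expr T f e t * cnj (h e t))
        - (\<Sum>v\<in>ends e. weight v * (outward T (p e) e v * cnj (H e (end_coord T e v))))" if e: "e \<in> edges T" for e
  proof -
    interpret tree_edge T e by (rule tree_edgeI[OF e])
    have a: "ac_deriv J (p e) (q e)" "p e \<in> sq" "q e \<in> sq" "ac_deriv J (H e) (r e)" "H e \<in> sq" "r e \<in> sq"
      and hm: "h e \<in> borel_measurable M" and hH: "AE t in M. H e t = h e t" 
      using assms e by (auto simp: rep2_def edge_rep2_def rep1_def closed_edge_eq gauss_edge_eq is_cont_rep_eq cont_rep_def)
    note f1 = rep2_rep1[OF f]
    have wf: "weak_deriv 1 (f e) \<in> borel_measurable M" 
      using sobolev_2_deriv(2)[of "f e"] rep2_facts(1)[OF f e] unfolding edge_sobolev_eq by (auto simp: sobolev_def square_int_def)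
    have wh: "weak_deriv 1 (h e) \<in> borel_measurable M"
      using sobolev_1_rep[of "h e"] rep1_wderiv(2)[OF h e] unfolding edge_sobolev_eq by (auto simp: square_int_def)
    note [measurable] = a(2,3,5,6)[THEN square_int_measurable] hm wf wh
    have cm [measurable]: "(\<lambda>t. cnj (u t)) \<in> borel_measurable M" if "u \<in> borel_measurable M" for u :: "real \<Rightarrow> complex"
      by (rule borel_measurable_continuous_on[where g=u]) (use that in \<open>auto intro!: continuous_intros\<close>)
    have "(LINT t|M. wderiv T 1 f e t * cnj (wderiv T 1 h e t)) = (LINT t|M. p e t * cnj (r e t))"
    proof (rule integral_cong_AE)
      show "AE t in M. wderiv T 1 f e t * cnj (wderiv T 1 h e t) = p e t * cnj (r e t)"
        using rep1_wderiv(1)[OF f1 e] rep1_wderiv(1)[OF h e] unfolding gauss_edge_eq by eventually_elim simp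
    qed (unfold wderiv_eq, intro borel_measurable_times cm wf wh, measurable)
    also have "\<dots> = bdry (\<lambda>t. of_real (G t) * (p e t * cnj (H e t)))
        + (LINT t|M. (- q e t + 2 * (of_real (vertex_dist T (start T e) + t) * p e t)) * cnj (H e t))"
      by (rule green_formula[OF a])
    also have "(LINT t|M. (- q e t + 2 * (of_real (vertex_dist T (start T e) + t) * p e t)) * cnj (H e t))
        = (LINT t|M. 2 * (OU_expr T f e t * cnj (h e t)))"
    proof (rule integral_cong_AE)
      show "AE t in M. (- q e t + 2 * (of_real (vertex_dist T (start T e) + t) * p e t)) * cnj (H e t)
          = 2 * (OU_expr T f e t * cnj (h e t))"
        using OU_expr_rep(3)[OF f e] hH unfolding gauss_edge_eq root_dist_def
      proof eventually_elim
        case (elim t)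
        show ?case unfolding elim by (simp add: algebra_simps)
      qed
      show "(\<lambda>t. 2 * (OU_expr T f e t * cnj (h e t))) \<in> borel_measurable M"
        using OU_expr_rep(2)[OF f e, THEN square_int_measurable] unfolding gauss_edge_eq
        by (intro borel_measurable_times cm hm) auto
      show "(\<lambda>t. (- q e t + 2 * (of_real (vertex_dist T (start T e) + t) * p e t)) * cnj (H e t)) \<in> borel_measurable M"
        by (intro borel_measurable_times borel_measurable_add borel_measurable_uminus cm a(2,3,5)[THEN square_int_measurable] continuous_measurable)
          (auto intro!: continuous_intros)
    qed
    finally show ?thesis unfolding gauss_edge_eq bdry_eq weight_def by simp
  qed
  have "inner_L2 T (wderiv T 1 f) (wderiv T 1 h) = 2 * inner_L2 T (OU_expr T f) h
      - (\<Sum>e\<in>edges T. \<Sum>v\<in>ends e. weight v * (outward T (p e) e v * cnj (H e (end_coord T e v))))"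
    unfolding inner_L2_def sum_distrib_left sum_subtractf[symmetric] by (rule sum.cong[OF refl edge])
  also have "(\<Sum>e\<in>edges T. \<Sum>v\<in>ends e. weight v * (outward T (p e) e v * cnj (H e (end_coord T e v)))) = boundary_form p H"
    unfolding sum_vertices_edges[symmetric] boundary_form_def sum_distrib_left ..
  finally have eq: "inner_L2 T (wderiv T 1 f) (wderiv T 1 h) = 2 * inner_L2 T (OU_expr T f) h - boundary_form p H" .
  show ?thesis unfolding OU_form_def eq by (simp add: algebra_simps)
qed

definition vanishes_at :: "'e tree_fun \<Rightarrow> 'v \<Rightarrow> bool" where
  "vanishes_at f v \<longleftrightarrow> (\<forall>e\<in>incident T v. vertex_value T f e v = 0)"

text \<open>Dirichlet conditions on the set \<open>D\<close> of vertices, standard conditions elsewhere.\<close>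

definition operator_dom :: "'v set \<Rightarrow> 'e tree_fun set" where
  "operator_dom D = {f \<in> sobolev_tilde T 2. (\<forall>v\<in>D. vanishes_at f v) \<and>
     (\<forall>v\<in>verts (core T) - D. standard_conditions T f v)}"

definition form_dom :: "'v set \<Rightarrow> 'e tree_fun set" where
  "form_dom D = {f \<in> H1 T. \<forall>v\<in>D. vanishes_at f v}"

lemma operator_domI:
  assumes f: "rep2 f F p q"
    and D: "\<And>v e. v \<in> D \<Longrightarrow> e \<in> incident T v \<Longrightarrow> F e (end_coord T e v) = 0"
    and c: "\<And>v e e'. v \<in> verts (core T) - D \<Longrightarrow> e \<in> incident T v \<Longrightarrow> e' \<in> incident T v \<Longrightarrow>
      F e (end_coord T e v) = F e' (end_coord T e' v)"
    and k: "\<And>v. v \<in> verts (core T) - D \<Longrightarrow> (\<Sum>e\<in>incident T v. outward T (p e) e v) = 0"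
  shows "f \<in> operator_dom D"
proof -
  note f1 = rep2_rep1[OF f]
  have "f \<in> sobolev_tilde T 2" using rep2_facts(1)[OF f] by (simp add: sobolev_tilde_def)
  moreover have "vanishes_at f v" if "v \<in> D" for v
    unfolding vanishes_at_def using D[OF that] rep1_vertex_value[OF f1] by auto
  moreover have "standard_conditions T f v" if v: "v \<in> verts (core T) - D" for v
    unfolding standard_conditions_def continuous_at_vertex_def
  proof (intro conjI ballI)
    show "vertex_value T f e v = vertex_value T f e' v" if "e \<in> incident T v" "e' \<in> incident T v" for e e'
      using c[OF v that] rep1_vertex_value[OF f1 that(1)] rep1_vertex_value[OF f1 that(2)] by simp
    show "(\<Sum>e\<in>incident T v. normal_deriv T f e v) = 0"
      using k[OF v] rep2_normal_deriv[OF f] by simp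
  qed
  ultimately show ?thesis by (simp add: operator_dom_def)
qed

lemma sobolev_1_of_2: "sobolev_tilde T 2 \<subseteq> sobolev_tilde T 1"
  unfolding sobolev_tilde_def edge_sobolev_def by auto

lemma operator_dom_rep:
  assumes "f \<in> operator_dom D" obtains F p q where "rep2 f F p q"
  using sobolev_2_rep2[of f] assms unfolding operator_dom_def by blast

lemma operator_dom_subset: "operator_dom D \<subseteq> form_dom D"
proof
  fix f assume f: "f \<in> operator_dom D"
  obtain F p q where r: "rep2 f F p q" using operator_dom_rep[OF f] .
  have "\<exists>\<phi>. is_cont_rep T e (f e) \<phi>" if "e \<in> edges T" for e
    using r that by (auto simp: rep2_def edge_rep2_def)
  moreover have "continuous_at_vertex T f v" if "v \<in> verts (core T)" for v
  \<comment> \<open>Continuity is not among the conditions imposed on \<open>D\<close>, but there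
    all values are 0 and hence equal.\<close>
  proof (cases "v \<in> D")
    case True
    then have "vanishes_at f v" using f by (simp add: operator_dom_def)
    then show ?thesis by (simp add: vanishes_at_def continuous_at_vertex_def)
  next
    case False
    then show ?thesis using f that by (simp add: operator_dom_def standard_conditions_def)
  qed
  moreover have "f \<in> sobolev_tilde T 1" using f sobolev_1_of_2 by (auto simp: operator_dom_def)
  ultimately show "f \<in> form_dom D"
    using f by (simp add: form_dom_def operator_dom_def H1_def continuous_funs_def)
qed

lemma OU_realisation_rep:
  assumes "rep2 f F p q" "f \<in> W"
    and "\<And>e. e \<in> edges T \<Longrightarrow> g e \<in> borel_measurable (gauss_edge T e)"
    and "\<And>e. e \<in> edges T \<Longrightarrow> AE t in gauss_edge T e. g e t = - (1 / 2) * q e t + of_real (root_dist T e t) * p e t"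
  shows "(f, g) \<in> OU_realisation T W"
proof -
  have "AE t in gauss_edge T e. g e t = OU_expr T f e t" if e: "e \<in> edges T" for e
    using OU_expr_rep(3)[OF assms(1) e] assms(4)[OF e] by eventually_elim simp
  then show ?thesis using assms by (simp add: OU_realisation_def ae_eq_def)
qed

lemma realisation_in_L2:
  assumes "(f, g) \<in> OU_realisation T (operator_dom D)"
  shows "f \<in> L2 T" "g \<in> L2 T"
proof -
  have f: "f \<in> operator_dom D" and g: "\<And>e. e \<in> edges T \<Longrightarrow> g e \<in> borel_measurable (gauss_edge T e)" "ae_eq T g (OU_expr T f)"
    using assms by (auto simp: OU_realisation_def)
  obtain F p q where r: "rep2 f F p q" using operator_dom_rep[OF f] .
  show "f \<in> L2 T" using f by (auto simp: operator_dom_def sobolev_tilde_def edge_sobolev_def L2_def)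
  have "g e \<in> square_int (gauss_edge T e)" if e: "e \<in> edges T" for e
  proof -
    interpret tree_edge T e by (rule tree_edgeI[OF e])
    have "AE t in M. OU_expr T f e t = g e t"
      using g(2)[unfolded ae_eq_def, rule_format, OF e] unfolding gauss_edge_eq by eventually_elim simp
    then show ?thesis using sq_cong_AE[OF OU_expr_rep(2)[OF r e, unfolded gauss_edge_eq] g(1)[OF e, unfolded gauss_edge_eq]]
      unfolding gauss_edge_eq by blast
  qed
  then show "g \<in> L2 T" by (simp add: L2_def)
qed

lemma realisation_inner:
  assumes "(f, g) \<in> OU_realisation T (operator_dom D)" "h \<in> L2 T"
  shows "inner_L2 T g h = inner_L2 T (OU_expr T f) h"
proof (rule inner_L2_cong)
  fix e assume e: "e \<in> edges T"
  have f: "f \<in> operator_dom D" and g: "g e \<in> borel_measurable (gauss_edge T e)" "AE t in gauss_edge T e. g e t = OU_expr T f e t"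
    using assms e by (auto simp: OU_realisation_def ae_eq_def)
  obtain F p q where r: "rep2 f F p q" using operator_dom_rep[OF f] .
  show "g e \<in> borel_measurable (gauss_edge T e) \<and> OU_expr T f e \<in> borel_measurable (gauss_edge T e) \<and> (AE t in gauss_edge T e. g e t = OU_expr T f e t)"
    using g OU_expr_rep(2)[OF r e] square_int_measurable by blast
qed (use assms(2) L2D square_int_measurable in auto)

text \<open>Each vertex term of Green's formula vanishes: on \<open>D\<close> because
  \<open>h\<close> does, elsewhere because the common value of \<open>h\<close> factors out and
  leaves the sum of normal derivatives of \<open>f\<close>.\<close>

lemma realisation_subset_associated:
  "OU_realisation T (operator_dom D) \<subseteq> associated_op T (OU_form T) (form_dom D)"
proof (rule subrelI)
  fix f g assume fg: "(f, g) \<in> OU_realisation T (operator_dom D)"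
  then have f: "f \<in> operator_dom D" by (simp add: OU_realisation_def)
  obtain F p q where r: "rep2 f F p q" using operator_dom_rep[OF f] .
  have "OU_form T f h = inner_L2 T g h" if h: "h \<in> form_dom D" for h
  proof -
    have hs: "h \<in> sobolev_tilde T 1" "h \<in> continuous_funs T" using h by (simp_all add: form_dom_def H1_def)
    then have hL: "h \<in> L2 T" by (simp add: sobolev_tilde_def edge_sobolev_def L2_def)
    obtain H where rh: "rep1 h H (wderiv T 1 h)" using sobolev_1_rep1[OF hs(1)] .
    have "(\<Sum>e\<in>incident T v. outward T (p e) e v * cnj (H e (end_coord T e v))) = 0" if v: "v \<in> verts (core T)" for v
    proof (cases "v \<in> D")
      case True
      then have "H e (end_coord T e v) = 0" if "e \<in> incident T v" for e
        using h that rep1_vertex_value[OF rh that] by (simp add: form_dom_def vanishes_at_def)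
      then show ?thesis by simp
    next
      case False
      show ?thesis
      proof (cases "incident T v = {}")
        case False
        then obtain e0 where e0: "e0 \<in> incident T v" by blast
        have "H e (end_coord T e v) = H e0 (end_coord T e0 v)" if "e \<in> incident T v" for e
          using hs(2) v that e0 unfolding rep1_vertex_value[OF rh that, symmetric] rep1_vertex_value[OF rh e0, symmetric]
            continuous_funs_def continuous_at_vertex_def by blast
        then have "(\<Sum>e\<in>incident T v. outward T (p e) e v * cnj (H e (end_coord T e v)))
            = (\<Sum>e\<in>incident T v. normal_deriv T f e v) * cnj (H e0 (end_coord T e0 v))"
          unfolding sum_distrib_right by (intro sum.cong refl) (simp add: rep2_normal_deriv[OF r])
        also have "(\<Sum>e\<in>incident T v. normal_deriv T f e v) = 0"
          using f v \<open>v \<notin> D\<close> by (simp add: operator_dom_def standard_conditions_def)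
        finally show ?thesis by simp
      qed simp
    qed
    then have "boundary_form p H = 0" by (simp add: boundary_form_def)
    then show ?thesis using green_formula_tree[OF r rh] realisation_inner[OF fg hL] by simp
  qed
  then show "(f, g) \<in> associated_op T (OU_form T) (form_dom D)"
    using f operator_dom_subset realisation_in_L2[OF fg] by (auto simp: associated_op_def)
qed

definition on_edge :: "'e \<Rightarrow> (real \<Rightarrow> complex) \<Rightarrow> 'e tree_fun" where
  "on_edge e h = (\<lambda>e'. if e' = e then h else (\<lambda>_. 0))"

lemma on_edge_rep:
  assumes e: "e \<in> edges T" and h: "ac_deriv (closed_edge T e) h p" "ac_deriv (closed_edge T e) p q"
    "h \<in> square_int (gauss_edge T e)" "p \<in> square_int (gauss_edge T e)" "q \<in> square_int (gauss_edge T e)"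
  shows "rep2 (on_edge e h) (on_edge e h) (on_edge e p) (on_edge e q)"
proof -
  have "edge_rep2 e' (\<lambda>_. 0) (\<lambda>_. 0) (\<lambda>_. 0) (\<lambda>_. 0)" for e'
    by (simp add: edge_rep2_def ac_deriv_const is_cont_rep_def square_int_def)
  moreover have "is_cont_rep T e h h"
  proof -
    interpret tree_edge T e by (rule tree_edgeI[OF e])
    show ?thesis using ac_deriv_continuous[OF h(1)[unfolded closed_edge_eq]] by (simp add: is_cont_rep_eq cont_rep_def)
  qed
  then have "edge_rep2 e h h p q" using h square_int_measurable by (simp add: edge_rep2_def)
  ultimately show ?thesis by (simp add: rep2_def on_edge_def)
qed

section \<open>The adjoint operator\<close>

lemma inner_on_edge:
  assumes "e \<in> edges T"
  shows "inner_L2 T (on_edge e h) g = (LINT t|gauss_edge T e. h t * cnj (g e t))"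
  unfolding inner_L2_def by (subst sum.remove[OF finite_edges assms]) (simp add: sum.neutral on_edge_def)

text \<open>All values and normal derivatives at the vertices are zero, which satisfies the
  conditions for every \<open>D\<close>.\<close>

lemma compactly_supported_in_operator_dom:
  assumes r: "rep2 f h p q"
    and z: "\<And>e t. e \<in> edges T \<Longrightarrow> t \<notin> open_edge T e \<Longrightarrow> h e t = 0 \<and> p e t = 0"
  shows "f \<in> operator_dom D"
proof -
  have v: "h e (end_coord T e v) = 0" "outward T (p e) e v = 0" if i: "e \<in> incident T v" for e v
  proof -
    have e: "e \<in> edges T" using i incident_edges by blast
    interpret tree_edge T e by (rule tree_edgeI[OF e])
    show "h e (end_coord T e v) = 0" using z[OF e] end_coord_not_in_I(1)[OF i] open_edge_eq by blast
    show "outward T (p e) e v = 0"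
      using z[OF e] end_coord_not_in_I(2)[OF i] boundary_not_in_I(1) unfolding outward_def open_edge_eq by simp
  qed
  show ?thesis by (rule operator_domI[OF r]) (use v in \<open>auto intro: sum.neutral\<close>)
qed

lemma test_on_edge:
  assumes e: "e \<in> edges T" and \<phi>: "\<phi> \<in> test_functions (open_edge T e)"
  shows "rep2 (on_edge e (\<lambda>t. of_real (\<phi> t))) (on_edge e (\<lambda>t. of_real (\<phi> t)))
      (on_edge e (\<lambda>t. of_real (deriv \<phi> t))) (on_edge e (\<lambda>t. of_real (deriv (deriv \<phi>) t)))" (is ?rep)
    and "on_edge e (\<lambda>t. of_real (\<phi> t)) \<in> operator_dom D"
proof -
  interpret tree_edge T e by (rule tree_edgeI[OF e])
  note \<phi> = \<phi>[unfolded open_edge_eq]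
  note \<phi>' = test_deriv[OF \<phi>] note \<phi>'' = test_deriv[OF \<phi>']
  show r: ?rep
    by (rule on_edge_rep[OF e]) (unfold closed_edge_eq gauss_edge_eq, (intro test_ac_deriv test_sq \<phi> \<phi>' \<phi>'')+)
  show "on_edge e (\<lambda>t. of_real (\<phi> t)) \<in> operator_dom D"
    by (rule compactly_supported_in_operator_dom[OF r])
      (auto simp: open_edge_eq on_edge_def test_zero_outside[OF \<phi>] test_zero_outside[OF \<phi>'])
qed

text \<open>Test functions supported in \<open>e\<close> belong to the operator domain, so the
  adjoint relation contains the weak equation on \<open>e\<close>; \<open>adjoint_regularity\<close>
  does the rest.\<close>

lemma adjoint_on_edge:
  assumes gk: "(g, k) \<in> adjoint_op T (OU_realisation T (operator_dom D))" and e: "e \<in> edges T"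
  shows "\<exists>F p q. edge_rep2 e (g e) F p q \<and> (\<forall>t. k e t = - (1 / 2) * q t + of_real (root_dist T e t) * p t)"
proof -
  interpret tree_edge T e by (rule tree_edgeI[OF e])
  have L: "g \<in> L2 T" "k \<in> L2 T" and adj: "\<And>f f'. (f, f') \<in> OU_realisation T (operator_dom D) \<Longrightarrow> inner_L2 T f' g = inner_L2 T f k"
    using gk by (auto simp: adjoint_op_def)
  have sq: "g e \<in> sq" "k e \<in> sq" using L2D[OF L(1) e] L2D[OF L(2) e] unfolding gauss_edge_eq .
  have weak: "(LINT t:I|lborel. (- 1 / 2 * deriv (deriv \<phi>) t + (vertex_dist T (start T e) + t) * deriv \<phi> t) *\<^sub>R (of_real (G t) * g e t))
      = (LINT t:I|lborel. \<phi> t *\<^sub>R (of_real (G t) * k e t))" if \<phi>: "\<phi> \<in> test_functions I" for \<phi>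
  proof -
    note \<phi>' = test_deriv[OF \<phi>] note \<phi>'' = test_deriv[OF \<phi>']
    let ?\<psi> = "\<lambda>t. - 1 / 2 * deriv (deriv \<phi>) t + (vertex_dist T (start T e) + t) * deriv \<phi> t"
    let ?f = "on_edge e (\<lambda>t. complex_of_real (\<phi> t))" and ?f' = "on_edge e (\<lambda>t. complex_of_real (?\<psi> t))"
    note r = test_on_edge[OF e \<phi>[folded open_edge_eq]]
    have "(?f, ?f') \<in> OU_realisation T (operator_dom D)"
    proof (rule OU_realisation_rep[OF r])
      fix e' assume "e' \<in> edges T"
      have "continuous_on J (\<lambda>t. complex_of_real (?\<psi> t))"
        by (intro continuous_on_of_real continuous_intros smooth_continuous_on test_smooth \<phi>' \<phi>'')
      from continuous_measurable[OF this] show "?f' e' \<in> borel_measurable (gauss_edge T e')"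
        by (simp add: gauss_edge_eq on_edge_def del: of_real_add of_real_mult)
      show "AE t in gauss_edge T e'. ?f' e' t = - (1 / 2) * on_edge e (\<lambda>t. complex_of_real (deriv (deriv \<phi>) t)) e' t +
          of_real (root_dist T e' t) * on_edge e (\<lambda>t. complex_of_real (deriv \<phi> t)) e' t"
        by (simp add: root_dist_def on_edge_def)
    qed
    from adj[OF this] have "(LINT t|M. complex_of_real (?\<psi> t) * cnj (g e t)) = (LINT t|M. complex_of_real (\<phi> t) * cnj (k e t))"
      unfolding inner_on_edge[OF e] gauss_edge_eq .
    \<comment> \<open>\<open>inner_L2\<close> conjugates its second argument and the test functions
      are real, so the wanted equation appears conjugated on both sides.\<close>
    then show ?thesis unfolding weighted_test_integral by (rule complex_cnj_cancel_iff[THEN iffD1])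
  qed
  obtain F p q where "ac_deriv J F p" "ac_deriv J p q" "AE t in M. F t = g e t" "F \<in> sq" "p \<in> sq" "q \<in> sq"
    "\<And>t. k e t = - (1 / 2) * q t + of_real (vertex_dist T (start T e) + t) * p t"
    using adjoint_regularity[OF sq weak] by blast
  then show ?thesis
    using ac_deriv_continuous[of F p] square_int_measurable[OF sq(1)]
    unfolding edge_rep2_def closed_edge_eq gauss_edge_eq is_cont_rep_eq cont_rep_def root_dist_def by blast
qed

lemma adjoint_rep:
  assumes gk: "(g, k) \<in> adjoint_op T (OU_realisation T (operator_dom D))"
  obtains F p q where "rep2 g F p q"
    "\<And>e t. e \<in> edges T \<Longrightarrow> k e t = - (1 / 2) * q e t + of_real (root_dist T e t) * p e t"
  using rep2_choice[of g "\<lambda>e F p q. \<forall>t. k e t = - (1 / 2) * q t + of_real (root_dist T e t) * p t", OF adjoint_on_edge[OF gk]]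
  by metis

lemma tree_boundary_data:
  fixes \<alpha> \<beta> :: "'e \<Rightarrow> 'v \<Rightarrow> complex"
  obtains f p q where "rep2 f f p q"
    "\<And>e v. e \<in> incident T v \<Longrightarrow> f e (end_coord T e v) = \<alpha> e v"
    "\<And>e v. e \<in> incident T v \<Longrightarrow> outward T (p e) e v = \<beta> e v"
proof -
  let ?Q = "\<lambda>e u p (q :: real \<Rightarrow> complex). \<forall>v. e \<in> incident T v \<longrightarrow> u (end_coord T e v) = \<alpha> e v \<and> outward T p e v = \<beta> e v"
  have ex: "\<exists>u p q. edge_rep2 e u u p q \<and> ?Q e u p q" if e: "e \<in> edges T" for e
  proof -
    interpret tree_edge T e by (rule tree_edgeI[OF e])
    let ?s = "start T e" and ?h = "head (core T) e"
    \<comment> \<open>At the head of an arc the outward derivative is \<open>- p\<close>, whence the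
      sign of the last datum.\<close>
    obtain F p q where F: "ac_deriv J F p" "ac_deriv J p q" "F \<in> sq" "p \<in> sq" "q \<in> sq"
      "F 0 = \<alpha> e ?s" "p 0 = \<beta> e ?s" "e \<notin> halflines T \<Longrightarrow> F (len T e) = \<alpha> e ?h" "e \<notin> halflines T \<Longrightarrow> p (len T e) = - \<beta> e ?h"
      using boundary_data[of "\<alpha> e ?s" "\<beta> e ?s" "\<alpha> e ?h" "- \<beta> e ?h"] by blast
    have "F (end_coord T e v) = \<alpha> e v \<and> outward T p e v = \<beta> e v" if i: "e \<in> incident T v" for v
    proof (cases "start T e = v")
      case True then show ?thesis using F by (simp add: end_coord_def outward_def)
    next
      case False
      then have a: "e \<in> arcs (core T)" "head (core T) e = v" using i by (simp_all add: incident_def)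
      then have "e \<notin> halflines T" using halflines_disjoint by blast
      then show ?thesis using F(8,9) a False by (simp add: end_coord_def outward_def)
    qed
    moreover have "cont_rep F F" using ac_deriv_continuous[OF F(1)] by (simp add: cont_rep_def)
    ultimately show ?thesis
      using F(1-5) square_int_measurable[OF F(3)]
      unfolding edge_rep2_def closed_edge_eq gauss_edge_eq is_cont_rep_eq by blast
  qed
  obtain f p q where "rep2 f f p q" "\<And>e. e \<in> edges T \<Longrightarrow> ?Q e (f e) (p e) (q e)"
    using rep2_choice_self[of ?Q, OF ex] by blast
  then show ?thesis using that incident_edges by blast
qed

section \<open>Recovering the vertex conditions from the adjoint relation\<close>

lemma cnj_form: "OU_form T g f = cnj (OU_form T f g)"
  unfolding OU_form_def by (subst inner_L2_commute) simp

text \<open>Green's formula is applied to the pair \<open>f\<close>, \<open>g\<close> in both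
  orders. By symmetry of the form and the adjoint relation everything cancels except the boundary
  terms, an identity in the values \<open>\<alpha>\<close> and normal derivatives
  \<open>\<beta>\<close> of \<open>f\<close>. Varying \<open>\<beta>\<close> gives the conditions on
  the values of \<open>g\<close>, varying \<open>\<alpha>\<close> those on its normal
  derivatives.\<close>

theorem adjoint_subset_realisation:
  assumes D: "D \<subseteq> verts (core T)"
  shows "adjoint_op T (OU_realisation T (operator_dom D)) \<subseteq> OU_realisation T (operator_dom D)"
proof (rule subrelI)
  fix g k assume gk: "(g, k) \<in> adjoint_op T (OU_realisation T (operator_dom D))"
  then have L: "g \<in> L2 T" "k \<in> L2 T" and adj: "\<And>f f'. (f, f') \<in> OU_realisation T (operator_dom D) \<Longrightarrow> inner_L2 T f' g = inner_L2 T f k"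
    by (auto simp: adjoint_op_def)
  obtain F p q where r: "rep2 g F p q"
    and k: "\<And>e t. e \<in> edges T \<Longrightarrow> k e t = - (1 / 2) * q e t + of_real (root_dist T e t) * p e t"
    using adjoint_rep[OF gk] by blast
  note r1 = rep2_rep1[OF r]
  have test: "(\<Sum>v\<in>verts (core T). weight v * (\<Sum>e\<in>incident T v. \<beta> e v * cnj (F e (end_coord T e v)) - \<alpha> e v * cnj (outward T (p e) e v))) = 0"
    if D0: "\<And>e v. v \<in> D \<Longrightarrow> e \<in> incident T v \<Longrightarrow> \<alpha> e v = 0"
      and c: "\<And>v e e'. v \<in> verts (core T) - D \<Longrightarrow> e \<in> incident T v \<Longrightarrow> e' \<in> incident T v \<Longrightarrow> \<alpha> e v = \<alpha> e' v"
      and kir: "\<And>v. v \<in> verts (core T) - D \<Longrightarrow> (\<Sum>e\<in>incident T v. \<beta> e v) = 0"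
    for \<alpha> \<beta> :: "'e \<Rightarrow> 'v \<Rightarrow> complex"
  proof -
    obtain f p' q' where f: "rep2 f f p' q'" "\<And>e v. e \<in> incident T v \<Longrightarrow> f e (end_coord T e v) = \<alpha> e v"
      "\<And>e v. e \<in> incident T v \<Longrightarrow> outward T (p' e) e v = \<beta> e v"
      using tree_boundary_data[of \<alpha> \<beta>] by blast
    note f1 = rep2_rep1[OF f(1)]
    have dom: "f \<in> operator_dom D"
    proof (rule operator_domI[OF f(1)])
      show "f e (end_coord T e v) = 0" if "v \<in> D" "e \<in> incident T v" for v e using f(2)[OF that(2)] D0[OF that] by simp
      show "f e (end_coord T e v) = f e' (end_coord T e' v)" if "v \<in> verts (core T) - D" "e \<in> incident T v" "e' \<in> incident T v" for v e e'
        using f(2)[OF that(2)] f(2)[OF that(3)] c[OF that] by simp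
      show "(\<Sum>e\<in>incident T v. outward T (p' e) e v) = 0" if "v \<in> verts (core T) - D" for v
        using f(3) kir[OF that] by simp
    qed
    have fA: "(f, OU_expr T f) \<in> OU_realisation T (operator_dom D)"
      using dom OU_expr_rep(2)[OF f(1)] square_int_measurable by (auto simp: OU_realisation_def ae_eq_def)
    have fL: "f \<in> L2 T" using realisation_in_L2(1)[OF fA] .
    have "inner_L2 T k f = inner_L2 T (OU_expr T g) f"
    proof (rule inner_L2_cong)
      fix e assume e: "e \<in> edges T"
      show "k e \<in> borel_measurable (gauss_edge T e) \<and> OU_expr T g e \<in> borel_measurable (gauss_edge T e) \<and> (AE t in gauss_edge T e. k e t = OU_expr T g e t)"
        using L2D[OF L(2) e] OU_expr_rep(2,3)[OF r e] square_int_measurable k[OF e] by (auto elim: eventually_mono)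
    qed (use fL L2D square_int_measurable in auto)
    then have "cnj (inner_L2 T (OU_expr T g) f) = inner_L2 T f k"
      unfolding inner_L2_commute[where g=f and f=k] by (rule arg_cong[OF sym])
    moreover have "OU_form T f g = inner_L2 T (OU_expr T f) g - 1 / 2 * boundary_form p' F" by (rule green_formula_tree[OF f(1) r1])
    moreover have "cnj (OU_form T f g) = inner_L2 T (OU_expr T g) f - 1 / 2 * boundary_form p f"
      unfolding cnj_form[symmetric] by (rule green_formula_tree[OF r f1])
    \<comment> \<open>The two Green formulas in abstract form: the operator terms cancel and the
      boundary terms remain.\<close>
    moreover have "X = cnj Y" if "cnj Z = W" "V = X' - 1 / 2 * X" "cnj V = Z - 1 / 2 * Y" "X' = W" for X Y Z V W X' :: complex
    proof -
      have "V = cnj Z - 1 / 2 * cnj Y" using arg_cong[OF that(3), of cnj] by simp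
      then show ?thesis using that by simp
    qed
    ultimately have "boundary_form p' F = cnj (boundary_form p f)" using adj[OF fA] by blast
    moreover have "boundary_form p' F = (\<Sum>v\<in>verts (core T). weight v * (\<Sum>e\<in>incident T v. \<beta> e v * cnj (F e (end_coord T e v))))"
      unfolding boundary_form_def by (simp add: f(3))
    moreover have "cnj (boundary_form p f) = (\<Sum>v\<in>verts (core T). weight v * (\<Sum>e\<in>incident T v. \<alpha> e v * cnj (outward T (p e) e v)))"
      unfolding boundary_form_def by (simp add: f(2) weight_def mult.commute)
    ultimately show ?thesis by (simp add: sum_subtractf right_diff_distrib)
  qed
  \<comment> \<open>Data supported at one vertex separate the conditions at the different vertices.\<close>
  have at_vertex: "(\<Sum>e\<in>incident T v. \<beta> e * cnj (F e (end_coord T e v)) - \<alpha> * cnj (outward T (p e) e v)) = 0"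
    if v: "v \<in> verts (core T)" and z: "v \<in> D \<Longrightarrow> \<alpha> = 0" "v \<notin> D \<Longrightarrow> (\<Sum>e\<in>incident T v. \<beta> e) = 0" for v \<alpha> \<beta>
  proof -
    let ?S = "\<lambda>w. \<Sum>e\<in>incident T w. (if w = v then \<beta> e else 0) * cnj (F e (end_coord T e w)) - (if w = v then \<alpha> else 0) * cnj (outward T (p e) e w)"
    have "0 = (\<Sum>w\<in>verts (core T). weight w * ?S w)"
    proof (rule test[symmetric])
      show "(\<Sum>e\<in>incident T w. if w = v then \<beta> e else 0) = 0" if "w \<in> verts (core T) - D" for w
        using z(2) that by (cases "w = v") auto
    qed (use z(1) in auto)
    also have "\<dots> = weight v * ?S v"
      by (subst sum.remove[OF _ v]) (auto intro!: sum.neutral)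
    finally show ?thesis using weight_nonzero[of v] by simp
  qed
  have "g \<in> operator_dom D"
  proof (rule operator_domI[OF r])
    fix v e assume v: "v \<in> D" and e: "e \<in> incident T v"
    have "v \<in> verts (core T)" using v D by blast
    \<comment> \<open>On \<open>D\<close> the normal derivatives of the test function are free, so a
      single one isolates the value of \<open>g\<close> on the edge \<open>e\<close>.\<close>
    from at_vertex[OF this, of 0 "\<lambda>e'. if e' = e then 1 else 0"] v
    have "(\<Sum>e'\<in>incident T v. (if e' = e then 1 else 0) * cnj (F e' (end_coord T e' v))) = 0" by simp
    then show "F e (end_coord T e v) = 0"
      using e by (simp add: if_distrib[of "\<lambda>x. x * _"] sum.delta finite_incident cong: if_cong)
  next
    fix v e e' assume v: "v \<in> verts (core T) - D" and e: "e \<in> incident T v" "e' \<in> incident T v"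
    \<comment> \<open>Off \<open>D\<close> the normal derivatives must sum to zero; two opposite
      ones compare the values of \<open>g\<close> on two edges.\<close>
    let ?\<beta> = "\<lambda>i. (if i = e then 1 else 0) - (if i = e' then 1 else 0) :: complex"
    have "(\<Sum>i\<in>incident T v. ?\<beta> i) = 0"
      using e by (simp add: sum_subtractf sum.delta finite_incident)
    then have "(\<Sum>i\<in>incident T v. ?\<beta> i * cnj (F i (end_coord T i v))) = 0"
      using at_vertex[of v 0 ?\<beta>] v by simp
    then show "F e (end_coord T e v) = F e' (end_coord T e' v)"
      using e by (simp add: left_diff_distrib sum_subtractf if_distrib[of "\<lambda>x. x * _"] sum.delta finite_incident cong: if_cong)
  next
    fix v assume v: "v \<in> verts (core T) - D"
    \<comment> \<open>Value 1 on all edges at the vertex and no normal derivative leaves exactly the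
      sum of the normal derivatives of \<open>g\<close>.\<close>
    then have "cnj (\<Sum>e\<in>incident T v. outward T (p e) e v) = 0"
      using at_vertex[of v 1 "\<lambda>_. 0"] by (simp add: sum_negf)
    then show "(\<Sum>e\<in>incident T v. outward T (p e) e v) = 0" by (simp only: complex_cnj_zero_iff)
  qed
  then show "(g, k) \<in> OU_realisation T (operator_dom D)"
    by (rule OU_realisation_rep[OF r]) (use L2D[OF L(2)] square_int_measurable k in auto)
qed

lemma associated_subset_adjoint:
  "associated_op T (OU_form T) (form_dom D) \<subseteq> adjoint_op T (OU_realisation T (operator_dom D))"
proof (rule subrelI)
  fix f g assume fg: "(f, g) \<in> associated_op T (OU_form T) (form_dom D)"
  have f: "f \<in> form_dom D" "g \<in> L2 T" "\<And>h. h \<in> form_dom D \<Longrightarrow> OU_form T f h = inner_L2 T g h"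
    using fg by (auto simp: associated_op_def)
  have "f \<in> L2 T" using f(1) by (simp add: form_dom_def H1_def sobolev_tilde_def edge_sobolev_def L2_def)
  moreover have "inner_L2 T h' f = inner_L2 T h g" if h: "(h, h') \<in> OU_realisation T (operator_dom D)" for h h'
  proof -
    have "(h, h') \<in> associated_op T (OU_form T) (form_dom D)" using h realisation_subset_associated by blast
    then have "h \<in> form_dom D" "OU_form T h f = inner_L2 T h' f" using f(1) by (auto simp: associated_op_def)
    then show ?thesis using f(3)[of h] cnj_form[of h f] inner_L2_commute[of g h] by simp
  qed
  ultimately show "(f, g) \<in> adjoint_op T (OU_realisation T (operator_dom D))"
    using f(2) by (auto simp: adjoint_op_def)
qed

section \<open>Density, single-valuedness and self-adjointness\<close>

lemma realisation_dense: "densely_defined T (OU_realisation T (operator_dom D))"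
  unfolding densely_defined_def
proof (intro ballI allI impI)
  fix f and \<epsilon> :: real assume f: "f \<in> L2 T" and \<epsilon>: "0 < \<epsilon>"
  \<comment> \<open>An equal share of \<open>\<epsilon>\<^sup>2\<close> for each edge; the summand 1
    makes the final inequality strict.\<close>
  define \<delta> where "\<delta> = \<epsilon>\<^sup>2 / (real (card (edges T)) + 1)"
  have \<delta>: "\<delta> > 0" using \<epsilon> by (simp add: \<delta>_def add_nonneg_pos)
  let ?Q = "\<lambda>e u p (q :: real \<Rightarrow> complex). (\<forall>t. t \<notin> open_edge T e \<longrightarrow> u t = 0 \<and> p t = 0) \<and>
      (LINT t|gauss_edge T e. (cmod (f e t - u t))\<^sup>2) < \<delta>"
  have ex: "\<exists>u p q. edge_rep2 e u u p q \<and> ?Q e u p q" if e: "e \<in> edges T" for e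
  proof -
    interpret tree_edge T e by (rule tree_edgeI[OF e])
    have "f e \<in> sq" using L2D[OF f e] unfolding gauss_edge_eq .
    from test_functions_dense[OF this] \<delta> obtain h where h: "h \<in> test_complex" "(LINT t|M. (cmod (f e t - h t))\<^sup>2) < \<delta>"
      unfolding approximable_def by blast
    obtain p q where pq: "ac_deriv J h p" "ac_deriv J p q" "h \<in> sq" "p \<in> sq" "q \<in> sq"
      "\<And>t. t \<notin> I \<Longrightarrow> h t = 0" "\<And>t. t \<notin> I \<Longrightarrow> p t = 0" using test_complex_rep[OF h(1)] by blast
    moreover have "cont_rep h h" using ac_deriv_continuous[OF pq(1)] by (simp add: cont_rep_def)
    ultimately show ?thesis
      unfolding edge_rep2_def closed_edge_eq gauss_edge_eq is_cont_rep_eq open_edge_eq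
      using h(2) square_int_measurable[OF pq(3)] by blast
  qed
  obtain h p q where r: "rep2 h h p q" and h: "\<And>e. e \<in> edges T \<Longrightarrow> ?Q e (h e) (p e) (q e)"
    using rep2_choice_self[of ?Q, OF ex] by blast
  have "h \<in> operator_dom D"
    by (rule compactly_supported_in_operator_dom[OF r]) (use h in blast)
  then have "(h, OU_expr T h) \<in> OU_realisation T (operator_dom D)"
    using OU_expr_rep(2)[OF r] square_int_measurable by (auto simp: OU_realisation_def ae_eq_def)
  moreover have "norm_L2 T (\<lambda>e t. f e t - h e t) < \<epsilon>"
  proof -
    have "inner_L2 T (\<lambda>e t. f e t - h e t) (\<lambda>e t. f e t - h e t)
        = (\<Sum>e\<in>edges T. of_real (LINT t|gauss_edge T e. (cmod (f e t - h e t))\<^sup>2))"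
      unfolding inner_L2_def complex_norm_square[symmetric] integral_complex_of_real[symmetric] ..
    then have "Re (inner_L2 T (\<lambda>e t. f e t - h e t) (\<lambda>e t. f e t - h e t))
        = (\<Sum>e\<in>edges T. LINT t|gauss_edge T e. (cmod (f e t - h e t))\<^sup>2)" by simp
    also have "\<dots> \<le> (\<Sum>e\<in>edges T. \<delta>)" by (rule sum_mono) (use h in \<open>auto intro: less_imp_le\<close>)
    also have "\<dots> = real (card (edges T)) * \<delta>" by simp
    also have "\<dots> < (real (card (edges T)) + 1) * \<delta>" using \<delta> by (simp add: distrib_right)
    also have "\<dots> = \<epsilon>\<^sup>2" by (simp add: \<delta>_def add_nonneg_pos less_imp_neq[symmetric])
    finally show ?thesis unfolding norm_L2_def using \<epsilon> real_sqrt_less_mono by fastforce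
  qed
  ultimately show "\<exists>h\<in>Domain (OU_realisation T (operator_dom D)). norm_L2 T (\<lambda>e t. f e t - h e t) < \<epsilon>"
    by (intro bexI[of _ h]) auto
qed

lemma inner_L2_lincomb:
  assumes "h \<in> L2 T" "f \<in> L2 T" "f' \<in> L2 T"
  shows "inner_L2 T h (\<lambda>e t. a * f e t + b * f' e t) = cnj a * inner_L2 T h f + cnj b * inner_L2 T h f'"
  unfolding inner_L2_def sum_distrib_left sum.distrib[symmetric]
proof (rule sum.cong[OF refl])
  fix e assume e: "e \<in> edges T"
  interpret tree_edge T e by (rule tree_edgeI[OF e])
  have i: "integrable M (\<lambda>t. h e t * cnj (f e t))" "integrable M (\<lambda>t. h e t * cnj (f' e t))"
    using assms[THEN L2D[OF _ e]] unfolding gauss_edge_eq by (auto intro: sq_mult_cnj_integrable)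
  have "h e t * cnj (a * f e t + b * f' e t) = cnj a * (h e t * cnj (f e t)) + cnj b * (h e t * cnj (f' e t))" for t
    by (simp add: algebra_simps)
  then show "(LINT t|gauss_edge T e. h e t * cnj (a * f e t + b * f' e t))
      = cnj a * (LINT t|gauss_edge T e. h e t * cnj (f e t)) + cnj b * (LINT t|gauss_edge T e. h e t * cnj (f' e t))"
    unfolding gauss_edge_eq using i by simp
qed

lemma L2_lincomb:
  assumes "f \<in> L2 T" "f' \<in> L2 T" shows "(\<lambda>e t. a * f e t + b * f' e t) \<in> L2 T"
proof -
  have "(\<lambda>t. a * f e t + b * f' e t) \<in> square_int (gauss_edge T e)" if e: "e \<in> edges T" for e
  proof -
    interpret tree_edge T e by (rule tree_edgeI[OF e])
    show ?thesis using assms[THEN L2D[OF _ e]] unfolding gauss_edge_eq by (intro sq_add sq_cmult)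
  qed
  then show ?thesis by (simp add: L2_def)
qed

lemma L2_zero: "(\<lambda>e t. 0) \<in> L2 T"
  by (simp add: L2_def square_int_def)

text \<open>Supplies single-valuedness of the operator: two images of the same function have the
  same inner products with the domain. Test functions on one edge suffice, by the fundamental
  lemma.\<close>

lemma orthogonal_to_operator_dom:
  assumes u: "u \<in> L2 T" and orth: "\<And>h. h \<in> Domain (OU_realisation T (operator_dom D)) \<Longrightarrow> inner_L2 T h u = 0"
    and e: "e \<in> edges T"
  shows "AE t in gauss_edge T e. u e t = 0"
proof -
  interpret tree_edge T e by (rule tree_edgeI[OF e])
  have us: "u e \<in> sq" using L2D[OF u e] unfolding gauss_edge_eq .
  have Gu: "locally_integrable I (\<lambda>t. of_real (G t) * u e t)"
    unfolding locally_integrable_def using G_mult_sq_set_integrable[OF us] I_subset_J by blast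
  have "AE t in lborel. t \<in> I \<longrightarrow> of_real (G t) * u e t = 0"
  proof (rule fundamental_lemma[OF Gu])
    fix \<phi> assume \<phi>: "\<phi> \<in> test_functions I"
    let ?f = "on_edge e (\<lambda>t. complex_of_real (\<phi> t))"
    note r = test_on_edge[OF e \<phi>[folded open_edge_eq]]
    have "(?f, OU_expr T ?f) \<in> OU_realisation T (operator_dom D)"
      using r(2) OU_expr_rep(2)[OF r(1)] square_int_measurable by (auto simp: OU_realisation_def ae_eq_def)
    from orth[OF DomainI[OF this]] have "(LINT t|M. of_real (\<phi> t) * cnj (u e t)) = 0"
      unfolding inner_on_edge[OF e] gauss_edge_eq .
    then show "(LINT t:I|lborel. \<phi> t *\<^sub>R (of_real (G t) * u e t)) = 0"
      unfolding weighted_test_integral by (rule complex_cnj_zero_iff[THEN iffD1])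
  qed
  then show ?thesis unfolding gauss_edge_eq AE_M
    by eventually_elim (use G_pos in \<open>auto simp: less_imp_neq[symmetric]\<close>)
qed

theorem associated_op_eq_realisation:
  assumes D: "D \<subseteq> verts (core T)"
  shows "associated_op T (OU_form T) (form_dom D) = OU_realisation T (operator_dom D)"
    and "adjoint_op T (OU_realisation T (operator_dom D)) = OU_realisation T (operator_dom D)"
  using realisation_subset_associated associated_subset_adjoint adjoint_subset_realisation[OF D] by blast+

text \<open>Since the operator equals its adjoint, membership is a statement about inner products
  alone. Invariance under almost everywhere equality and linearity are thus inherited from
  \<open>inner_L2\<close>, without returning to weak derivatives or vertex conditions.\<close>

theorem self_adjoint_realisation:
  assumes D: "D \<subseteq> verts (core T)"
  shows "self_adjoint T (OU_realisation T (operator_dom D))"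
proof -
  let ?A = "OU_realisation T (operator_dom D)"
  have adj: "adjoint_op T ?A = ?A" by (rule associated_op_eq_realisation(2)[OF D])
  have AI: "(f, g) \<in> ?A"
    if "f \<in> L2 T" "g \<in> L2 T" "\<And>h h'. (h, h') \<in> ?A \<Longrightarrow> inner_L2 T h' f = inner_L2 T h g" for f g
    by (subst adj[symmetric]) (use that in \<open>auto simp: adjoint_op_def\<close>)
  have AD: "inner_L2 T h' f = inner_L2 T h g" if "(f, g) \<in> ?A" "(h, h') \<in> ?A" for f g h h'
    using that(1) that(2) by (subst (asm) (1) adj[symmetric]) (auto simp: adjoint_op_def)
  note L = realisation_in_L2
  have "(\<lambda>e t. 0, \<lambda>e t. 0) \<in> ?A"
    by (rule AI[OF L2_zero L2_zero]) (simp add: inner_L2_def)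
  moreover have "?A \<subseteq> L2 T \<times> L2 T" using L by (auto simp: subset_iff)
  moreover have "(f', g') \<in> ?A"
    if fg: "(f, g) \<in> ?A" and L': "f' \<in> L2 T" "g' \<in> L2 T" and ae: "ae_eq T f f'" "ae_eq T g g'" for f g f' g'
  proof (rule AI[OF L'])
    fix h h' assume h: "(h, h') \<in> ?A"
    have "inner_L2 T h' f = inner_L2 T h' f'" "inner_L2 T h g = inner_L2 T h g'"
      by (rule inner_L2_cong; use L[OF fg] L[OF h] L' ae L2D square_int_measurable in \<open>auto simp: ae_eq_def\<close>)+
    then show "inner_L2 T h' f' = inner_L2 T h g'" using AD[OF fg h] by simp
  qed
  moreover have "ae_eq T g g'" if fg: "(f, g) \<in> ?A" "(f, g') \<in> ?A" for f g g'
    unfolding ae_eq_def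
  proof
    fix e assume e: "e \<in> edges T"
    have "AE t in gauss_edge T e. 1 * g e t + (- 1) * g' e t = 0"
    proof (rule orthogonal_to_operator_dom[where u="\<lambda>e t. 1 * g e t + (- 1) * g' e t", OF _ _ e])
      show "(\<lambda>e t. 1 * g e t + (- 1) * g' e t) \<in> L2 T" by (rule L2_lincomb[OF L(2)[OF fg(1)] L(2)[OF fg(2)]])
      fix h assume "h \<in> Domain ?A"
      then obtain h' where h: "(h, h') \<in> ?A" by blast
      have "inner_L2 T h g = inner_L2 T h g'" using AD[OF fg(1) h] AD[OF fg(2) h] by simp
      then show "inner_L2 T h (\<lambda>e t. 1 * g e t + (- 1) * g' e t) = 0"
        using inner_L2_lincomb[OF L(1)[OF h] L(2)[OF fg(1)] L(2)[OF fg(2)], of 1 "- 1"] by simp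
    qed
    then show "AE t in gauss_edge T e. g e t = g' e t" by eventually_elim simp
  qed
  moreover have "(\<lambda>e t. a * f e t + b * f' e t, \<lambda>e t. a * g e t + b * g' e t) \<in> ?A"
    if fg: "(f, g) \<in> ?A" "(f', g') \<in> ?A" for f g f' g' a b
  proof (rule AI)
    show "(\<lambda>e t. a * f e t + b * f' e t) \<in> L2 T" "(\<lambda>e t. a * g e t + b * g' e t) \<in> L2 T"
      by (intro L2_lincomb L[OF fg(1)] L[OF fg(2)])+
    fix h h' assume h: "(h, h') \<in> ?A"
    show "inner_L2 T h' (\<lambda>e t. a * f e t + b * f' e t) = inner_L2 T h (\<lambda>e t. a * g e t + b * g' e t)"
      unfolding inner_L2_lincomb[OF L(2)[OF h] L(1)[OF fg(1)] L(1)[OF fg(2)]]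
        inner_L2_lincomb[OF L(1)[OF h] L(2)[OF fg(1)] L(2)[OF fg(2)]] AD[OF fg(1) h] AD[OF fg(2) h] ..
  qed
  ultimately have "L2_operator T ?A" unfolding L2_operator_def by blast
  then show ?thesis unfolding self_adjoint_def using realisation_dense adj by blast
qed

lemma dirichlet_dom_eq: "dirichlet_dom T = operator_dom {root T}"
  by (simp add: dirichlet_dom_def operator_dom_def vanishes_at_def zero_at_root_def)

lemma neumann_dom_eq: "neumann_dom T = operator_dom {}"
  by (simp add: neumann_dom_def operator_dom_def)

lemma H1_0_eq: "H1_0 T = form_dom {root T}"
  by (simp add: H1_0_def form_dom_def vanishes_at_def zero_at_root_def)

lemma H1_eq: "H1 T = form_dom {}"
  by (simp add: form_dom_def)

end

theorem proposition3p2: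
  fixes T :: "('v, 'e) tree"
  assumes "metric_tree T"
  shows "(self_adjoint T (associated_op T (OU_form T) (H1_0 T)) \<and>
          associated_op T (OU_form T) (H1_0 T) = A_D T) \<and>
         (self_adjoint T (associated_op T (OU_form T) (H1 T)) \<and>
          associated_op T (OU_form T) (H1 T) = A_N T)"
proof -
  interpret metric_tree T by fact
  have root: "{root T} \<subseteq> verts (core T)" using root_in_verts by simp
  show ?thesis
    unfolding A_D_def A_N_def dirichlet_dom_eq neumann_dom_eq H1_0_eq H1_eq
      associated_op_eq_realisation(1)[OF root] associated_op_eq_realisation(1)[OF empty_subsetI]
    using self_adjoint_realisation[OF root] self_adjoint_realisation[OF empty_subsetI] by blast
qed

end
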